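(* Assume the Ultrapower Axiom. Then the seed order is antisymmetric: if \(U_0,U_1\) are uniform ultrafilters with \(U_0\leq_S U_1\) and \(U_1\leq_S U_0\), then \(U_0=U_1\).
   Context: For a countably complete ultrafilter \(U\), \(\mathrm{Ult}(V,U)\) denotes the transitive collapse of the ultrapower of \(V\) by \(U\), \(j_U\) the ultrapower embedding and \([\mathrm{id}]_U\) the class of the identity. A uniform ultrafilter is a countably complete ultrafilter \(U\) on \([\kappa]^n\) (the \(n\)-element subsets of an ordinal \(\kappa\)) such that \(\kappa\) is least with \([\kappa]^n\in U\); \(\mathrm{sp}(U)=\kappa\). Finite sets of ordinals are ordered by \(a<b\) iff the largest element of their symmetric difference lies in \(b\). A comparison of \(\langle U_0,U_1\rangle\) by internal ultrafilters is a pair \(\langle W_0,W_1\rangle\) with \(W_i\in\mathrm{Ult}(V,U_i)\) a countably complete ultrafilter in the sense of \(\mathrm{Ult}(V,U_i)\), such that \(\mathrm{Ult}(\mathrm{Ult}(V,U_0),W_0)=\mathrm{Ult}(\mathrm{Ult}(V,U_1),W_1)\) and \(j_{W_0}\circ j_{U_0}=j_{W_1}\circ j_{U_1}\). The Ultrapower Axiom: every pair of countably complete ultrafilters admits such a comparison. Seed order: \(U_0\leq_S U_1\) iff some comparison \(\langle W_0,W_1\rangle\) of \(\langle U_0,U_1\rangle\) has \(j_{W_0}([\mathrm{id}]_{U_0})\leq j_{W_1}([\mathrm{id}]_{U_1})\). *)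

theory Defs
  imports Main
begin

text \<open>
  Statements of ZFC are read in an arbitrary model of first-order ZFC: a set \<open>M\<close> with a binary
  relation \<open>\<epsilon>\<close>, neither of which need be standard or well-founded in the metatheory.
  Every set-theoretic notion is parametrised by \<open>(M, \<epsilon>)\<close> and quantifies over \<open>M\<close> only, so that
  instantiating \<open>M\<close> with an inner model \<open>N \<subseteq> M\<close> (same \<open>\<epsilon>\<close>) yields the notion in the sense of \<open>N\<close>.
\<close>

text \<open>First-order formulas of the language of set theory; variables are de Bruijn indices.\<close>

datatype fm = FMem nat nat | FEq nat nat | FNeg fm | FConj fm fm | FEx fm

locale mem_structure =
  fixes M :: "'v set"
    and E :: "'v \<Rightarrow> 'v \<Rightarrow> bool" (infix "\<epsilon>" 50)
begin

primrec sat :: "fm \<Rightarrow> (nat \<Rightarrow> 'v) \<Rightarrow> bool" where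
  "sat (FMem i k) s \<longleftrightarrow> s i \<epsilon> s k"
| "sat (FEq i k) s \<longleftrightarrow> s i = s k"
| "sat (FNeg \<phi>) s \<longleftrightarrow> \<not> sat \<phi> s"
| "sat (FConj \<phi> \<psi>) s \<longleftrightarrow> sat \<phi> s \<and> sat \<psi> s"
| "sat (FEx \<phi>) s \<longleftrightarrow> (\<exists>x\<in>M. sat \<phi> (case_nat x s))"

definition ext :: "'v \<Rightarrow> 'v set" where
  "ext a = {x \<in> M. x \<epsilon> a}"

definition inductive_set_in :: "'v \<Rightarrow> bool" where
  "inductive_set_in v \<longleftrightarrow> v \<in> M \<and> (\<exists>z\<in>ext v. ext z = {}) \<and>
     (\<forall>x\<in>ext v. \<exists>y\<in>ext v. ext y = insert x (ext x))"

definition omega :: "'v \<Rightarrow> bool" where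
  "omega w \<longleftrightarrow> inductive_set_in w \<and> (\<forall>v. inductive_set_in v \<longrightarrow> ext w \<subseteq> ext v)"

definition transitive_set :: "'v \<Rightarrow> bool" where
  "transitive_set a \<longleftrightarrow> (\<forall>x\<in>ext a. ext x \<subseteq> ext a)"

text \<open>Von Neumann ordinals; well-foundedness is supplied by the axiom of foundation.\<close>

definition ordinal :: "'v \<Rightarrow> bool" where
  "ordinal a \<longleftrightarrow> a \<in> M \<and> transitive_set a \<and> (\<forall>x\<in>ext a. transitive_set x)"

definition opair :: "'v \<Rightarrow> 'v \<Rightarrow> 'v \<Rightarrow> bool" where
  "opair p a b \<longleftrightarrow> (\<exists>u\<in>M. \<exists>v\<in>M. ext u = {a} \<and> ext v = {a, b} \<and> ext p = {u, v})"

definition func :: "'v \<Rightarrow> 'v \<Rightarrow> bool" where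
  "func f X \<longleftrightarrow> f \<in> M \<and> (\<forall>p\<in>ext f. \<exists>x\<in>ext X. \<exists>y\<in>M. opair p x y) \<and>
     (\<forall>x\<in>ext X. \<exists>!y. y \<in> M \<and> (\<exists>p\<in>ext f. opair p x y))"

definition app :: "'v \<Rightarrow> 'v \<Rightarrow> 'v" where
  "app f x = (THE y. y \<in> M \<and> (\<exists>p\<in>ext f. opair p x y))"

text \<open>The collection \<open>S\<close> is (the extension of) a member of \<open>U\<close>.\<close>

definition large :: "'v \<Rightarrow> 'v set \<Rightarrow> bool" where
  "large U S \<longleftrightarrow> (\<exists>A\<in>ext U. ext A = S)"

text \<open>
  Principal ultrafilters are included. Closure under binary intersections is the case of an
  eventually constant sequence.
\<close>

definition cc_ultrafilter_on :: "'v \<Rightarrow> 'v \<Rightarrow> bool" where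
  "cc_ultrafilter_on X U \<longleftrightarrow> X \<in> M \<and> U \<in> M \<and>
     (\<forall>A\<in>ext U. ext A \<subseteq> ext X) \<and>
     X \<in> ext U \<and> \<not> large U {} \<and>
     (\<forall>A\<in>ext U. \<forall>B\<in>M. ext A \<subseteq> ext B \<and> ext B \<subseteq> ext X \<longrightarrow> B \<in> ext U) \<and>
     (\<forall>A\<in>M. ext A \<subseteq> ext X \<longrightarrow> A \<in> ext U \<or> large U (ext X - ext A)) \<and>
     (\<forall>w s. omega w \<and> func s w \<and> (\<forall>n\<in>ext w. app s n \<in> ext U) \<longrightarrow>
        large U {x \<in> ext X. \<forall>n\<in>ext w. x \<epsilon> app s n})"

definition cc_ultrafilter :: "'v \<Rightarrow> bool" where
  "cc_ultrafilter U \<longleftrightarrow> (\<exists>X. cc_ultrafilter_on X U)"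

text \<open>The underlying set is determined by the ultrafilter, being its largest member.\<close>

definition space :: "'v \<Rightarrow> 'v" where
  "space U = (THE X. cc_ultrafilter_on X U)"

definition Fn :: "'v \<Rightarrow> 'v set" where
  "Fn U = {f. func f (space U)}"

definition ult_eq :: "'v \<Rightarrow> 'v \<Rightarrow> 'v \<Rightarrow> bool" where
  "ult_eq U f g \<longleftrightarrow> large U {x \<in> ext (space U). app f x = app g x}"

definition ult_mem :: "'v \<Rightarrow> 'v \<Rightarrow> 'v \<Rightarrow> bool" where
  "ult_mem U f g \<longleftrightarrow> large U {x \<in> ext (space U). app f x \<epsilon> app g x}"

text \<open>
  The transitive collapse \<open>\<pi>\<close> of the ultrapower, given by \<open>\<pi>[f] = {\<pi>[g] | [g] \<in>\<^sub>U [f]}\<close>, is a proper class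
  of the model. As usual for transfinite recursion it is the union of its set-sized approximations:
  functions \<open>p\<close> in the model, on a set \<open>D\<close> of representatives that is closed under \<open>\<in>\<^sub>U\<close>-predecessors
  up to \<open>=\<^sub>U\<close>, satisfying the recursion equation on \<open>D\<close>. (A function of the metatheory
  satisfying the equation would not do, as it need not be unique if \<open>\<epsilon>\<close> is not well-founded there.)
\<close>

definition collapse_approx :: "'v \<Rightarrow> 'v \<Rightarrow> 'v \<Rightarrow> bool" where
  "collapse_approx U D p \<longleftrightarrow> D \<in> M \<and> ext D \<subseteq> Fn U \<and> func p D \<and>
     (\<forall>f\<in>ext D. \<forall>g\<in>Fn U. ult_mem U g f \<longrightarrow> (\<exists>h\<in>ext D. ult_eq U g h)) \<and>
     (\<forall>f\<in>ext D. ext (app p f) = {app p g | g. g \<in> ext D \<and> ult_mem U g f})"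

definition collapse :: "'v \<Rightarrow> 'v \<Rightarrow> 'v" where
  "collapse U f = (THE y. \<exists>D p. collapse_approx U D p \<and> f \<in> ext D \<and> y = app p f)"

text \<open>
  \<open>Ult U\<close> is the transitive collapse of the ultrapower of \<open>M\<close> by \<open>U\<close>, \<open>j U\<close> the ultrapower embedding
  and \<open>seed U\<close> the class of the identity.
\<close>

definition Ult :: "'v \<Rightarrow> 'v set" where
  "Ult U = collapse U ` Fn U"

definition the_fn :: "'v \<Rightarrow> ('v \<Rightarrow> 'v) \<Rightarrow> 'v" where
  "the_fn U F = (THE f. f \<in> Fn U \<and> (\<forall>x\<in>ext (space U). app f x = F x))"

definition j :: "'v \<Rightarrow> 'v \<Rightarrow> 'v" where
  "j U x = collapse U (the_fn U (\<lambda>_. x))"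

definition seed :: "'v \<Rightarrow> 'v" where
  "seed U = collapse U (the_fn U (\<lambda>x. x))"

text \<open>The class \<open>[\<kappa>]\<^sup>n\<close>; here \<open>n\<close> is a natural number of the model, i.e. an element of its \<open>\<omega>\<close>.\<close>

definition subsets_of_size :: "'v \<Rightarrow> 'v \<Rightarrow> 'v set" where
  "subsets_of_size \<kappa> n =
     {a \<in> M. ext a \<subseteq> ext \<kappa> \<and> (\<exists>b. func b n \<and> bij_betw (app b) (ext n) (ext a))}"

definition uniform_ultrafilter :: "'v \<Rightarrow> bool" where
  "uniform_ultrafilter U \<longleftrightarrow>
     (\<exists>\<kappa> n w X. ordinal \<kappa> \<and> omega w \<and> n \<in> ext w \<and> ext X = subsets_of_size \<kappa> n \<and>
        cc_ultrafilter_on X U \<and> (\<forall>\<alpha>\<in>ext \<kappa>. \<not> large U (subsets_of_size \<alpha> n)))"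

text \<open>The order on finite sets of ordinals; the order on the ordinals themselves is \<open>\<epsilon>\<close>.\<close>

definition finset_less :: "'v \<Rightarrow> 'v \<Rightarrow> bool" where
  "finset_less a b \<longleftrightarrow> (\<exists>x \<in> ext b - ext a.
     \<forall>y \<in> (ext a - ext b) \<union> (ext b - ext a). y = x \<or> y \<epsilon> x)"

definition finset_le :: "'v \<Rightarrow> 'v \<Rightarrow> bool" where
  "finset_le a b \<longleftrightarrow> finset_less a b \<or> a = b"

definition comparison :: "'v \<Rightarrow> 'v \<Rightarrow> 'v \<Rightarrow> 'v \<Rightarrow> bool" where
  "comparison U\<^sub>0 U\<^sub>1 W\<^sub>0 W\<^sub>1 \<longleftrightarrow>
     mem_structure.cc_ultrafilter (Ult U\<^sub>0) (\<epsilon>) W\<^sub>0 \<and>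
     mem_structure.cc_ultrafilter (Ult U\<^sub>1) (\<epsilon>) W\<^sub>1 \<and>
     mem_structure.Ult (Ult U\<^sub>0) (\<epsilon>) W\<^sub>0 = mem_structure.Ult (Ult U\<^sub>1) (\<epsilon>) W\<^sub>1 \<and>
     (\<forall>x\<in>M. mem_structure.j (Ult U\<^sub>0) (\<epsilon>) W\<^sub>0 (j U\<^sub>0 x) = mem_structure.j (Ult U\<^sub>1) (\<epsilon>) W\<^sub>1 (j U\<^sub>1 x))"

definition ultrapower_axiom :: bool where
  "ultrapower_axiom \<longleftrightarrow> (\<forall>U\<^sub>0 U\<^sub>1. cc_ultrafilter U\<^sub>0 \<and> cc_ultrafilter U\<^sub>1 \<longrightarrow>
     (\<exists>W\<^sub>0 W\<^sub>1. comparison U\<^sub>0 U\<^sub>1 W\<^sub>0 W\<^sub>1))"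

definition seed_le :: "'v \<Rightarrow> 'v \<Rightarrow> bool" where
  "seed_le U\<^sub>0 U\<^sub>1 \<longleftrightarrow> (\<exists>W\<^sub>0 W\<^sub>1. comparison U\<^sub>0 U\<^sub>1 W\<^sub>0 W\<^sub>1 \<and>
     finset_le (mem_structure.j (Ult U\<^sub>0) (\<epsilon>) W\<^sub>0 (seed U\<^sub>0))
               (mem_structure.j (Ult U\<^sub>1) (\<epsilon>) W\<^sub>1 (seed U\<^sub>1)))"

end

text \<open>
  First-order ZFC. Separation and replacement are schemas over \<^typ>\<open>fm\<close>; the assignment \<open>s\<close> supplies
  the parameters.
\<close>

locale zfc_model = mem_structure M E
  for M :: "'v set" and E :: "'v \<Rightarrow> 'v \<Rightarrow> bool" (infix "\<epsilon>" 50) +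
  assumes extensionality: "\<lbrakk>a \<in> M; b \<in> M; ext a = ext b\<rbrakk> \<Longrightarrow> a = b"
    and foundation: "\<lbrakk>a \<in> M; ext a \<noteq> {}\<rbrakk> \<Longrightarrow> \<exists>x\<in>ext a. ext x \<inter> ext a = {}"
    and pairing: "\<lbrakk>a \<in> M; b \<in> M\<rbrakk> \<Longrightarrow> \<exists>c\<in>M. ext c = {a, b}"
    and union: "a \<in> M \<Longrightarrow> \<exists>c\<in>M. ext c = (\<Union>x\<in>ext a. ext x)"
    and powerset: "a \<in> M \<Longrightarrow> \<exists>c\<in>M. ext c = {x \<in> M. ext x \<subseteq> ext a}"
    and infinity: "\<exists>v. inductive_set_in v"
    and separation: "\<lbrakk>a \<in> M; range s \<subseteq> M\<rbrakk> \<Longrightarrow>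
      \<exists>c\<in>M. ext c = {x \<in> ext a. sat \<phi> (case_nat x s)}"
    and replacement: "\<lbrakk>a \<in> M; range s \<subseteq> M;
        \<And>x. x \<in> ext a \<Longrightarrow> \<exists>!y. y \<in> M \<and> sat \<phi> (case_nat x (case_nat y s))\<rbrakk> \<Longrightarrow>
      \<exists>c\<in>M. ext c = {y \<in> M. \<exists>x\<in>ext a. sat \<phi> (case_nat x (case_nat y s))}"
    and choice: "\<lbrakk>a \<in> M; \<And>x. x \<in> ext a \<Longrightarrow> ext x \<noteq> {};
        \<And>x y. \<lbrakk>x \<in> ext a; y \<in> ext a; x \<noteq> y\<rbrakk> \<Longrightarrow> ext x \<inter> ext y = {}\<rbrakk> \<Longrightarrow>
      \<exists>c\<in>M. \<forall>x\<in>ext a. \<exists>!z. z \<in> ext x \<inter> ext c"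

end

theory Submission
  imports Defs
begin

text \<open>
  Suppose a comparison \<open>\<langle>W\<^sub>0, W\<^sub>1\<rangle>\<close> sends the seed of \<open>U\<^sub>0\<close> strictly below the seed of \<open>U\<^sub>1\<close>. Representing \<open>W\<^sub>1\<close>
  and the image of the seed of \<open>U\<^sub>0\<close> modulo \<open>U\<^sub>1\<close> exhibits \<open>U\<^sub>0\<close> as a \<open>U\<^sub>1\<close>-limit of families of sets \<open>F a\<close>, each
  concentrating on the predecessors of \<open>a\<close>: a set \<open>A\<close> belongs to \<open>U\<^sub>0\<close> iff \<open>A \<in> F a\<close> for \<open>U\<^sub>1\<close>-almost all \<open>a\<close>, and
  \<open>A \<in> F a\<close> depends only on \<open>{z \<in> A. z < a}\<close>. If \<open>U\<^sub>1\<close> is in the same way a \<open>U\<^sub>0\<close>-limit of families \<open>G b\<close>, then by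
  recursion along the well-founded order of finite sets of ordinals there are \<open>S\<^sub>0\<close> and \<open>S\<^sub>1\<close> with
  \<open>b \<in> S\<^sub>0 \<longleftrightarrow> S\<^sub>1 \<in> G b\<close> and \<open>a \<in> S\<^sub>1 \<longleftrightarrow> S\<^sub>0 \<notin> F a\<close>, whence \<open>S\<^sub>0 \<in> U\<^sub>0 \<longleftrightarrow> S\<^sub>1 \<notin> U\<^sub>1 \<longleftrightarrow> S\<^sub>0 \<notin> U\<^sub>0\<close>. So
  in one of the two comparisons the images of the seeds coincide, and then \<open>A \<in> U\<^sub>0\<close> iff \<open>A \<in> U\<^sub>1\<close>, because membership
  is decided by whether the seed lies in the image of \<open>A\<close>. As the model need not be well-founded, the well-foundedness of
  ultrapowers and of the order on finite sets has to be argued inside the model.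
\<close>

text \<open>The two inequalities may be witnessed by unrelated comparisons, whose iterated
  ultrapowers can be different models. The images of the seeds in one say nothing directly about
  those in the other, so antisymmetry of the order on finite sets does not settle the matter.
  Passing to the families \<open>F a\<close> and \<open>G b\<close> pulls both comparisons back to
  the ground model, where they can be played against each other. Every collection used on the way
  has to be a set of the model, and this dictates the machinery. One calculus of definability admits
  parameters and feeds separation and replacement. Another one, for formulas without parameters that
  are read in several structures at once, feeds the theorem of Los. Los in turn makes the ultrapower
  a model of ZFC, so that what is proved about a single ultrafilter also holds for
  \<open>W\<^sub>0\<close> and \<open>W\<^sub>1\<close>, which are ultrafilters only in the sense of
  their ultrapowers.\<close>

primrec rename_fm :: "(nat \<Rightarrow> nat) \<Rightarrow> fm \<Rightarrow> fm" where
  "rename_fm r (FMem i k) = FMem (r i) (r k)"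
| "rename_fm r (FEq i k) = FEq (r i) (r k)"
| "rename_fm r (FNeg \<phi>) = FNeg (rename_fm r \<phi>)"
| "rename_fm r (FConj \<phi> \<psi>) = FConj (rename_fm r \<phi>) (rename_fm r \<psi>)"
| "rename_fm r (FEx \<phi>) = FEx (rename_fm (case_nat 0 (\<lambda>i. Suc (r i))) \<phi>)"

lemma range_case_nat: "range (case_nat x s) \<subseteq> M \<longleftrightarrow> x \<in> M \<and> range s \<subseteq> M"
proof
  assume *: "range (case_nat x s) \<subseteq> M"
  have "case_nat x s 0 \<in> M" "case_nat x s (Suc i) \<in> M" for i using * by blast+
  then show "x \<in> M \<and> range s \<subseteq> M" by auto
next
  assume *: "x \<in> M \<and> range s \<subseteq> M"
  have "case_nat x s i \<in> M" for i using * by (cases i) auto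
  then show "range (case_nat x s) \<subseteq> M" by blast
qed

text \<open>Renaming variables is the basic syntactic operation of the definability calculi:
  assignments are merged, split and shifted by reindexing them.\<close>

lemma (in mem_structure) sat_rename: "sat (rename_fm r \<phi>) s = sat \<phi> (\<lambda>i. s (r i))"
proof (induction \<phi> arbitrary: r s)
  case (FEx \<phi>)
  have "(\<lambda>i. case_nat x s (case_nat 0 (\<lambda>i. Suc (r i)) i)) = case_nat x (\<lambda>i. s (r i))" for x
    by (rule ext) (simp split: nat.split)
  then show ?case using FEx by simp
qed auto

subsection \<open>Uniform definability\<close>

text \<open>One formula, without parameters, has to work for every carrier at once; only then can
  the same predicate be read both in a model and in its ultrapower. Hence \<open>P\<close> takes the
  carrier as an argument.\<close>

definition udefinable :: "('v \<Rightarrow> 'v \<Rightarrow> bool) \<Rightarrow> ('v set \<Rightarrow> (nat \<Rightarrow> 'v) \<Rightarrow> bool) \<Rightarrow> bool" where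
  "udefinable E P \<longleftrightarrow>
     (\<exists>\<phi>. \<forall>M s. range s \<subseteq> M \<longrightarrow> P M s = mem_structure.sat M E \<phi> s)"

named_theorems udefinable_intros

lemma udef_mem [udefinable_intros]: "udefinable E (\<lambda>M s. E (s i) (s k))"
  unfolding udefinable_def by (rule exI[of _ "FMem i k"]) (simp add: mem_structure.sat.simps)

lemma udef_eq [udefinable_intros]: "udefinable E (\<lambda>M s. s i = s k)"
  unfolding udefinable_def by (rule exI[of _ "FEq i k"]) (simp add: mem_structure.sat.simps)

lemma udef_not [udefinable_intros]:
  assumes "udefinable E P" shows "udefinable E (\<lambda>M s. \<not> P M s)"
proof -
  obtain \<phi> where "\<forall>M s. range s \<subseteq> M \<longrightarrow> P M s = mem_structure.sat M E \<phi> s"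
    using assms unfolding udefinable_def by blast
  then show ?thesis
    unfolding udefinable_def by (intro exI[of _ "FNeg \<phi>"]) (simp add: mem_structure.sat.simps)
qed

lemma udef_conj [udefinable_intros]:
  assumes "udefinable E P" "udefinable E Q" shows "udefinable E (\<lambda>M s. P M s \<and> Q M s)"
proof -
  obtain \<phi> \<psi> where "\<forall>M s. range s \<subseteq> M \<longrightarrow> P M s = mem_structure.sat M E \<phi> s"
      "\<forall>M s. range s \<subseteq> M \<longrightarrow> Q M s = mem_structure.sat M E \<psi> s"
    using assms unfolding udefinable_def by blast
  then show ?thesis
    unfolding udefinable_def by (intro exI[of _ "FConj \<phi> \<psi>"]) (simp add: mem_structure.sat.simps)
qed

lemma udef_disj [udefinable_intros]:
  assumes "udefinable E P" "udefinable E Q" shows "udefinable E (\<lambda>M s. P M s \<or> Q M s)"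
  using udef_not[OF udef_conj[OF udef_not[OF assms(1)] udef_not[OF assms(2)]]] by simp

lemma udef_imp [udefinable_intros]:
  assumes "udefinable E P" "udefinable E Q" shows "udefinable E (\<lambda>M s. P M s \<longrightarrow> Q M s)"
  using udef_not[OF udef_conj[OF assms(1) udef_not[OF assms(2)]]] by simp

lemma udef_iff [udefinable_intros]:
  assumes "udefinable E P" "udefinable E Q" shows "udefinable E (\<lambda>M s. P M s \<longleftrightarrow> Q M s)"
  using udef_conj[OF udef_imp[OF assms] udef_imp[OF assms(2,1)]]
  by (simp add: iff_conv_conj_imp)

text \<open>The premise is the body after a de Bruijn shift: the bound element becomes
  \<open>s 0\<close> and the old variables move up by one. In this form
  \<open>intro udefinable_intros\<close> finds the formula by higher-order unification.\<close>

lemma udef_ex [udefinable_intros]: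
  assumes "udefinable E (\<lambda>M s. P M (\<lambda>i. s (Suc i)) (s 0))"
  shows "udefinable E (\<lambda>M s. \<exists>x\<in>M. P M s x)"
proof -
  obtain \<phi> where \<phi>: "\<And>M s. range s \<subseteq> M \<Longrightarrow>
      P M (\<lambda>i. s (Suc i)) (s 0) = mem_structure.sat M E \<phi> s"
    using assms unfolding udefinable_def by blast
  have "P M s x = mem_structure.sat M E \<phi> (case_nat x s)" if "x \<in> M" "range s \<subseteq> M" for M s x
    using \<phi>[of "case_nat x s" M] that by (simp add: range_case_nat)
  then show ?thesis
    unfolding udefinable_def by (intro exI[of _ "FEx \<phi>"]) (simp add: mem_structure.sat.simps)
qed

lemma udef_all [udefinable_intros]:
  assumes "udefinable E (\<lambda>M s. P M (\<lambda>i. s (Suc i)) (s 0))"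
  shows "udefinable E (\<lambda>M s. \<forall>x\<in>M. P M s x)"
  using udef_not[OF udef_ex[OF udef_not[OF assms]]] by simp

lemma udef_sat [udefinable_intros]: "udefinable E (\<lambda>M s. mem_structure.sat M E \<phi> (\<lambda>i. s (r i)))"
  unfolding udefinable_def
  by (rule exI[of _ "rename_fm r \<phi>"]) (metis mem_structure.sat_rename)

lemma udef_cong:
  assumes "udefinable E Q" "\<And>M s. range s \<subseteq> M \<Longrightarrow> P M s = Q M s"
  shows "udefinable E P"
  using assms unfolding udefinable_def by metis

text \<open>An equation such as \<open>ext u = {a}\<close> between sets of the metatheory is not a
  formula. For \<open>a\<close> and \<open>b\<close> in \<open>M\<close> it becomes an equivalence
  quantified over \<open>M\<close>; for \<open>a\<close> outside \<open>M\<close> the two readings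
  would differ, as no \<open>ext u\<close> contains \<open>a\<close>.\<close>

lemma (in mem_structure) opair_iff:
  assumes "a \<in> M" "b \<in> M"
  shows "opair p a b \<longleftrightarrow> (\<exists>u\<in>M. \<exists>v\<in>M. (\<forall>z\<in>M. z \<epsilon> u \<longleftrightarrow> z = a) \<and>
    (\<forall>z\<in>M. z \<epsilon> v \<longleftrightarrow> z = a \<or> z = b) \<and> (\<forall>z\<in>M. z \<epsilon> p \<longleftrightarrow> z = u \<or> z = v))"
proof -
  have *: "ext u = S \<longleftrightarrow> (\<forall>z\<in>M. z \<epsilon> u \<longleftrightarrow> z \<in> S)" if "S \<subseteq> M" for u S
    using that by (auto simp: ext_def)
  show ?thesis
    unfolding opair_def using assms by (simp add: * cong: bex_cong)
qed

lemma udef_opair [udefinable_intros]: "udefinable E (\<lambda>M s. mem_structure.opair M E (s i) (s k) (s l))"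
proof (rule udef_cong)
  show "udefinable E (\<lambda>M s. \<exists>u\<in>M. \<exists>v\<in>M. (\<forall>z\<in>M. E z u \<longleftrightarrow> z = s k) \<and>
    (\<forall>z\<in>M. E z v \<longleftrightarrow> z = s k \<or> z = s l) \<and> (\<forall>z\<in>M. E z (s i) \<longleftrightarrow> z = u \<or> z = v))"
    by (intro udefinable_intros)
qed (rule mem_structure.opair_iff; blast)

text \<open>Separation and replacement put one or two elements in front of the parameters. With
  these shapes an instance of the schemas for a fixed \<open>\<phi>\<close> is recognised as a
  single formula.\<close>

lemma udef_sat1 [udefinable_intros]:
  "udefinable E (\<lambda>M s. mem_structure.sat M E \<phi> (case_nat (s a) (\<lambda>i. s (r i))))"
proof -
  have "(\<lambda>i. s (case_nat a r i)) = case_nat (s a) (\<lambda>i. s (r i))" for s :: "nat \<Rightarrow> 'a"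
    by (rule ext) (simp split: nat.split)
  then show ?thesis using udef_sat[of E \<phi> "case_nat a r"] by simp
qed

lemma udef_sat2 [udefinable_intros]:
  "udefinable E (\<lambda>M s. mem_structure.sat M E \<phi> (case_nat (s a) (case_nat (s b) (\<lambda>i. s (r i)))))"
proof -
  have "(\<lambda>i. s (case_nat b r i)) = case_nat (s b) (\<lambda>i. s (r i))" for s :: "nat \<Rightarrow> 'a"
    by (rule ext) (simp split: nat.split)
  then show ?thesis using udef_sat1[of E \<phi> a "case_nat b r"] by simp
qed

lemma (in mem_structure) finset_less_iff:
  "finset_less a b \<longleftrightarrow> (\<exists>x\<in>M. x \<epsilon> b \<and> \<not> x \<epsilon> a \<and>
     (\<forall>y\<in>M. (y \<epsilon> a \<and> \<not> y \<epsilon> b) \<or> (y \<epsilon> b \<and> \<not> y \<epsilon> a) \<longrightarrow> y = x \<or> y \<epsilon> x))"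
  unfolding finset_less_def ext_def by blast

lemma udef_finset_less [udefinable_intros]: "udefinable E (\<lambda>M s. mem_structure.finset_less M E (s i) (s k))"
  unfolding mem_structure.finset_less_iff by (intro udefinable_intros)

subsection \<open>Definability with parameters\<close>

context zfc_model
begin

definition interleave :: "(nat \<Rightarrow> 'v) \<Rightarrow> (nat \<Rightarrow> 'v) \<Rightarrow> nat \<Rightarrow> 'v" where
  "interleave s t i = (if even i then s (i div 2) else t (i div 2))"

text \<open>The even variables are the arguments of the predicate, the odd ones its parameters.\<close>

definition definable :: "((nat \<Rightarrow> 'v) \<Rightarrow> bool) \<Rightarrow> bool" where
  "definable P \<longleftrightarrow> (\<exists>\<phi> t. range t \<subseteq> M \<and>
     (\<forall>s. range s \<subseteq> M \<longrightarrow> P s = sat \<phi> (interleave s t)))"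

text \<open>Totality on \<open>M\<close> is part of the notion because substituting
  \<open>F s\<close> into a predicate \<open>P\<close> is expressed as
  \<open>\<exists>x\<in>M. x = F s \<and> P s x\<close>. Operations that are meaningful on part of
  \<open>M\<close> only therefore receive default values.\<close>

definition definable_fun :: "((nat \<Rightarrow> 'v) \<Rightarrow> 'v) \<Rightarrow> bool" where
  "definable_fun F \<longleftrightarrow> (\<forall>s. range s \<subseteq> M \<longrightarrow> F s \<in> M) \<and>
     definable (\<lambda>s. s 0 = F (\<lambda>i. s (Suc i)))"

named_theorems definable_intros

lemma interleave_M: "range s \<subseteq> M \<Longrightarrow> range t \<subseteq> M \<Longrightarrow> range (interleave s t) \<subseteq> M"
  unfolding interleave_def by (auto split: if_splits)

lemma M_nonempty: "\<exists>c. c \<in> M"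
  using infinity unfolding inductive_set_in_def by blast

lemma definable_cong:
  "definable Q \<Longrightarrow> (\<And>s. range s \<subseteq> M \<Longrightarrow> P s = Q s) \<Longrightarrow> definable P"
  unfolding definable_def by metis

lemma def_sat_var: "definable (\<lambda>s. sat \<phi> (\<lambda>i. s (r i)))"
proof -
  obtain c where "c \<in> M" using M_nonempty by blast
  then show ?thesis unfolding definable_def
    by (intro exI[of _ "rename_fm (\<lambda>i. 2 * r i) \<phi>"] exI[of _ "\<lambda>_. c"])
       (auto simp: sat_rename interleave_def)
qed

lemma def_mem_var: "definable (\<lambda>s. s i \<epsilon> s k)"
  using def_sat_var[of "FMem i k" id] by simp

lemma def_eq_var: "definable (\<lambda>s. s i = s k)"
  using def_sat_var[of "FEq i k" id] by simp

lemma def_eq_const: "c \<in> M \<Longrightarrow> definable (\<lambda>s. s i = c)"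
  unfolding definable_def
  by (rule exI[of _ "FEq (2 * i) 1"], rule exI[of _ "\<lambda>_. c"]) (auto simp: interleave_def)

lemma def_not [definable_intros]:
  assumes "definable P" shows "definable (\<lambda>s. \<not> P s)"
proof -
  obtain \<phi> t where "range t \<subseteq> M" "\<forall>s. range s \<subseteq> M \<longrightarrow> P s = sat \<phi> (interleave s t)"
    using assms unfolding definable_def by blast
  then show ?thesis unfolding definable_def by (intro exI[of _ "FNeg \<phi>"] exI[of _ t]) simp
qed

lemma def_conj [definable_intros]:
  assumes "definable P" "definable Q" shows "definable (\<lambda>s. P s \<and> Q s)"
proof -
  obtain \<phi> t where 1: "range t \<subseteq> M" "\<And>s. range s \<subseteq> M \<Longrightarrow> P s = sat \<phi> (interleave s t)"
    using assms unfolding definable_def by blast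
  obtain \<psi> u where 2: "range u \<subseteq> M" "\<And>s. range s \<subseteq> M \<Longrightarrow> Q s = sat \<psi> (interleave s u)"
    using assms unfolding definable_def by blast
  \<comment> \<open>In \<open>interleave s (interleave t u)\<close> the parameter \<open>t k\<close>
    stands at place \<open>2 * (2 * k) + 1\<close> and \<open>u k\<close> at place
    \<open>2 * (2 * k + 1) + 1\<close>; the arguments stay where they are.\<close>
  define f where "f i = (if even i then i else 4 * (i div 2) + 1)" for i :: nat
  define g where "g i = (if even i then i else 4 * (i div 2) + 3)" for i :: nat
  have *: "(\<lambda>i. interleave s (interleave t u) (f i)) = interleave s t"
    and **: "(\<lambda>i. interleave s (interleave t u) (g i)) = interleave s u" for s
  proof -
    have "interleave s (interleave t u) (f i) = interleave s t i \<and>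
      interleave s (interleave t u) (g i) = interleave s u i" for i
    proof (cases "even i")
      case False
      then obtain k where k: "i = 2 * k + 1" by (auto elim: oddE)
      have "(4 * k + 1) div 2 = 2 * k" "(4 * k + 3) div 2 = 2 * k + 1" "i div 2 = k"
        "odd (4 * k + 1)" "odd (4 * k + 3)" using k by presburger+
      then show ?thesis using False unfolding interleave_def f_def g_def by simp
    qed (simp add: interleave_def f_def g_def)
    then show "(\<lambda>i. interleave s (interleave t u) (f i)) = interleave s t"
      "(\<lambda>i. interleave s (interleave t u) (g i)) = interleave s u" by auto
  qed
  have "P s = sat (rename_fm f \<phi>) (interleave s (interleave t u))"
    "Q s = sat (rename_fm g \<psi>) (interleave s (interleave t u))" if "range s \<subseteq> M" for s
    unfolding sat_rename * ** using 1(2) 2(2) that by auto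
  then show ?thesis
    unfolding definable_def using interleave_M[OF 1(1) 2(1)]
    by (intro exI[of _ "FConj (rename_fm f \<phi>) (rename_fm g \<psi>)"] exI[of _ "interleave t u"])
       (auto simp only: sat.simps)
qed

lemma def_disj [definable_intros]:
  assumes "definable P" "definable Q" shows "definable (\<lambda>s. P s \<or> Q s)"
  using def_not[OF def_conj[OF def_not[OF assms(1)] def_not[OF assms(2)]]] by simp

lemma def_imp [definable_intros]:
  assumes "definable P" "definable Q" shows "definable (\<lambda>s. P s \<longrightarrow> Q s)"
  using def_not[OF def_conj[OF assms(1) def_not[OF assms(2)]]] by simp

lemma def_iff [definable_intros]:
  assumes "definable P" "definable Q" shows "definable (\<lambda>s. P s \<longleftrightarrow> Q s)"
  using def_conj[OF def_imp[OF assms] def_imp[OF assms(2,1)]]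
  by (simp add: iff_conv_conj_imp)

lemma def_ex [definable_intros]:
  assumes "definable (\<lambda>s. P (\<lambda>i. s (Suc i)) (s 0))"
  shows "definable (\<lambda>s. \<exists>x\<in>M. P s x)"
proof -
  obtain \<phi> t where t: "range t \<subseteq> M"
    and \<phi>: "\<And>s. range s \<subseteq> M \<Longrightarrow> P (\<lambda>i. s (Suc i)) (s 0) = sat \<phi> (interleave s t)"
    using assms unfolding definable_def by metis
  \<comment> \<open>Putting \<open>x\<close> in front of \<open>interleave s t\<close> shifts every
    place by one, whereas \<open>interleave (case_nat x s) t\<close> moves the arguments by two
    places and leaves the parameters alone. The difference is minus one at even places and plus one
    at odd ones.\<close>
  define r where "r i = (if i = 0 then 0 else if even i then i - 1 else i + 1)" for i :: nat
  have *: "(\<lambda>i. case_nat x (interleave s t) (r i)) = interleave (case_nat x s) t" for x s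
  proof
    fix i :: nat
    have "i = 0 \<or> (\<exists>k. i = 2 * k + 2) \<or> (\<exists>k. i = 2 * k + 1)" by presburger
    then consider "i = 0" | k where "i = 2 * k + 2" | k where "i = 2 * k + 1" by blast
    then show "case_nat x (interleave s t) (r i) = interleave (case_nat x s) t i"
      by cases (auto simp: r_def interleave_def)
  qed
  have "P s x = sat (rename_fm r \<phi>) (case_nat x (interleave s t))"
    if "x \<in> M" "range s \<subseteq> M" for s x
    using \<phi>[of "case_nat x s"] that by (simp add: sat_rename * range_case_nat)
  then show ?thesis
    unfolding definable_def using t
    by (intro exI[of _ "FEx (rename_fm r \<phi>)"] exI[of _ t]) simp
qed

lemma def_all [definable_intros]:
  assumes "definable (\<lambda>s. P (\<lambda>i. s (Suc i)) (s 0))"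
  shows "definable (\<lambda>s. \<forall>x\<in>M. P s x)"
  using def_not[OF def_ex[OF def_not[OF assms]]] by simp

lemma definable_rename:
  assumes "definable P" shows "definable (\<lambda>s. P (\<lambda>i. s (r i)))"
proof -
  obtain \<phi> t where t: "range t \<subseteq> M"
    and \<phi>: "\<And>s. range s \<subseteq> M \<Longrightarrow> P s = sat \<phi> (interleave s t)"
    using assms unfolding definable_def by blast
  define q where "q i = (if even i then 2 * r (i div 2) else i)" for i
  have *: "(\<lambda>i. interleave s t (q i)) = interleave (\<lambda>i. s (r i)) t" for s
    by (rule ext) (auto simp: interleave_def q_def)
  have "P (\<lambda>i. s (r i)) = sat (rename_fm q \<phi>) (interleave s t)" if "range s \<subseteq> M" for s
    using \<phi>[of "\<lambda>i. s (r i)"] that by (auto simp add: sat_rename *)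
  then show ?thesis unfolding definable_def using t by blast
qed

lemma defun_M: "definable_fun F \<Longrightarrow> range s \<subseteq> M \<Longrightarrow> F s \<in> M"
  unfolding definable_fun_def by blast

lemma defun_eq_var:
  assumes "definable_fun F" shows "definable (\<lambda>s. s i = F (\<lambda>k. s (r k)))"
proof -
  have "definable (\<lambda>s. s 0 = F (\<lambda>i. s (Suc i)))"
    using assms unfolding definable_fun_def by blast
  from definable_rename[OF this, of "case_nat i r"] show ?thesis by simp
qed

lemma def_subst:
  assumes P: "definable (\<lambda>s. P (\<lambda>i. s (Suc i)) (s 0))" and F: "definable_fun F"
  shows "definable (\<lambda>s. P s (F s))"
proof -
  have "definable (\<lambda>s. \<exists>x\<in>M. x = F s \<and> P s x)"
    by (intro definable_intros defun_eq_var F P)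
  then show ?thesis
    by (rule definable_cong) (use defun_M[OF F] in blast)
qed

lemma defun_var [definable_intros]: "definable_fun (\<lambda>s. s i)"
  unfolding definable_fun_def using def_eq_var by blast

lemma defun_const [definable_intros]: "c \<in> M \<Longrightarrow> definable_fun (\<lambda>s. c)"
  unfolding definable_fun_def using def_eq_const by blast

lemma defun_rename: 
  assumes "definable_fun F" shows "definable_fun (\<lambda>s. F (\<lambda>i. s (r i)))"
  unfolding definable_fun_def
proof (intro conjI allI impI)
  show "F (\<lambda>i. s (r i)) \<in> M" if "range s \<subseteq> M" for s
    by (rule defun_M[OF assms]) (use that in blast)
  show "definable (\<lambda>s. s 0 = F (\<lambda>i. s (Suc (r i))))"
    by (rule defun_eq_var[OF assms])
qed

lemma def_mem [definable_intros]:
  assumes "definable_fun F" "definable_fun G" shows "definable (\<lambda>s. F s \<epsilon> G s)"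
  by (rule def_subst[OF _ assms(1)], rule def_subst[OF _ defun_rename[OF assms(2)]])
     (rule def_mem_var)

lemma def_eq [definable_intros]:
  assumes "definable_fun F" "definable_fun G" shows "definable (\<lambda>s. F s = G s)"
  by (rule def_subst[OF _ assms(1)]) (rule defun_eq_var[OF assms(2)])

lemma def_sat:
  assumes "\<And>i. definable_fun (F i)" shows "definable (\<lambda>s. sat \<phi> (\<lambda>i. F i s))"
  using assms
proof (induction \<phi> arbitrary: F)
  case (FEx \<phi>)
  have "definable (\<lambda>s. sat \<phi> (\<lambda>i. case_nat (\<lambda>s. s 0) (\<lambda>i s. F i (\<lambda>k. s (Suc k))) i s))"
    by (rule FEx.IH) (auto intro: definable_intros defun_rename FEx.prems split: nat.split)
  moreover have "(\<lambda>i. case_nat (\<lambda>s. s 0) (\<lambda>i s. F i (\<lambda>k. s (Suc k))) i s) =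
      case_nat (s 0) (\<lambda>i. F i (\<lambda>k. s (Suc k)))" for s
    by (rule ext) (simp split: nat.split)
  ultimately show ?case by (simp add: def_ex)
qed (simp_all add: definable_intros)

text \<open>A notion that is definable in the variables \<open>s 0\<close>, \<open>s 1\<close> and
  so on is definable for arbitrary definable terms in their place. Through the corollaries for one,
  two and three arguments, most new notions enter \<open>definable_intros\<close> this way.\<close>

lemma def_inst:
  assumes "definable P" "\<And>i. definable_fun (F i)" shows "definable (\<lambda>s. P (\<lambda>i. F i s))"
proof -
  obtain \<phi> t where t: "range t \<subseteq> M"
    and \<phi>: "\<And>s. range s \<subseteq> M \<Longrightarrow> P s = sat \<phi> (interleave s t)"
    using assms unfolding definable_def by blast
  have "definable (\<lambda>s. sat \<phi> (\<lambda>i. (if even i then F (i div 2) else (\<lambda>s. t (i div 2))) s))"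
    by (rule def_sat) (use t assms(2) in \<open>auto intro: definable_intros\<close>)
  moreover have "(\<lambda>i. (if even i then F (i div 2) else (\<lambda>s. t (i div 2))) s) =
      interleave (\<lambda>i. F i s) t" for s
    by (rule ext) (simp add: interleave_def)
  ultimately have "definable (\<lambda>s. sat \<phi> (interleave (\<lambda>i. F i s) t))" by simp
  then show ?thesis
    by (rule definable_cong) (rule \<phi>, use defun_M[OF assms(2)] in blast)
qed

lemma def_inst1:
  assumes "definable (\<lambda>s. P (s 0))" "definable_fun F"
  shows "definable (\<lambda>s. P (F s))"
  using def_inst[OF assms(1), of "\<lambda>_. F"] assms(2) by simp

lemma def_inst2:
  assumes "definable (\<lambda>s. P (s 0) (s 1))" "definable_fun F" "definable_fun G"
  shows "definable (\<lambda>s. P (F s) (G s))"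
  using def_inst[OF assms(1), of "\<lambda>i. if i = 0 then F else G"] assms(2,3) by simp

lemma def_inst3:
  assumes "definable (\<lambda>s. P (s 0) (s 1) (s 2))" "definable_fun F" "definable_fun G" "definable_fun H"
  shows "definable (\<lambda>s. P (F s) (G s) (H s))"
  using def_inst[OF assms(1), of "\<lambda>i. if i = 0 then F else if i = 1 then G else H"] assms(2-)
  by simp

lemma definable_funI:
  assumes "\<And>s. range s \<subseteq> M \<Longrightarrow> F s \<in> M" "definable (\<lambda>s. Q (\<lambda>i. s (Suc i)) (s 0))"
    "\<And>s y. range s \<subseteq> M \<Longrightarrow> y \<in> M \<Longrightarrow> y = F s \<longleftrightarrow> Q s y"
  shows "definable_fun F"
  unfolding definable_fun_def
proof (intro conjI allI impI)
  show "definable (\<lambda>s. s 0 = F (\<lambda>i. s (Suc i)))"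
    by (rule definable_cong[OF assms(2)]) (rule assms(3); blast)
qed (rule assms(1))

lemma defun_inst1:
  assumes "definable_fun (\<lambda>s. H (s 0))" "definable_fun F"
  shows "definable_fun (\<lambda>s. H (F s))"
proof (rule definable_funI[where Q = "\<lambda>s y. y = H (F s)"])
  show "H (F s) \<in> M" if "range s \<subseteq> M" for s
    using defun_M[OF assms(1), of "\<lambda>_. F s"] defun_M[OF assms(2) that] by auto
  have "definable (\<lambda>s. s 1 = H (s 0))" using defun_eq_var[OF assms(1), of 1 id] by simp
  then show "definable (\<lambda>s. s 0 = H (F (\<lambda>i. s (Suc i))))"
    by (rule def_inst2[where P = "\<lambda>x y. y = H x", OF _ defun_rename[OF assms(2)] defun_var])
qed simp

lemma defun_inst2:
  assumes "definable_fun (\<lambda>s. H (s 0) (s 1))" "definable_fun F" "definable_fun G"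
  shows "definable_fun (\<lambda>s. H (F s) (G s))"
proof (rule definable_funI[where Q = "\<lambda>s y. y = H (F s) (G s)"])
  show "H (F s) (G s) \<in> M" if "range s \<subseteq> M" for s
    using defun_M[OF assms(1), of "\<lambda>i. if i = 0 then F s else G s"]
      defun_M[OF assms(2) that] defun_M[OF assms(3) that] by auto
  have "definable (\<lambda>s. s 2 = H (s 0) (s 1))" using defun_eq_var[OF assms(1), of 2 id] by simp
  then show "definable (\<lambda>s. s 0 = H (F (\<lambda>i. s (Suc i))) (G (\<lambda>i. s (Suc i))))"
    by (rule def_inst3[where P = "\<lambda>x y z. z = H x y",
          OF _ defun_rename[OF assms(2)] defun_rename[OF assms(3)] defun_var])
qed simp

lemma ext_M: "x \<in> ext a \<Longrightarrow> x \<in> M"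
  by (simp add: ext_def)

lemma ext_iff: "x \<in> M \<Longrightarrow> x \<in> ext a \<longleftrightarrow> x \<epsilon> a"
  by (simp add: ext_def)

lemma def_in_ext [definable_intros]:
  assumes "definable_fun F" "definable_fun G" shows "definable (\<lambda>s. F s \<in> ext (G s))"
  by (rule definable_cong[OF def_mem[OF assms]]) (simp add: ext_iff defun_M[OF assms(1)])

lemma def_bex [definable_intros]:
  assumes "definable_fun F" "definable (\<lambda>s. P (\<lambda>i. s (Suc i)) (s 0))"
  shows "definable (\<lambda>s. \<exists>x\<in>ext (F s). P s x)"
proof -
  have "definable (\<lambda>s. \<exists>x\<in>M. x \<in> ext (F s) \<and> P s x)"
    by (intro definable_intros defun_rename[OF assms(1)] assms(2))
  then show ?thesis by (rule definable_cong) (use ext_M in blast)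
qed

lemma def_ball [definable_intros]:
  assumes "definable_fun F" "definable (\<lambda>s. P (\<lambda>i. s (Suc i)) (s 0))"
  shows "definable (\<lambda>s. \<forall>x\<in>ext (F s). P s x)"
  using def_not[OF def_bex[OF assms(1) def_not[OF assms(2)]]] by simp

lemma def_ex1 [definable_intros]:
  assumes "definable (\<lambda>s. P (\<lambda>i. s (Suc i)) (s 0))"
  shows "definable (\<lambda>s. \<exists>!x. x \<in> M \<and> P s x)"
proof -
  have "definable (\<lambda>s. \<exists>x\<in>M. P s x \<and> (\<forall>y\<in>M. P s y \<longrightarrow> y = x))"
    apply (intro definable_intros assms)
    using definable_rename[OF assms, of "case_nat 0 (\<lambda>i. Suc (Suc i))"] by simp
  then show ?thesis by (rule definable_cong) blast
qed

lemma def_if [definable_intros]: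
  assumes "definable P" "definable Q" "definable R"
  shows "definable (\<lambda>s. if P s then Q s else R s)"
  using def_conj[OF def_imp[OF assms(1,2)] def_imp[OF def_not[OF assms(1)] assms(3)]]
  by (rule definable_cong) simp

lemma def_in_M [definable_intros]: "definable_fun F \<Longrightarrow> definable (\<lambda>s. F s \<in> M)"
  by (rule definable_cong[where Q = "\<lambda>s. F s = F s"], rule def_eq) (simp_all add: defun_M)

lemma def_opair [definable_intros]:
  assumes "definable_fun F" "definable_fun G" "definable_fun H"
  shows "definable (\<lambda>s. opair (F s) (G s) (H s))"
proof (rule def_inst3[OF _ assms], rule definable_cong)
  show "definable (\<lambda>s. \<exists>u\<in>M. \<exists>v\<in>M. (\<forall>z\<in>M. z \<epsilon> u \<longleftrightarrow> z = s 1) \<and>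
    (\<forall>z\<in>M. z \<epsilon> v \<longleftrightarrow> z = s 1 \<or> z = s 2) \<and> (\<forall>z\<in>M. z \<epsilon> s 0 \<longleftrightarrow> z = u \<or> z = v))"
    by (intro definable_intros)
qed (rule opair_iff; blast)

subsection \<open>Set existence\<close>

lemma extI: "a \<in> M \<Longrightarrow> b \<in> M \<Longrightarrow> (\<And>x. x \<in> M \<Longrightarrow> x \<in> ext a \<longleftrightarrow> x \<in> ext b) \<Longrightarrow> a = b"
  by (rule extensionality) (auto simp: ext_def)

definition is_set :: "'v set \<Rightarrow> bool" where
  "is_set S \<longleftrightarrow> (\<exists>c\<in>M. ext c = S)"

definition mk :: "'v set \<Rightarrow> 'v" where
  "mk S = (THE c. c \<in> M \<and> ext c = S)"

lemma mk_props: assumes "is_set S" shows "mk S \<in> M \<and> ext (mk S) = S"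
proof -
  have "\<exists>!c. c \<in> M \<and> ext c = S"
    using assms extensionality unfolding is_set_def by blast
  then show ?thesis unfolding mk_def by (rule theI')
qed

lemma mk_M [simp]: "is_set S \<Longrightarrow> mk S \<in> M"
  and ext_mk [simp]: "is_set S \<Longrightarrow> ext (mk S) = S"
  using mk_props by auto

lemma mk_ext [simp]: "a \<in> M \<Longrightarrow> mk (ext a) = a"
  using mk_props[of "ext a"] extensionality unfolding is_set_def by blast

lemma is_set_ext [simp]: "a \<in> M \<Longrightarrow> is_set (ext a)"
  unfolding is_set_def by blast

lemma is_set_sep:
  assumes a: "a \<in> M" and Q: "definable (\<lambda>s. Q (s 0))"
  shows "is_set {x \<in> ext a. Q x}"
proof -
  obtain \<phi> t where t: "range t \<subseteq> M"
    and \<phi>: "\<And>s. range s \<subseteq> M \<Longrightarrow> Q (s 0) = sat \<phi> (interleave s t)"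
    using Q unfolding definable_def by metis
  \<comment> \<open>The axiom provides a single variable for the element, followed by the
    parameters. As \<open>Q\<close> reads only \<open>s 0\<close>, all arguments may be set to
    \<open>x\<close>.\<close>
  define r :: "nat \<Rightarrow> nat" where "r i = (if even i then 0 else Suc (i div 2))" for i
  have *: "(\<lambda>i. case_nat x t (r i)) = interleave (\<lambda>_. x) t" for x
    by (rule HOL.ext) (simp add: interleave_def r_def)
  have "Q x = sat (rename_fm r \<phi>) (case_nat x t)" if "x \<in> M" for x
    using \<phi>[of "\<lambda>_. x"] that unfolding sat_rename * by auto
  then have "{x \<in> ext a. Q x} = {x \<in> ext a. sat (rename_fm r \<phi>) (case_nat x t)}"
    using ext_M by blast
  then show ?thesis
    using separation[OF a t, of "rename_fm r \<phi>"] unfolding is_set_def by simp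
qed

lemma is_set_subset:
  assumes "a \<in> M" "S \<subseteq> ext a" "definable (\<lambda>s. s 0 \<in> S)" shows "is_set S"
proof -
  have "{x \<in> ext a. x \<in> S} = S" using assms(2) by blast
  then show ?thesis using is_set_sep[OF assms(1,3)] by simp
qed

lemma is_set_repl:
  assumes a: "a \<in> M" and Q: "definable (\<lambda>s. Q (s 0) (s 1))"
    and ex: "\<And>x. x \<in> ext a \<Longrightarrow> \<exists>!y. y \<in> M \<and> Q x y"
  shows "is_set {y \<in> M. \<exists>x\<in>ext a. Q x y}"
proof -
  obtain \<phi> t where t: "range t \<subseteq> M"
    and \<phi>: "\<And>s. range s \<subseteq> M \<Longrightarrow> Q (s 0) (s 1) = sat \<phi> (interleave s t)"
    using Q unfolding definable_def by metis
  define r :: "nat \<Rightarrow> nat"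
    where "r i = (if i = 0 then 0 else if even i then 1 else Suc (Suc (i div 2)))" for i
  have *: "(\<lambda>i. case_nat x (case_nat y t) (r i)) = interleave (\<lambda>i. if i = 0 then x else y) t" for x y
    by (rule HOL.ext) (auto simp add: interleave_def r_def)
  have **: "Q x y = sat (rename_fm r \<phi>) (case_nat x (case_nat y t))" if "x \<in> M" "y \<in> M" for x y
    using \<phi>[of "\<lambda>i. if i = 0 then x else y"] that unfolding sat_rename * by auto
  have "\<exists>!y. y \<in> M \<and> sat (rename_fm r \<phi>) (case_nat x (case_nat y t))" if "x \<in> ext a" for x
    using ex[OF that] ** ext_M[OF that] by metis
  from replacement[OF a t this] show ?thesis
    unfolding is_set_def using ** ext_M by (smt (verit, best) Collect_cong)
qed

lemma is_set_image:
  assumes "a \<in> M" "definable (\<lambda>s. s 1 = F (s 0))" "\<And>x. x \<in> ext a \<Longrightarrow> F x \<in> M"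
  shows "is_set (F ` ext a)"
proof -
  have "is_set {y \<in> M. \<exists>x\<in>ext a. y = F x}"
    by (rule is_set_repl) (use assms in auto)
  moreover have "{y \<in> M. \<exists>x\<in>ext a. y = F x} = F ` ext a" using assms(3) by auto
  ultimately show ?thesis by simp
qed

lemma is_set_pair [simp]: "a \<in> M \<Longrightarrow> b \<in> M \<Longrightarrow> is_set {a, b}"
  using pairing unfolding is_set_def by blast

lemma is_set_singleton [simp]: "a \<in> M \<Longrightarrow> is_set {a}"
  using is_set_pair[of a a] by simp

lemma is_set_Union: "a \<in> M \<Longrightarrow> is_set (\<Union>x\<in>ext a. ext x)"
  using union unfolding is_set_def by blast

lemma is_set_Un: assumes "is_set S" "is_set T" shows "is_set (S \<union> T)"
proof -
  have "is_set (\<Union>x\<in>ext (mk {mk S, mk T}). ext x)"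
    by (rule is_set_Union) (simp add: assms)
  then show ?thesis using assms by simp
qed

lemma is_set_insert: "a \<in> M \<Longrightarrow> is_set S \<Longrightarrow> is_set (insert a S)"
  using is_set_Un[of "{a}" S] by simp

lemma is_set_pow: "a \<in> M \<Longrightarrow> is_set {x \<in> M. ext x \<subseteq> ext a}"
  using powerset unfolding is_set_def by blast

lemma is_set_UN:
  assumes "a \<in> M" "definable (\<lambda>s. s 1 = F (s 0))" "\<And>x. x \<in> ext a \<Longrightarrow> F x \<in> M"
  shows "is_set (\<Union>x\<in>ext a. ext (F x))"
  using is_set_Union[OF mk_M[OF is_set_image[OF assms]]] is_set_image[OF assms] by simp

lemma minimal_element:
  assumes "is_set S" "S \<noteq> {}" shows "\<exists>x\<in>S. \<forall>y\<in>ext x. y \<notin> S"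
  using foundation[of "mk S"] assms by auto

lemma mem_irrefl: "a \<notin> ext a"
proof
  assume a: "a \<in> ext a"
  then have "\<exists>x\<in>{a}. \<forall>y\<in>ext x. y \<notin> {a}"
    by (intro minimal_element) (simp_all add: ext_M)
  then show False using a by blast
qed

lemma mem_asym: "a \<in> ext b \<Longrightarrow> b \<in> ext a \<Longrightarrow> False"
  using minimal_element[of "{a, b}"] by (auto simp: ext_M)

subsection \<open>Functions\<close>

lemma opair_inj: "opair p a b \<Longrightarrow> opair p c d \<Longrightarrow> a = c \<and> b = d"
  unfolding opair_def by (metis doubleton_eq_iff insert_absorb2 insertI1 singletonD singleton_insert_inj_eq)

lemma opair_exists: assumes "a \<in> M" "b \<in> M" shows "\<exists>p\<in>M. opair p a b"
proof -
  have "opair (mk {mk {a}, mk {a, b}}) a b"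
    unfolding opair_def using assms
    by (intro bexI[of _ "mk {a}"] bexI[of _ "mk {a, b}"]) simp_all
  then show ?thesis using assms by (intro bexI[of _ "mk {mk {a}, mk {a, b}}"]) simp_all
qed

lemma opair_unique: "p \<in> M \<Longrightarrow> q \<in> M \<Longrightarrow> opair p a b \<Longrightarrow> opair q a b \<Longrightarrow> p = q"
  unfolding opair_def using extensionality by metis

definition pr :: "'v \<Rightarrow> 'v \<Rightarrow> 'v" where
  "pr a b = (THE p. p \<in> M \<and> opair p a b)"

lemma pr_props: assumes "a \<in> M" "b \<in> M" shows "pr a b \<in> M \<and> opair (pr a b) a b"
proof -
  have "\<exists>!p. p \<in> M \<and> opair p a b" using opair_exists[OF assms] opair_unique by blast
  then show ?thesis unfolding pr_def by (rule theI')
qed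

lemma pr_iff: "p \<in> M \<Longrightarrow> a \<in> M \<Longrightarrow> b \<in> M \<Longrightarrow> p = pr a b \<longleftrightarrow> opair p a b"
  using pr_props opair_unique by blast

text \<open>\<open>app\<close> may leave \<open>M\<close> on arguments where it is undefined, so it is not a definable total function.\<close>

definition ap :: "'v \<Rightarrow> 'v \<Rightarrow> 'v" where
  "ap f x = (if \<exists>!y. y \<in> M \<and> (\<exists>p\<in>ext f. opair p x y) then app f x else f)"

lemma ap_iff:
  assumes "f \<in> M" "y \<in> M"
  shows "y = ap f x \<longleftrightarrow> (if \<exists>!y. y \<in> M \<and> (\<exists>p\<in>ext f. opair p x y) then \<exists>p\<in>ext f. opair p x y else y = f)"
proof (cases "\<exists>!y. y \<in> M \<and> (\<exists>p\<in>ext f. opair p x y)")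
  case True
  show ?thesis unfolding ap_def app_def using theI'[OF True] True assms by auto
qed (simp add: ap_def)

lemma ap_M [simp]: assumes "f \<in> M" shows "ap f x \<in> M"
proof (cases "\<exists>!y. y \<in> M \<and> (\<exists>p\<in>ext f. opair p x y)")
  case True
  show ?thesis unfolding ap_def app_def using theI'[OF True] True by simp
next
  case False
  show ?thesis unfolding ap_def if_not_P[OF False] by (rule assms)
qed

lemma defun_ap [definable_intros]:
  assumes "definable_fun F" "definable_fun G" shows "definable_fun (\<lambda>s. ap (F s) (G s))"
proof (rule defun_inst2[OF _ assms],
    rule definable_funI[where Q = "\<lambda>s y. if \<exists>!y. y \<in> M \<and> (\<exists>p\<in>ext (s 0). opair p (s 1) y)
      then \<exists>p\<in>ext (s 0). opair p (s 1) y else y = s 0"])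
  show "ap (s 0) (s 1) \<in> M" if "range s \<subseteq> M" for s
    by (rule ap_M) (use that in blast)
  show "(y = ap (s 0) (s 1)) = (if \<exists>!y. y \<in> M \<and> (\<exists>p\<in>ext (s 0). opair p (s 1) y)
      then \<exists>p\<in>ext (s 0). opair p (s 1) y else y = s 0)" if "range s \<subseteq> M" "y \<in> M" for s y
    by (rule ap_iff) (use that in blast)+
  show "definable (\<lambda>s. if \<exists>!y. y \<in> M \<and> (\<exists>p\<in>ext (s (Suc 0)). opair p (s (Suc 1)) y)
      then \<exists>p\<in>ext (s (Suc 0)). opair p (s (Suc 1)) (s 0) else s 0 = s (Suc 0))"
    by (intro definable_intros)
qed

lemma func_M: "func f X \<Longrightarrow> f \<in> M"
  unfolding func_def by blast

lemma func_ap: assumes "func f X" "x \<in> ext X" shows "ap f x = app f x"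
  using assms unfolding func_def ap_def by auto

lemma func_pair_iff:
  assumes "func f X" "x \<in> ext X" "y \<in> M"
  shows "(\<exists>p\<in>ext f. opair p x y) \<longleftrightarrow> y = ap f x"
proof -
  have *: "\<exists>!y. y \<in> M \<and> (\<exists>p\<in>ext f. opair p x y)"
    using assms(1,2) unfolding func_def by blast
  show ?thesis using ap_iff[OF func_M[OF assms(1)] assms(3), of x] * by simp
qed

lemma func_eqI:
  assumes f: "func f X" and g: "func g X" and eq: "\<And>x. x \<in> ext X \<Longrightarrow> ap f x = ap g x"
  shows "f = g"
proof -
  have "ext f \<subseteq> ext g" if f: "func f X" and g: "func g X"
    and eq: "\<And>x. x \<in> ext X \<Longrightarrow> ap f x = ap g x" for f g
  proof
    fix p assume p: "p \<in> ext f"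
    then obtain x y where xy: "x \<in> ext X" "y \<in> M" "opair p x y"
      using f unfolding func_def by blast
    then have "y = ap g x" using func_pair_iff[OF f xy(1,2)] eq p by auto
    then obtain q where "q \<in> ext g" "opair q x y"
      using func_pair_iff[OF g xy(1,2)] by blast
    then show "p \<in> ext g" using opair_unique ext_M p xy(3) by metis
  qed
  from this[OF f g eq] this[OF g f eq[symmetric]] show ?thesis
    using extensionality func_M f g by blast
qed

lemma function_exists:
  assumes X: "X \<in> M" and Q: "definable (\<lambda>s. Q (s 0) (s 1))"
    and ex: "\<And>x. x \<in> ext X \<Longrightarrow> \<exists>!y. y \<in> M \<and> Q x y"
  shows "\<exists>f. func f X \<and> (\<forall>x\<in>ext X. Q x (ap f x))"
proof -
  \<comment> \<open>Replacement is applied to the map from \<open>x\<close> to the coded pair of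
    \<open>x\<close> and its value, so that its range is the graph.\<close>
  define R where "R x p \<longleftrightarrow> (\<exists>y\<in>M. Q x y \<and> opair p x y)" for x p
  have Q': "definable (\<lambda>s. Q (F s) (G s))" if "definable_fun F" "definable_fun G" for F G
    by (rule def_inst2[OF Q that])
  have "is_set {p \<in> M. \<exists>x\<in>ext X. R x p}"
  proof (rule is_set_repl[OF X])
    show "definable (\<lambda>s. R (s 0) (s 1))" unfolding R_def by (intro definable_intros Q')
    fix x assume x: "x \<in> ext X"
    then obtain y where y: "y \<in> M" "Q x y" "\<And>z. z \<in> M \<Longrightarrow> Q x z \<Longrightarrow> z = y" using ex by blast
    then show "\<exists>!p. p \<in> M \<and> R x p"
      unfolding R_def using opair_exists[of x y] opair_unique ext_M[OF x] by metis
  qed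
  then obtain f where f: "f \<in> M" "ext f = {p \<in> M. \<exists>x\<in>ext X. R x p}"
    unfolding is_set_def by blast
  have *: "(\<exists>p\<in>ext f. opair p x y) \<longleftrightarrow> Q x y" if "x \<in> ext X" "y \<in> M" for x y
    using that opair_exists[of x y] ext_M opair_inj unfolding f(2) R_def by blast
  have "func f X"
    unfolding func_def
  proof (intro conjI ballI f(1))
    show "\<exists>x\<in>ext X. \<exists>y\<in>M. opair p x y" if "p \<in> ext f" for p
      using that unfolding f(2) R_def by blast
    show "\<exists>!y. y \<in> M \<and> (\<exists>p\<in>ext f. opair p x y)" if "x \<in> ext X" for x
      using ex[OF that] *[OF that] by metis
  qed
  moreover have "Q x (ap f x)" if "x \<in> ext X" for x
    using func_pair_iff[OF \<open>func f X\<close> that, of "ap f x"] *[OF that, of "ap f x"] f(1) by auto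
  ultimately show ?thesis by blast
qed

lemma lambda_exists:
  assumes X: "X \<in> M" and "definable (\<lambda>s. s 1 = F (s 0))" "\<And>x. x \<in> ext X \<Longrightarrow> F x \<in> M"
  shows "\<exists>f. func f X \<and> (\<forall>x\<in>ext X. ap f x = F x)"
  using function_exists[OF X, of "\<lambda>x y. y = F x"] assms by auto

lemma def_func [definable_intros]:
  assumes "definable_fun F" "definable_fun G" shows "definable (\<lambda>s. func (F s) (G s))"
  by (rule def_inst2[OF _ assms]) (unfold func_def, intro definable_intros)

lemma def_subset [definable_intros]:
  assumes "definable_fun F" "definable_fun G" shows "definable (\<lambda>s. ext (F s) \<subseteq> ext (G s))"
  by (rule def_inst2[OF _ assms]) (unfold subset_eq, intro definable_intros)

text \<open>The partial solutions on downward closed subsets of \<open>A\<close> are sets, so that their union is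
  definable; its domain is all of \<open>A\<close> by well-foundedness.\<close>

theorem wf_recursion:
  assumes A: "A \<in> M" and R: "definable (\<lambda>s. R (s 0) (s 1))"
    and wf: "\<And>B. B \<in> M \<Longrightarrow> ext B \<subseteq> ext A \<Longrightarrow> ext B \<noteq> {} \<Longrightarrow> \<exists>x\<in>ext B. \<forall>y\<in>ext B. \<not> R y x"
    and H: "definable_fun (\<lambda>s. H (s 0) (s 1))"
    and local: "\<And>x p q. x \<in> ext A \<Longrightarrow> p \<in> M \<Longrightarrow> q \<in> M \<Longrightarrow>
      (\<And>y. y \<in> ext A \<Longrightarrow> R y x \<Longrightarrow> ap p y = ap q y) \<Longrightarrow> H x p = H x q"
  shows "\<exists>p. func p A \<and> (\<forall>x\<in>ext A. ap p x = H x p)"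
proof -
  have R': "definable (\<lambda>s. R (F s) (G s))" if "definable_fun F" "definable_fun G" for F G
    by (rule def_inst2[OF R that])
  have H': "definable_fun (\<lambda>s. H (F s) (G s))" if "definable_fun F" "definable_fun G" for F G
    by (rule defun_inst2[OF H that])
  have HM: "H x p \<in> M" if "x \<in> M" "p \<in> M" for x p
    using defun_M[OF H, of "\<lambda>i. if i = 0 then x else p"] that by auto
  define sol where "sol C p \<longleftrightarrow> ext C \<subseteq> ext A \<and> (\<forall>x\<in>ext C. \<forall>y\<in>ext A. R y x \<longrightarrow> y \<in> ext C) \<and>
    func p C \<and> (\<forall>x\<in>ext C. ap p x = H x p)" for C p
  have dsol: "definable (\<lambda>s. sol (F s) (G s))" if "definable_fun F" "definable_fun G" for F G
    by (rule def_inst2[OF _ that]) (unfold sol_def, intro definable_intros R' H' A)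
  have solD: "ext C \<subseteq> ext A" "func p C" "\<And>x y. x \<in> ext C \<Longrightarrow> y \<in> ext A \<Longrightarrow> R y x \<Longrightarrow> y \<in> ext C"
    "\<And>x. x \<in> ext C \<Longrightarrow> ap p x = H x p" if "sol C p" for C p
    using that unfolding sol_def by blast+
  have unique: "ap p x = ap q x"
    if sol: "C \<in> M" "sol C p" "D \<in> M" "sol D q" and x: "x \<in> ext C" "x \<in> ext D" for C D p q x
  proof (rule ccontr)
    assume ne: "ap p x \<noteq> ap q x"
    have pq: "p \<in> M" "q \<in> M" using sol solD(2) func_M by blast+
    \<comment> \<open>Minimal elements exist only for subsets of \<open>A\<close> that are sets of
      the model, so the counterexamples have to be separated by a definable condition, with
      \<open>p\<close> and \<open>q\<close> as parameters.\<close>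
    define B where "B = {x \<in> ext A. x \<in> ext C \<and> x \<in> ext D \<and> ap p x \<noteq> ap q x}"
    have B: "is_set B" unfolding B_def by (rule is_set_sep[OF A]) (intro definable_intros pq sol)
    have "x \<in> B" using ne x solD(1)[OF sol(2)] unfolding B_def by blast
    then obtain z where z: "z \<in> B" "\<forall>y\<in>B. \<not> R y z"
      using wf[OF mk_M[OF B]] ext_mk[OF B] B_def by auto
    have "H z p = H z q"
    proof (rule local)
      show "ap p y = ap q y" if y: "y \<in> ext A" "R y z" for y
      proof -
        have "y \<in> ext C" "y \<in> ext D" using solD(3)[OF sol(2)] solD(3)[OF sol(4)] z(1) y
          unfolding B_def by blast+
        then show ?thesis using z(2) y unfolding B_def by blast
      qed
    qed (use z(1) pq B_def in auto)
    then show False using z(1) solD(4)[OF sol(2)] solD(4)[OF sol(4)] unfolding B_def by auto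
  qed
  define val where "val x v \<longleftrightarrow> (\<exists>C\<in>M. \<exists>p\<in>M. sol C p \<and> x \<in> ext C \<and> v = ap p x)" for x v
  have dval: "definable (\<lambda>s. val (F s) (G s))" if "definable_fun F" "definable_fun G" for F G
    by (rule def_inst2[OF _ that]) (unfold val_def, intro definable_intros dsol A)
  define G where "G = {x \<in> ext A. \<exists>v\<in>M. val x v}"
  have G: "is_set G" unfolding G_def by (rule is_set_sep[OF A]) (intro definable_intros dval)
  have "\<exists>P. func P (mk G) \<and> (\<forall>x\<in>ext (mk G). val x (ap P x))"
  proof (rule function_exists)
    show "definable (\<lambda>s. val (s 0) (s 1))" by (intro definable_intros dval)
    show "\<exists>!y. y \<in> M \<and> val x y" if "x \<in> ext (mk G)" for x
    proof -
      have "x \<in> G" using that ext_mk[OF G] by simp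
      then obtain v where "v \<in> M" "val x v" unfolding G_def by blast
      moreover have "w = w'" if "val x w" "val x w'" for w w'
        using that unique unfolding val_def by metis
      ultimately show ?thesis by blast
    qed
  qed (simp add: G)
  then obtain P where P: "func P (mk G)" "\<And>x. x \<in> G \<Longrightarrow> val x (ap P x)"
    using ext_mk[OF G] by metis
  have PM: "P \<in> M" using P(1) func_M by blast
  have solG: "sol (mk G) P"
    unfolding sol_def
  proof (intro conjI ballI impI P(1))
    show "ext (mk G) \<subseteq> ext A" using G G_def by auto
    have key: "(\<forall>y\<in>ext A. R y x \<longrightarrow> y \<in> G) \<and> ap P x = H x P" if x: "x \<in> G" for x
    proof -
      obtain C p where C: "C \<in> M" "p \<in> M" "sol C p" "x \<in> ext C" "ap P x = ap p x"
        using P(2)[OF x] unfolding val_def by blast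
      have CG: "y \<in> G \<and> ap P y = ap p y" if y: "y \<in> ext C" for y
      proof -
        have "val y (ap p y)" using C y unfolding val_def by blast
        moreover have "ap p y \<in> M" using C by simp
        ultimately have "y \<in> G" using solD(1)[OF C(3)] y unfolding G_def by blast
        moreover obtain D q where "D \<in> M" "sol D q" "y \<in> ext D" "ap P y = ap q y"
          using P(2)[OF \<open>y \<in> G\<close>] unfolding val_def by blast
        ultimately show ?thesis using unique C y by metis
      qed
      have xA: "x \<in> ext A" using x unfolding G_def by blast
      have pred: "y \<in> ext C" if "y \<in> ext A" "R y x" for y using solD(3)[OF C(3,4)] that .
      have "H x P = H x p" by (rule local[OF xA PM C(2)]) (use CG pred in blast)
      then show ?thesis using C(4,5) CG pred solD(4)[OF C(3)] by auto
    qed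
    show "y \<in> ext (mk G)" if "x \<in> ext (mk G)" "y \<in> ext A" "R y x" for x y
      using key that G by auto
    show "ap P x = H x P" if "x \<in> ext (mk G)" for x using key that G by auto
  qed
  have "G = ext A"
  proof (rule ccontr)
    assume "G \<noteq> ext A"
    then have ne: "ext A - G \<noteq> {}" unfolding G_def by auto
    have B: "is_set {x \<in> ext A. x \<notin> ext (mk G)}"
      by (rule is_set_sep[OF A]) (intro definable_intros; simp add: G)
    then obtain x where x: "x \<in> ext A" "x \<notin> G" "\<And>y. y \<in> ext A \<Longrightarrow> y \<notin> G \<Longrightarrow> \<not> R y x"
      using wf[of "mk {x \<in> ext A. x \<notin> ext (mk G)}"] ne G by auto
    have xM: "x \<in> M" using x ext_M by blast
    \<comment> \<open>By minimality all predecessors of \<open>x\<close> lie in \<open>G\<close>.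
      One more value, computed from \<open>P\<close>, therefore gives a solution on
      \<open>insert x G\<close>, and \<open>x\<close> should have been in \<open>G\<close>.\<close>
    have C: "is_set (insert x G)" using is_set_insert[OF xM G] .
    have "\<exists>q. func q (mk (insert x G)) \<and> (\<forall>y\<in>ext (mk (insert x G)).
        (y \<in> ext (mk G) \<and> ap q y = ap P y) \<or> (y \<notin> ext (mk G) \<and> ap q y = H y P))"
    proof (rule function_exists)
      show "definable (\<lambda>s. (s 0 \<in> ext (mk G) \<and> s 1 = ap P (s 0)) \<or> (s 0 \<notin> ext (mk G) \<and> s 1 = H (s 0) P))"
        by (intro definable_intros H' PM; simp add: G)
      show "\<exists>!z. z \<in> M \<and> ((y \<in> ext (mk G) \<and> z = ap P y) \<or> (y \<notin> ext (mk G) \<and> z = H y P))"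
        if "y \<in> ext (mk (insert x G))" for y
        using ap_M[OF PM] HM[OF ext_M[OF that] PM] by auto
    qed (simp add: C)
    then obtain q where q: "func q (mk (insert x G))" "\<And>y. y \<in> G \<Longrightarrow> ap q y = ap P y" "ap q x = H x P"
      using C G x(2) by auto
    have qM: "q \<in> M" using q func_M by blast
    have GA: "G \<subseteq> ext A" unfolding G_def by blast
    have down: "z \<in> G" if "y \<in> insert x G" "z \<in> ext A" "R z y" for y z
    proof (cases "y = x")
      case True then show ?thesis using x(3) that by blast
    next
      case False then show ?thesis using solD(3)[OF solG, of y z] that G by simp
    qed
    have Hq: "H y q = H y P" if y: "y \<in> insert x G" for y
      by (rule local) (use y x(1) GA q(2) PM qM down[OF y] in auto)
    have "ap q y = H y q" if "y \<in> insert x G" for y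
      using that Hq[OF that] q(2,3) solD(4)[OF solG] G by auto
    then have "sol (mk (insert x G)) q"
      unfolding sol_def using C q(1) down GA x(1) by auto
    then have "val x (ap q x)"
      unfolding val_def using C qM by (intro bexI[of _ "mk (insert x G)"] bexI[of _ q]) auto
    then show False using x(1,2) qM unfolding G_def by auto
  qed
  then show ?thesis using solG G A P(1) unfolding sol_def by auto
qed

lemma eq_mk_iff:
  assumes "is_set S" "v \<in> M" shows "v = mk S \<longleftrightarrow> (\<forall>u\<in>M. u \<in> ext v \<longleftrightarrow> u \<in> S)"
proof
  assume "\<forall>u\<in>M. u \<in> ext v \<longleftrightarrow> u \<in> S"
  then show "v = mk S" by (intro extI mk_M assms) (simp add: assms)
qed (simp add: assms)

lemma transitive_setD: "transitive_set a \<Longrightarrow> x \<in> ext a \<Longrightarrow> ext x \<subseteq> ext a"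
  unfolding transitive_set_def by blast

subsection \<open>Natural numbers and induction\<close>

lemma def_ext_empty [definable_intros]: "definable_fun F \<Longrightarrow> definable (\<lambda>s. ext (F s) = {})"
  by (rule definable_cong[where Q = "\<lambda>s. \<forall>x\<in>ext (F s). x \<noteq> x"]) (intro definable_intros | simp | blast)+

lemma def_ext_insert [definable_intros]:
  assumes "definable_fun F" "definable_fun G" "definable_fun H"
  shows "definable (\<lambda>s. ext (F s) = insert (G s) (ext (H s)))"
proof (rule def_inst3[OF _ assms], rule definable_cong)
  show "definable (\<lambda>s. \<forall>x\<in>M. x \<in> ext (s 0) \<longleftrightarrow> x = s 1 \<or> x \<in> ext (s 2))"
    by (intro definable_intros)
  show "(ext (s 0) = insert (s 1) (ext (s 2))) = (\<forall>x\<in>M. x \<in> ext (s 0) \<longleftrightarrow> x = s 1 \<or> x \<in> ext (s 2))"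
    if "range s \<subseteq> M" for s
  proof -
    have "s 1 \<in> M" using that by blast
    then have "x \<in> M" if "x \<in> ext (s 0) \<or> x = s 1 \<or> x \<in> ext (s 2)" for x using that ext_M by blast
    then show ?thesis unfolding set_eq_iff insert_iff by blast
  qed
qed

lemma def_inductive [definable_intros]: "definable_fun F \<Longrightarrow> definable (\<lambda>s. inductive_set_in (F s))"
  by (rule def_inst1[where P = inductive_set_in]) (unfold inductive_set_in_def, intro definable_intros)

lemma omega_M: "omega w \<Longrightarrow> w \<in> M"
  unfolding omega_def inductive_set_in_def by blast

lemma omega_zero: "omega w \<Longrightarrow> \<exists>z\<in>ext w. ext z = {}"
  unfolding omega_def inductive_set_in_def by blast

lemma omega_succ: "omega w \<Longrightarrow> n \<in> ext w \<Longrightarrow> \<exists>m\<in>ext w. ext m = insert n (ext n)"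
  unfolding omega_def inductive_set_in_def by blast

lemma omega_exists: "\<exists>w. omega w"
proof -
  obtain v where v: "inductive_set_in v" using infinity by blast
  then have vM: "v \<in> M" unfolding inductive_set_in_def by blast
  define S where "S = {x \<in> ext v. \<forall>u\<in>M. inductive_set_in u \<longrightarrow> x \<in> ext u}"
  have S: "is_set S" unfolding S_def by (rule is_set_sep[OF vM]) (intro definable_intros)
  have *: "y \<in> S \<longleftrightarrow> (\<forall>u. inductive_set_in u \<longrightarrow> y \<in> ext u)" for y
    using v unfolding S_def inductive_set_in_def by blast
  have "inductive_set_in (mk S)"
    unfolding inductive_set_in_def ext_mk[OF S]
  proof (intro conjI ballI)
    obtain z where z: "z \<in> ext v" "ext z = {}" using v unfolding inductive_set_in_def by blast
    have "z \<in> ext u" if u: "inductive_set_in u" for u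
    proof -
      obtain z' where "z' \<in> ext u" "ext z' = {}" using u unfolding inductive_set_in_def by blast
      then show ?thesis using extensionality[of z z'] z ext_M by auto
    qed
    then show "\<exists>z\<in>S. ext z = {}" using z * by blast
    fix x assume x: "x \<in> S"
    then obtain y where y: "y \<in> ext v" "ext y = insert x (ext x)"
      using v * unfolding inductive_set_in_def by blast
    have "y \<in> ext u" if u: "inductive_set_in u" for u
    proof -
      have "x \<in> ext u" using x u * by blast
      then obtain y' where "y' \<in> ext u" "ext y' = insert x (ext x)"
        using u unfolding inductive_set_in_def by blast
      then show ?thesis using extensionality[of y y'] y ext_M by auto
    qed
    then show "\<exists>y\<in>S. ext y = insert x (ext x)" using y * by blast
  qed (simp add: S)
  then have "omega (mk S)" unfolding omega_def ext_mk[OF S] using * by blast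
  then show ?thesis by blast
qed

text \<open>Induction is limited to definable properties: the set of natural numbers of the model
  may have nonstandard elements, which no induction of the metatheory reaches.\<close>

lemma omega_induct:
  assumes w: "omega w" and n: "n \<in> ext w" and Q: "definable (\<lambda>s. Q (s 0))"
    and zero: "\<And>z. z \<in> ext w \<Longrightarrow> ext z = {} \<Longrightarrow> Q z"
    and succ: "\<And>x y. x \<in> ext w \<Longrightarrow> y \<in> ext w \<Longrightarrow> ext y = insert x (ext x) \<Longrightarrow> Q x \<Longrightarrow> Q y"
  shows "Q n"
proof -
  have S: "is_set {x \<in> ext w. Q x}" by (rule is_set_sep[OF omega_M[OF w] Q])
  have "inductive_set_in (mk {x \<in> ext w. Q x})"
    unfolding inductive_set_in_def ext_mk[OF S]
  proof (intro conjI ballI)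
    show "\<exists>z\<in>{x \<in> ext w. Q x}. ext z = {}" using omega_zero[OF w] zero by blast
    fix x assume x: "x \<in> {x \<in> ext w. Q x}"
    then obtain y where y: "y \<in> ext w" "ext y = insert x (ext x)" using omega_succ[OF w] by blast
    then have "Q y" using succ x by blast
    then show "\<exists>y\<in>{x \<in> ext w. Q x}. ext y = insert x (ext x)" using y by blast
  qed (rule mk_M[OF S])
  then show ?thesis using w n ext_mk[OF S] unfolding omega_def by blast
qed

lemma omega_transitive:
  assumes w: "omega w" and n: "n \<in> ext w" shows "ext n \<subseteq> ext w"
proof (rule omega_induct[OF w n])
  show "definable (\<lambda>s. ext (s 0) \<subseteq> ext w)" by (intro definable_intros omega_M w)
qed auto

lemma pred_unique: "insert m (ext m) = insert k (ext k) \<Longrightarrow> m = k"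
  using mem_asym[of m k] mem_asym[of k m] by (metis insert_iff)

lemma omega_recursion:
  assumes w: "omega w" and a: "a \<in> M" and G: "definable_fun (\<lambda>s. G (s 0))"
  shows "\<exists>e. func e w \<and> (\<forall>n\<in>ext w. ext n = {} \<longrightarrow> ap e n = a) \<and>
    (\<forall>n\<in>ext w. \<forall>m\<in>ext w. ext n = insert m (ext m) \<longrightarrow> ap e n = G (ap e m))"
proof -
  have G': "definable_fun (\<lambda>s. G (F s))" if "definable_fun F" for F by (rule defun_inst1[OF G that])
  have GM: "G x \<in> M" if "x \<in> M" for x using defun_M[OF G, of "\<lambda>_. x"] that by blast
  \<comment> \<open>The predecessor of a successor is unique by foundation, so the recursion can
    recover it from \<open>n\<close>. Whatever is not a successor, zero in particular, receives
    \<open>a\<close>.\<close>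
  define H where "H n p = (if \<exists>m\<in>ext n. ext n = insert m (ext m)
    then G (ap p (THE m. ext n = insert m (ext m))) else a)" for n p
  have H_succ: "H n p = G (ap p m)" if "ext n = insert m (ext m)" for n p m
  proof -
    have "(THE m. ext n = insert m (ext m)) = m"
      using that pred_unique by (intro the_equality) auto
    then show ?thesis unfolding H_def using that by auto
  qed
  have H_zero: "H n p = a" if "\<not> (\<exists>m\<in>ext n. ext n = insert m (ext m))" for n p
    unfolding H_def using that by simp
  have "\<exists>p. func p w \<and> (\<forall>x\<in>ext w. ap p x = H x p)"
  proof (rule wf_recursion[where R = "\<lambda>x y. x \<epsilon> y"])
    show "definable_fun (\<lambda>s. H (s 0) (s 1))"
    proof (rule definable_funI[where Q = "\<lambda>s y. if \<exists>m\<in>ext (s 0). ext (s 0) = insert m (ext m)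
          then \<exists>m\<in>ext (s 0). ext (s 0) = insert m (ext m) \<and> y = G (ap (s 1) m) else y = a"])
      show "H (s 0) (s 1) \<in> M" if "range s \<subseteq> M" for s
      proof -
        have "s 1 \<in> M" using that by blast
        then show ?thesis unfolding H_def by (simp add: a GM)
      qed
      show "(y = H (s 0) (s 1)) = (if \<exists>m\<in>ext (s 0). ext (s 0) = insert m (ext m)
          then \<exists>m\<in>ext (s 0). ext (s 0) = insert m (ext m) \<and> y = G (ap (s 1) m) else y = a)"
        if "range s \<subseteq> M" "y \<in> M" for s y
      proof (cases "\<exists>m\<in>ext (s 0). ext (s 0) = insert m (ext m)")
        case True
        then show ?thesis using H_succ by (metis (no_types, lifting))
      next
        case False
        then show ?thesis unfolding if_not_P[OF False] using H_zero by simp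
      qed
    qed (intro definable_intros G' a)
    show "\<exists>x\<in>ext B. \<forall>y\<in>ext B. \<not> y \<epsilon> x" if "B \<in> M" "ext B \<subseteq> ext w" "ext B \<noteq> {}" for B
      using minimal_element[of "ext B"] that ext_M ext_iff by (metis is_set_ext)
    show "H x p = H x q"
      if x: "x \<in> ext w" and eq: "\<And>y. y \<in> ext w \<Longrightarrow> y \<epsilon> x \<Longrightarrow> ap p y = ap q y" for x p q
    proof (cases "\<exists>m\<in>ext x. ext x = insert m (ext m)")
      case True
      then obtain m where m: "m \<in> ext x" "ext x = insert m (ext m)" by blast
      then have "m \<in> ext w" "m \<epsilon> x" using omega_transitive[OF w x] ext_iff ext_M by blast+
      then show ?thesis using H_succ[OF m(2)] eq by simp
    next
      case False
      then show ?thesis using H_zero by simp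
    qed
  qed (intro definable_intros omega_M w)+
  then obtain e where e: "func e w" "\<And>x. x \<in> ext w \<Longrightarrow> ap e x = H x e" by blast
  have "ap e n = a" if "n \<in> ext w" "ext n = {}" for n
    using e(2)[OF that(1)] H_zero[of n e] that(2) by simp
  moreover have "ap e n = G (ap e m)" if "n \<in> ext w" "ext n = insert m (ext m)" for n m
    using e(2)[OF that(1)] H_succ[OF that(2), of e] by simp
  ultimately show ?thesis using e(1) by blast
qed

text \<open>Unions are iterated along the natural numbers of the model and then collected. Starting
  from \<open>{a}\<close> rather than from \<open>a\<close> makes \<open>a\<close> itself an element
  of the result.\<close>

lemma transitive_closure: assumes a: "a \<in> M" shows "\<exists>T\<in>M. transitive_set T \<and> a \<in> ext T"
proof -
  obtain w where w: "omega w" using omega_exists by blast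
  define G where "G t = mk (\<Union>x\<in>ext t. ext x)" for t
  have G: "definable_fun (\<lambda>s. G (s 0))"
  proof (rule definable_funI[where Q = "\<lambda>s y. \<forall>u\<in>M. u \<in> ext y \<longleftrightarrow> (\<exists>x\<in>ext (s 0). u \<in> ext x)"])
    fix s :: "nat \<Rightarrow> 'v" and y assume s: "range s \<subseteq> M" and y: "y \<in> M"
    have S: "is_set (\<Union>x\<in>ext (s 0). ext x)" by (rule is_set_Union) (use s in blast)
    show "(y = G (s 0)) = (\<forall>u\<in>M. u \<in> ext y \<longleftrightarrow> (\<exists>x\<in>ext (s 0). u \<in> ext x))"
      unfolding G_def eq_mk_iff[OF S y] by blast
  next
    fix s :: "nat \<Rightarrow> 'v" assume s: "range s \<subseteq> M"
    show "G (s 0) \<in> M" unfolding G_def by (rule mk_M, rule is_set_Union) (use s in blast)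
  qed (intro definable_intros)
  have GM: "ext (G t) = (\<Union>x\<in>ext t. ext x)" if "t \<in> M" for t
    unfolding G_def by (simp add: is_set_Union that)
  obtain e where e: "func e w" "\<And>n. n \<in> ext w \<Longrightarrow> ext n = {} \<Longrightarrow> ap e n = mk {a}"
      "\<And>n m. n \<in> ext w \<Longrightarrow> m \<in> ext w \<Longrightarrow> ext n = insert m (ext m) \<Longrightarrow> ap e n = G (ap e m)"
    using omega_recursion[OF w _ G, of "mk {a}"] a by auto
  have eM: "e \<in> M" using e(1) func_M by blast
  have T: "is_set (\<Union>n\<in>ext w. ext (ap e n))"
    by (rule is_set_UN[OF omega_M[OF w]], intro definable_intros eM) (simp add: eM)
  show ?thesis
  proof (intro bexI conjI)
    show "a \<in> ext (mk (\<Union>n\<in>ext w. ext (ap e n)))"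
    proof -
      obtain z where z: "z \<in> ext w" "ext z = {}" using omega_zero[OF w] by blast
      have "a \<in> ext (ap e z)" using e(2)[OF z] a by simp
      then show ?thesis unfolding ext_mk[OF T] using z(1) by blast
    qed
    show "transitive_set (mk (\<Union>n\<in>ext w. ext (ap e n)))"
      unfolding transitive_set_def ext_mk[OF T]
    proof
      fix x assume "x \<in> (\<Union>n\<in>ext w. ext (ap e n))"
      then obtain n where n: "n \<in> ext w" "x \<in> ext (ap e n)" by blast
      obtain m where m: "m \<in> ext w" "ext m = insert n (ext n)" using omega_succ[OF w n(1)] by blast
      have "ext (ap e m) = (\<Union>x\<in>ext (ap e n). ext x)"
        using e(3)[OF m(1) n(1) m(2)] GM[of "ap e n"] eM by simp
      then show "ext x \<subseteq> (\<Union>n\<in>ext w. ext (ap e n))" using n m by blast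
    qed
  qed (rule mk_M[OF T])
qed

text \<open>Foundation speaks about sets, while the counterexamples to \<open>Q\<close> may form a
  proper class. Inside a transitive set that contains \<open>x\<close> they form a set, and a
  minimal one has no counterexample among its elements.\<close>

lemma mem_induct:
  assumes Q: "definable (\<lambda>s. Q (s 0))" and x: "x \<in> M"
    and step: "\<And>x. x \<in> M \<Longrightarrow> (\<And>y. y \<in> ext x \<Longrightarrow> Q y) \<Longrightarrow> Q x"
  shows "Q x"
proof (rule ccontr)
  assume nQ: "\<not> Q x"
  obtain T where T: "T \<in> M" "transitive_set T" "x \<in> ext T" using transitive_closure[OF x] by blast
  have S: "is_set {y \<in> ext T. \<not> Q y}" by (rule is_set_sep[OF T(1)]) (intro definable_intros Q)
  obtain y where y: "y \<in> ext T" "\<not> Q y" "\<forall>z\<in>ext y. z \<notin> {y \<in> ext T. \<not> Q y}"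
    using minimal_element[OF S] nQ T(3) by blast
  have "Q z" if "z \<in> ext y" for z using y that T(2) unfolding transitive_set_def by blast
  then show False using step y ext_M by blast
qed

subsection \<open>Levels of the cumulative hierarchy and choice functions\<close>

lemma def_transitive [definable_intros]: "definable_fun F \<Longrightarrow> definable (\<lambda>s. transitive_set (F s))"
  by (rule def_inst1[where P = transitive_set]) (unfold transitive_set_def, intro definable_intros)

text \<open>The equation makes \<open>p x\<close> the union of the power sets of \<open>p y\<close>
  for \<open>y \<in> x\<close>. Thus \<open>p x\<close> is the level of the cumulative hierarchy
  indexed by the rank of \<open>x\<close>, obtained without mentioning ordinals.\<close>

definition level_fun :: "'v \<Rightarrow> 'v \<Rightarrow> bool" where
  "level_fun T p \<longleftrightarrow> transitive_set T \<and> func p T \<and>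
     (\<forall>x\<in>ext T. \<forall>u\<in>M. u \<in> ext (ap p x) \<longleftrightarrow> (\<exists>y\<in>ext x. ext u \<subseteq> ext (ap p y)))"

lemma def_level_fun [definable_intros]:
  "definable_fun F \<Longrightarrow> definable_fun G \<Longrightarrow> definable (\<lambda>s. level_fun (F s) (G s))"
  by (rule def_inst2[where P = level_fun]) (unfold level_fun_def, intro definable_intros)

lemma level_fun_unique:
  assumes 1: "T \<in> M" "level_fun T p" and 2: "T' \<in> M" "level_fun T' p'" and x: "x \<in> ext T" "x \<in> ext T'"
  shows "ap p x = ap p' x"
proof -
  have M: "p \<in> M" "p' \<in> M" using 1 2 func_M unfolding level_fun_def by blast+
  have "x \<in> ext T \<longrightarrow> x \<in> ext T' \<longrightarrow> ap p x = ap p' x"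
  proof (rule mem_induct[OF _ ext_M[OF x(1)]])
    show "definable (\<lambda>s. s 0 \<in> ext T \<longrightarrow> s 0 \<in> ext T' \<longrightarrow> ap p (s 0) = ap p' (s 0))"
      by (intro definable_intros M 1 2)
    fix x assume IH: "\<And>y. y \<in> ext x \<Longrightarrow> y \<in> ext T \<longrightarrow> y \<in> ext T' \<longrightarrow> ap p y = ap p' y"
    show "x \<in> ext T \<longrightarrow> x \<in> ext T' \<longrightarrow> ap p x = ap p' x"
    proof (intro impI)
      assume x: "x \<in> ext T" "x \<in> ext T'"
      have "transitive_set T" "transitive_set T'" using 1(2) 2(2) unfolding level_fun_def by simp_all
      then have "ext x \<subseteq> ext T" "ext x \<subseteq> ext T'" using x transitive_setD by blast+
      then have eq: "ap p y = ap p' y" if "y \<in> ext x" for y using IH that by blast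
      show "ap p x = ap p' x"
      proof (rule extI)
        fix u assume u: "u \<in> M"
        have "u \<in> ext (ap p x) \<longleftrightarrow> (\<exists>y\<in>ext x. ext u \<subseteq> ext (ap p y))"
          using 1(2) x(1) u unfolding level_fun_def by blast
        also have "\<dots> \<longleftrightarrow> (\<exists>y\<in>ext x. ext u \<subseteq> ext (ap p' y))" using eq by auto
        also have "\<dots> \<longleftrightarrow> u \<in> ext (ap p' x)"
          using 2(2) x(2) u unfolding level_fun_def by blast
        finally show "u \<in> ext (ap p x) \<longleftrightarrow> u \<in> ext (ap p' x)" .
      qed (use M in auto)
    qed
  qed
  then show ?thesis using x by blast
qed

lemma level_fun_exists: assumes T: "T \<in> M" "transitive_set T" shows "\<exists>p. level_fun T p"
proof -
  define H where "H x p = mk (\<Union>y\<in>ext x. {u \<in> M. ext u \<subseteq> ext (ap p y)})" for x p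
  have S: "is_set (\<Union>y\<in>ext x. {u \<in> M. ext u \<subseteq> ext (ap p y)})" if "x \<in> M" "p \<in> M" for x p
  proof -
    have P: "is_set {u \<in> M. ext u \<subseteq> ext (ap p y)}" for y by (rule is_set_pow) (simp add: that)
    have "is_set (\<Union>y\<in>ext x. ext (mk {u \<in> M. ext u \<subseteq> ext (ap p y)}))"
    proof (rule is_set_UN[OF that(1)])
      have "definable (\<lambda>s. \<forall>u\<in>M. u \<in> ext (s 1) \<longleftrightarrow> ext u \<subseteq> ext (ap p (s 0)))"
        by (intro definable_intros that)
      then show "definable (\<lambda>s. s 1 = mk {u \<in> M. ext u \<subseteq> ext (ap p (s 0))})"
      proof (rule definable_cong)
        fix s :: "nat \<Rightarrow> 'v" assume "range s \<subseteq> M"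
        then have "s 1 \<in> M" by blast
        then show "(s 1 = mk {u \<in> M. ext u \<subseteq> ext (ap p (s 0))}) =
            (\<forall>u\<in>M. u \<in> ext (s 1) \<longleftrightarrow> ext u \<subseteq> ext (ap p (s 0)))"
          by (subst eq_mk_iff[OF P]) auto
      qed
    qed (rule mk_M[OF P])
    then show ?thesis unfolding ext_mk[OF P] .
  qed
  have "\<exists>p. func p T \<and> (\<forall>x\<in>ext T. ap p x = H x p)"
  proof (rule wf_recursion[OF T(1), where R = "\<lambda>x y. x \<epsilon> y"])
    show "definable_fun (\<lambda>s. H (s 0) (s 1))"
    proof (rule definable_funI[where Q = "\<lambda>s v. \<forall>u\<in>M. u \<in> ext v \<longleftrightarrow> (\<exists>y\<in>ext (s 0). ext u \<subseteq> ext (ap (s 1) y))"])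
      fix s :: "nat \<Rightarrow> 'v" and v assume s: "range s \<subseteq> M"
      have S': "is_set (\<Union>y\<in>ext (s 0). {u \<in> M. ext u \<subseteq> ext (ap (s 1) y)})" by (rule S) (use s in blast)+
      show "H (s 0) (s 1) \<in> M" unfolding H_def by (rule mk_M[OF S'])
      show "(v = H (s 0) (s 1)) = (\<forall>u\<in>M. u \<in> ext v \<longleftrightarrow> (\<exists>y\<in>ext (s 0). ext u \<subseteq> ext (ap (s 1) y)))"
        if "v \<in> M"
        unfolding H_def eq_mk_iff[OF S' that] by blast
    qed (intro definable_intros)
    show "\<exists>x\<in>ext B. \<forall>y\<in>ext B. \<not> y \<epsilon> x" if "B \<in> M" "ext B \<noteq> {}" for B
      using minimal_element[of "ext B"] that ext_M ext_iff by (metis is_set_ext)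
    show "H x p = H x q"
      if x: "x \<in> ext T" and eq: "\<And>y. y \<in> ext T \<Longrightarrow> y \<epsilon> x \<Longrightarrow> ap p y = ap q y" for x p q
    proof -
      have "ap p y = ap q y" if "y \<in> ext x" for y
        using that eq transitive_setD[OF T(2) x] ext_iff ext_M by blast
      then show ?thesis unfolding H_def by simp
    qed
  qed (intro definable_intros)
  then obtain p where p: "func p T" "\<forall>x\<in>ext T. ap p x = H x p" by blast
  have "\<forall>u\<in>M. u \<in> ext (ap p x) \<longleftrightarrow> (\<exists>y\<in>ext x. ext u \<subseteq> ext (ap p y))" if "x \<in> ext T" for x
  proof -
    have "ap p x = H x p" using p(2) that by blast
    then have "ext (ap p x) = (\<Union>y\<in>ext x. {u \<in> M. ext u \<subseteq> ext (ap p y)})"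
      unfolding H_def using ext_mk[OF S[OF ext_M[OF that] func_M[OF p(1)]]] by simp
    then show ?thesis by blast
  qed
  then show ?thesis unfolding level_fun_def using T p by blast
qed

definition level :: "'v \<Rightarrow> 'v" where
  "level x = (THE v. \<exists>T\<in>M. \<exists>p\<in>M. level_fun T p \<and> x \<in> ext T \<and> v = ap p x)"

lemma level_eq: "T \<in> M \<Longrightarrow> level_fun T p \<Longrightarrow> x \<in> ext T \<Longrightarrow> level x = ap p x"
  unfolding level_def
  by (rule the_equality) (use level_fun_unique func_M level_fun_def in blast)+

lemma level_fun_at: assumes "x \<in> M" shows "\<exists>T\<in>M. \<exists>p\<in>M. level_fun T p \<and> x \<in> ext T"
  using transitive_closure[OF assms] level_fun_exists func_M level_fun_def by meson

lemma level_M [simp]: "x \<in> M \<Longrightarrow> level x \<in> M"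
  using level_fun_at[of x] level_eq by (metis ap_M)

lemma defun_level [definable_intros]: assumes "definable_fun F" shows "definable_fun (\<lambda>s. level (F s))"
proof (rule defun_inst1[OF _ assms],
    rule definable_funI[where Q = "\<lambda>s v. \<exists>T\<in>M. \<exists>p\<in>M. level_fun T p \<and> s 0 \<in> ext T \<and> v = ap p (s 0)"])
  fix s :: "nat \<Rightarrow> 'v" and v assume "range s \<subseteq> M"
  then have s: "s 0 \<in> M" by blast
  show "level (s 0) \<in> M" using s by simp
  show "(v = level (s 0)) = (\<exists>T\<in>M. \<exists>p\<in>M. level_fun T p \<and> s 0 \<in> ext T \<and> v = ap p (s 0))"
  proof
    assume "v = level (s 0)"
    moreover obtain T p where "T \<in> M" "p \<in> M" "level_fun T p" "s 0 \<in> ext T" using level_fun_at[OF s] by blast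
    ultimately show "\<exists>T\<in>M. \<exists>p\<in>M. level_fun T p \<and> s 0 \<in> ext T \<and> v = ap p (s 0)"
      using level_eq by metis
  next
    assume "\<exists>T\<in>M. \<exists>p\<in>M. level_fun T p \<and> s 0 \<in> ext T \<and> v = ap p (s 0)"
    then show "v = level (s 0)" using level_eq by metis
  qed
qed (intro definable_intros)

lemma level_iff:
  assumes "x \<in> M" "u \<in> M"
  shows "u \<in> ext (level x) \<longleftrightarrow> (\<exists>y\<in>ext x. ext u \<subseteq> ext (level y))"
proof -
  obtain T p where T: "T \<in> M" "p \<in> M" "level_fun T p" "x \<in> ext T" using level_fun_at[OF assms(1)] by blast
  have sub: "ext x \<subseteq> ext T" using T(3,4) transitive_setD unfolding level_fun_def by blast
  have "u \<in> ext (ap p x) \<longleftrightarrow> (\<exists>y\<in>ext x. ext u \<subseteq> ext (ap p y))"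
    using T assms unfolding level_fun_def by blast
  moreover have "level x = ap p x" using level_eq[OF T(1,3,4)] .
  moreover have "level y = ap p y" if "y \<in> ext x" for y using level_eq[OF T(1,3)] that sub by blast
  ultimately show ?thesis by (simp cong: bex_cong)
qed

lemma subset_level: assumes "x \<in> M" shows "ext x \<subseteq> ext (level x)"
proof (rule mem_induct[OF _ assms])
  show "ext x \<subseteq> ext (level x)" if "x \<in> M" "\<And>y. y \<in> ext x \<Longrightarrow> ext y \<subseteq> ext (level y)" for x
    using level_iff that ext_M by blast
qed (intro definable_intros)

text \<open>This replaces the comparison of ranks. If the level of \<open>y\<close> is not an
  element of the level of \<open>x\<close>, then for each \<open>z \<in> x\<close> the level of
  \<open>y\<close> is not included in that of \<open>z\<close>. So some \<open>t \<in> y\<close> has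
  a level that is not an element of that of \<open>z\<close>, and by induction the level of
  \<open>z\<close> is included in that of \<open>t\<close>.\<close>

lemma level_linear:
  assumes "x \<in> M" "y \<in> M"
  shows "ext (level x) \<subseteq> ext (level y) \<or> level y \<in> ext (level x)"
proof -
  have "\<forall>y\<in>M. ext (level x) \<subseteq> ext (level y) \<or> level y \<in> ext (level x)"
  proof (rule mem_induct[OF _ assms(1)])
    fix x assume x: "x \<in> M"
      and IH: "\<And>z. z \<in> ext x \<Longrightarrow> \<forall>y\<in>M. ext (level z) \<subseteq> ext (level y) \<or> level y \<in> ext (level z)"
    show "\<forall>y\<in>M. ext (level x) \<subseteq> ext (level y) \<or> level y \<in> ext (level x)"
    proof (intro ballI disjCI)
      fix y assume y: "y \<in> M" and ny: "level y \<notin> ext (level x)"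
      show "ext (level x) \<subseteq> ext (level y)"
      proof
        fix u assume u: "u \<in> ext (level x)"
        then obtain z where z: "z \<in> ext x" "ext u \<subseteq> ext (level z)" using level_iff x ext_M by blast
        have zM: "z \<in> M" using z ext_M by blast
        have zx: "level z \<in> ext (level x)" using level_iff[OF x level_M[OF zM]] z(1) by blast
        have "\<not> ext (level y) \<subseteq> ext (level z)"
          using level_iff[OF x level_M[OF y]] ny z(1) by blast
        then obtain v where v: "v \<in> ext (level y)" "v \<notin> ext (level z)" by blast
        then obtain t where t: "t \<in> ext y" "ext v \<subseteq> ext (level t)" using level_iff y ext_M by blast
        have tM: "t \<in> M" using t ext_M by blast
        have "level t \<notin> ext (level z)"
        proof
          assume "level t \<in> ext (level z)"
          then obtain r where r: "r \<in> ext z" "ext (level t) \<subseteq> ext (level r)"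
            using level_iff zM tM by auto
          then have "v \<in> ext (level z)" using level_iff zM v(1) ext_M t(2) by blast
          then show False using v(2) by blast
        qed
        then have "ext (level z) \<subseteq> ext (level t)" using IH z(1) tM by blast
        then show "u \<in> ext (level y)" using level_iff y t(1) z(2) u ext_M by blast
      qed
    qed
  qed (intro definable_intros)
  then show ?thesis using assms(2) by blast
qed

text \<open>Scott's trick: the witnesses are taken from the first level that contains any.\<close>

lemma nonempty_selection:
  assumes X: "X \<in> M" and Q: "definable (\<lambda>s. Q (s 0) (s 1))"
    and ex: "\<And>x. x \<in> ext X \<Longrightarrow> \<exists>y\<in>M. Q x y"
  shows "\<exists>f. func f X \<and> (\<forall>x\<in>ext X. ext (ap f x) \<noteq> {} \<and> (\<forall>y\<in>ext (ap f x). Q x y))"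
proof -
  have Q': "definable (\<lambda>s. Q (F s) (G s))" if "definable_fun F" "definable_fun G" for F G
    by (rule def_inst2[OF Q that])
  define C where "C x l \<longleftrightarrow> (\<exists>t\<in>M. l = level t) \<and> (\<exists>y\<in>ext l. Q x y)" for x l
  have dC: "definable (\<lambda>s. C (F s) (G s))" if "definable_fun F" "definable_fun G" for F G
    by (rule def_inst2[OF _ that]) (unfold C_def, intro definable_intros Q')
  define L where "L x l \<longleftrightarrow> C x l \<and> (\<forall>k\<in>M. C x k \<longrightarrow> ext l \<subseteq> ext k)" for x l
  have dL: "definable (\<lambda>s. L (F s) (G s))" if "definable_fun F" "definable_fun G" for F G
    by (rule def_inst2[OF _ that]) (unfold L_def, intro definable_intros dC)
  have L_ex: "\<exists>l\<in>M. L x l" if x: "x \<in> ext X" for x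
  proof -
    obtain y where y: "y \<in> M" "Q x y" using ex x by blast
    have xM: "x \<in> M" using x ext_M by blast
    have "y \<in> ext (level (mk {y}))" using level_iff[of "mk {y}" y] subset_level[OF y(1)] y(1) by simp
    then have "C x (level (mk {y}))" unfolding C_def using y by (auto intro: bexI[of _ "mk {y}"])
    moreover have "level (mk {y}) \<in> M" using y by simp
    \<comment> \<open>Membership induction yields a level that contains a witness but has no such
      level among its elements; by linearity it is included in every other one.\<close>
    ultimately obtain l where l: "l \<in> M" "C x l" "\<And>k. k \<in> ext l \<Longrightarrow> \<not> C x k"
      using mem_induct[of "\<lambda>l. \<not> C x l", OF def_not[OF dC[OF defun_const[OF xM] defun_var]]] by blast
    have "ext l \<subseteq> ext k" if k: "C x k" for k
    proof -
      obtain t t' where t: "t \<in> M" "l = level t" "t' \<in> M" "k = level t'" using k l(2) unfolding C_def by blast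
      then show ?thesis using level_linear[OF t(1,3)] l(3)[of k] k by blast
    qed
    then show ?thesis using l unfolding L_def by blast
  qed
  have L_unique: "l = k" if "L x l" "L x k" "l \<in> M" "k \<in> M" for x l k
    using that unfolding L_def by (intro extI) blast+
  have "\<exists>f. func f X \<and> (\<forall>x\<in>ext X. \<forall>y\<in>M. y \<in> ext (ap f x) \<longleftrightarrow> Q x y \<and> (\<exists>l\<in>M. L x l \<and> y \<in> ext l))"
  proof (rule function_exists[OF X])
    show "definable (\<lambda>s. \<forall>y\<in>M. y \<in> ext (s 1) \<longleftrightarrow> Q (s 0) y \<and> (\<exists>l\<in>M. L (s 0) l \<and> y \<in> ext l))"
      by (intro definable_intros Q' dL)
    fix x assume x: "x \<in> ext X"
    obtain l where l: "l \<in> M" "L x l" using L_ex[OF x] by blast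
    have xM: "x \<in> M" using x ext_M by blast
    have S: "is_set {y \<in> ext l. Q x y}" by (rule is_set_sep[OF l(1)]) (intro definable_intros Q' xM)
    have eq: "(\<exists>l\<in>M. L x l \<and> y \<in> ext l) \<longleftrightarrow> y \<in> ext l" for y using l L_unique by metis
    show "\<exists>!c. c \<in> M \<and> (\<forall>y\<in>M. y \<in> ext c \<longleftrightarrow> Q x y \<and> (\<exists>l\<in>M. L x l \<and> y \<in> ext l))"
    proof (rule ex1I[of _ "mk {y \<in> ext l. Q x y}"])
      show "mk {y \<in> ext l. Q x y} \<in> M \<and> (\<forall>y\<in>M. y \<in> ext (mk {y \<in> ext l. Q x y}) \<longleftrightarrow>
          Q x y \<and> (\<exists>l\<in>M. L x l \<and> y \<in> ext l))"
        unfolding eq using S by auto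
      show "c = mk {y \<in> ext l. Q x y}"
        if "c \<in> M \<and> (\<forall>y\<in>M. y \<in> ext c \<longleftrightarrow> Q x y \<and> (\<exists>l\<in>M. L x l \<and> y \<in> ext l))" for c
        by (rule extI) (use that S eq in auto)
    qed
  qed
  then obtain f where f: "func f X"
    "\<And>x y. x \<in> ext X \<Longrightarrow> y \<in> M \<Longrightarrow> y \<in> ext (ap f x) \<longleftrightarrow> Q x y \<and> (\<exists>l\<in>M. L x l \<and> y \<in> ext l)"
    by blast
  have "ext (ap f x) \<noteq> {} \<and> (\<forall>y\<in>ext (ap f x). Q x y)" if x: "x \<in> ext X" for x
  proof -
    obtain l where l: "l \<in> M" "L x l" using L_ex[OF x] by blast
    then obtain y where "y \<in> ext l" "Q x y" unfolding L_def C_def by blast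
    then have "y \<in> ext (ap f x)" using f(2)[OF x] l ext_M by blast
    then show ?thesis using f(2)[OF x] ext_M by blast
  qed
  then show ?thesis using f(1) by blast
qed

lemma defun_pr [definable_intros]:
  assumes "definable_fun F" "definable_fun G" shows "definable_fun (\<lambda>s. pr (F s) (G s))"
proof (rule defun_inst2[OF _ assms], rule definable_funI[where Q = "\<lambda>s p. opair p (s 0) (s 1)"])
  fix s :: "nat \<Rightarrow> 'v" and p assume "range s \<subseteq> M"
  then have s: "s 0 \<in> M" "s 1 \<in> M" by blast+
  show "pr (s 0) (s 1) \<in> M" using pr_props[OF s] by blast
  show "(p = pr (s 0) (s 1)) = opair p (s 0) (s 1)" if "p \<in> M" using pr_iff[OF that s] .
qed (intro definable_intros)

lemma choice_function:
  assumes X: "X \<in> M" and Q: "definable (\<lambda>s. Q (s 0) (s 1))"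
  shows "\<exists>g. func g X \<and> (\<forall>x\<in>ext X. (\<exists>y\<in>M. Q x y) \<longrightarrow> Q x (ap g x))"
proof -
  have Q': "definable (\<lambda>s. Q (F s) (G s))" if "definable_fun F" "definable_fun G" for F G
    by (rule def_inst2[OF Q that])
  \<comment> \<open>Weakening \<open>Q\<close> to an implication makes the selection total: where no
    witness exists, any element will do.\<close>
  have "\<exists>f. func f X \<and> (\<forall>x\<in>ext X. ext (ap f x) \<noteq> {} \<and>
      (\<forall>y\<in>ext (ap f x). (\<exists>z\<in>M. Q x z) \<longrightarrow> Q x y))"
  proof (rule nonempty_selection[OF X])
    show "definable (\<lambda>s. (\<exists>z\<in>M. Q (s 0) z) \<longrightarrow> Q (s 0) (s 1))" by (intro definable_intros Q')
    show "\<exists>y\<in>M. (\<exists>z\<in>M. Q x z) \<longrightarrow> Q x y" for x using M_nonempty by blast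
  qed
  then obtain f where f: "func f X" "\<And>x. x \<in> ext X \<Longrightarrow> ext (ap f x) \<noteq> {}"
    "\<And>x y. x \<in> ext X \<Longrightarrow> y \<in> ext (ap f x) \<Longrightarrow> (\<exists>z\<in>M. Q x z) \<Longrightarrow> Q x y" by blast
  have fM: "f \<in> M" using f(1) func_M by blast
  \<comment> \<open>The axiom of choice is given for disjoint families only; tagging the candidates
    with \<open>x\<close> makes the sets \<open>K x\<close> disjoint.\<close>
  define K where "K x = pr x ` ext (ap f x)" for x
  have K: "is_set (K x)" if "x \<in> M" for x
    unfolding K_def by (rule is_set_image) (use fM that pr_props ext_M in \<open>intro definable_intros | simp\<close>)+
  have K_iff: "p \<in> K x \<longleftrightarrow> (\<exists>y\<in>ext (ap f x). opair p x y)" if "p \<in> M" "x \<in> M" for p x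
    unfolding K_def using pr_iff[OF that] ext_M by (auto simp: image_iff)
  have F: "is_set ((\<lambda>x. mk (K x)) ` ext X)"
  proof (rule is_set_image[OF X])
    have "definable (\<lambda>s. \<forall>p\<in>M. p \<in> ext (s 1) \<longleftrightarrow> (\<exists>y\<in>ext (ap f (s 0)). opair p (s 0) y))"
      by (intro definable_intros fM)
    then show "definable (\<lambda>s. s 1 = mk (K (s 0)))"
    proof (rule definable_cong)
      fix s :: "nat \<Rightarrow> 'v" assume "range s \<subseteq> M"
      then have s: "s 1 \<in> M" "s 0 \<in> M" by blast+
      then show "(s 1 = mk (K (s 0))) =
          (\<forall>p\<in>M. p \<in> ext (s 1) \<longleftrightarrow> (\<exists>y\<in>ext (ap f (s 0)). opair p (s 0) y))"
        unfolding eq_mk_iff[OF K[OF s(2)] s(1)] using K_iff s by simp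
    qed
  qed (use K ext_M in simp)
  have "\<exists>c\<in>M. \<forall>k\<in>ext (mk ((\<lambda>x. mk (K x)) ` ext X)). \<exists>!z. z \<in> ext k \<inter> ext c"
  proof (rule choice[OF mk_M[OF F]], unfold ext_mk[OF F])
    show "ext k \<noteq> {}" if "k \<in> (\<lambda>x. mk (K x)) ` ext X" for k
      using that f(2) K ext_M unfolding K_def by auto
    fix k l assume "k \<in> (\<lambda>x. mk (K x)) ` ext X" "l \<in> (\<lambda>x. mk (K x)) ` ext X" and ne: "k \<noteq> l"
    then obtain x y where "x \<in> ext X" "y \<in> ext X" and kl: "k = mk (K x)" "l = mk (K y)" by blast
    then have M: "x \<in> M" "y \<in> M" using ext_M by blast+
    show "ext k \<inter> ext l = {}"
    proof (rule ccontr)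
      assume "ext k \<inter> ext l \<noteq> {}"
      then obtain p where p: "p \<in> ext k" "p \<in> ext l" by blast
      then have "p \<in> M" "p \<in> K x" "p \<in> K y" using ext_M[OF p(1)] kl K M by simp_all
      then have "x = y" using K_iff M opair_inj by blast
      then show False using ne kl by simp
    qed
  qed
  then obtain c where c: "c \<in> M" "\<And>x. x \<in> ext X \<Longrightarrow> \<exists>!z. z \<in> ext (mk (K x)) \<inter> ext c"
    unfolding ext_mk[OF F] by blast
  have "\<exists>g. func g X \<and> (\<forall>x\<in>ext X. ap g x \<in> ext (ap f x) \<and> (\<exists>p\<in>ext c. opair p x (ap g x)))"
  proof (rule function_exists[OF X])
    show "definable (\<lambda>s. s 1 \<in> ext (ap f (s 0)) \<and> (\<exists>p\<in>ext c. opair p (s 0) (s 1)))"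
      by (intro definable_intros fM c(1))
    fix x assume x: "x \<in> ext X"
    then have xM: "x \<in> M" using ext_M by blast
    obtain z where z: "z \<in> K x" "z \<in> ext c" "\<And>z'. z' \<in> K x \<Longrightarrow> z' \<in> ext c \<Longrightarrow> z' = z"
      using c(2)[OF x] unfolding ext_mk[OF K[OF xM]] by blast
    obtain y where y: "y \<in> ext (ap f x)" "opair z x y" using z(1,2) K_iff xM ext_M by blast
    show "\<exists>!y. y \<in> M \<and> y \<in> ext (ap f x) \<and> (\<exists>p\<in>ext c. opair p x y)"
    proof (rule ex1I[of _ y])
      show "y \<in> M \<and> y \<in> ext (ap f x) \<and> (\<exists>p\<in>ext c. opair p x y)" using y z(2) ext_M by blast
      fix y' assume y': "y' \<in> M \<and> y' \<in> ext (ap f x) \<and> (\<exists>p\<in>ext c. opair p x y')"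
      then obtain p where p: "p \<in> ext c" "opair p x y'" by blast
      then have "p = z" using z(3) K_iff xM ext_M y' by blast
      then show "y' = y" using p(2) y(2) opair_inj by blast
    qed
  qed
  then show ?thesis using f(3) by blast
qed

lemma ap_in_transitive:
  assumes T: "transitive_set T" "f \<in> ext T" and f: "func f X" "x \<in> ext X"
  shows "ap f x \<in> ext T"
proof -
  obtain p where p: "p \<in> ext f" "opair p x (ap f x)"
    using func_pair_iff[OF f, of "ap f x"] func_M[OF f(1)] by auto
  then obtain v where v: "v \<in> ext p" "ap f x \<in> ext v" unfolding opair_def by auto
  show ?thesis using transitive_setD[OF T(1)] T(2) p(1) v by blast
qed

text \<open>A Kuratowski pair over \<open>Z\<close> is a set of subsets of \<open>Z\<close>. A
  function from \<open>X\<close> to \<open>T\<close> is a set of such pairs over the union of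
  \<open>X\<close> and \<open>T\<close>, and hence belongs to the third power set of that
  union.\<close>

lemma is_set_functions:
  assumes X: "X \<in> M" and T: "T \<in> M"
  shows "is_set {f. func f X \<and> (\<forall>x\<in>ext X. ap f x \<in> ext T)}"
proof -
  define Z where "Z = mk (ext X \<union> ext T)"
  have Z: "Z \<in> M" "ext Z = ext X \<union> ext T" unfolding Z_def using is_set_Un[OF is_set_ext is_set_ext] X T by auto
  define P where "P a = mk {x \<in> M. ext x \<subseteq> ext a}" for a
  have P: "P a \<in> M \<and> ext (P a) = {x \<in> M. ext x \<subseteq> ext a}" if "a \<in> M" for a
    unfolding P_def using is_set_pow[OF that] by simp
  have PP: "P Z \<in> M" "P (P Z) \<in> M" "P (P (P Z)) \<in> M" using P Z(1) by blast+
  show ?thesis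
  proof (rule is_set_subset[OF PP(3)])
    show "definable (\<lambda>s. s 0 \<in> {f. func f X \<and> (\<forall>x\<in>ext X. ap f x \<in> ext T)})"
      unfolding mem_Collect_eq by (intro definable_intros X T)
    show "{f. func f X \<and> (\<forall>x\<in>ext X. ap f x \<in> ext T)} \<subseteq> ext (P (P (P Z)))"
    proof
      fix f assume "f \<in> {f. func f X \<and> (\<forall>x\<in>ext X. ap f x \<in> ext T)}"
      then have f: "func f X" "\<And>x. x \<in> ext X \<Longrightarrow> ap f x \<in> ext T" by blast+
      have "p \<in> ext (P (P Z))" if p: "p \<in> ext f" for p
      proof -
        obtain x y where xy: "x \<in> ext X" "y \<in> M" "opair p x y" using p f(1) unfolding func_def by blast
        then have "y = ap f x" using func_pair_iff[OF f(1) xy(1,2)] p by blast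
        then have yT: "y \<in> ext T" using f(2) xy(1) by blast
        obtain u v where uv: "u \<in> M" "v \<in> M" "ext u = {x}" "ext v = {x, y}" "ext p = {u, v}"
          using xy(3) unfolding opair_def by blast
        have "u \<in> ext (P Z)" "v \<in> ext (P Z)" using P[OF Z(1)] Z(2) uv xy(1) yT by auto
        then show ?thesis using P[OF PP(1)] uv(5) ext_M[OF p] by auto
      qed
      then show "f \<in> ext (P (P (P Z)))" using P[OF PP(2)] func_M[OF f(1)] by blast
    qed
  qed
qed

end

text \<open>The model is a parameter of the locale because it is needed at two levels: for
  \<open>U\<close> in \<open>M\<close> and, once the ultrapower is known to satisfy ZFC, for an
  internal ultrafilter of \<open>Ult U\<close>.\<close>

locale ultrafilter = zfc_model M E for M :: "'v set" and E (infix "\<epsilon>" 50) +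
  fixes X U :: 'v
  assumes uf: "cc_ultrafilter_on X U"
begin

lemma X_M: "X \<in> M" and U_M: "U \<in> M" and X_in_U: "X \<in> ext U"
  and U_subset: "A \<in> ext U \<Longrightarrow> ext A \<subseteq> ext X"
  using uf unfolding cc_ultrafilter_on_def by blast+

lemma space_eq: "space U = X"
  unfolding space_def
proof (rule the_equality[of "\<lambda>X. cc_ultrafilter_on X U", OF uf])
  fix Y assume "cc_ultrafilter_on Y U"
  then have "Y \<in> M" "Y \<in> ext U" "\<forall>A\<in>ext U. ext A \<subseteq> ext Y" unfolding cc_ultrafilter_on_def by blast+
  then show "Y = X" using extensionality[OF _ X_M] U_subset X_in_U by blast
qed

lemma Fn_iff: "f \<in> Fn U \<longleftrightarrow> func f X"
  unfolding Fn_def space_eq by simp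

subsection \<open>Almost all elements of the space\<close>

definition ae :: "('v \<Rightarrow> bool) \<Rightarrow> bool" where
  "ae P \<longleftrightarrow> large U {x \<in> ext X. P x}"

lemma large_iff: "is_set S \<Longrightarrow> large U S \<longleftrightarrow> mk S \<in> ext U"
  unfolding large_def using ext_M by (metis ext_mk mk_ext)

lemma large_is_set: "large U S \<Longrightarrow> is_set S \<and> S \<subseteq> ext X"
  unfolding large_def is_set_def using U_subset ext_M by blast

lemma large_mono: assumes "large U S" "S \<subseteq> T" "T \<subseteq> ext X" "is_set T" shows "large U T"
proof -
  obtain A where A: "A \<in> ext U" "ext A = S" using assms(1) unfolding large_def by blast
  obtain B where B: "B \<in> M" "ext B = T" using assms(4) unfolding is_set_def by blast
  have "B \<in> ext U" using uf A B assms(2,3) unfolding cc_ultrafilter_on_def by blast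
  then show ?thesis unfolding large_def using B by blast
qed

lemma large_nonempty: "large U S \<Longrightarrow> S \<noteq> {}"
  using uf unfolding cc_ultrafilter_on_def by blast

lemma large_or_compl: assumes "is_set S" "S \<subseteq> ext X" shows "large U S \<or> large U (ext X - S)"
proof -
  obtain A where A: "A \<in> M" "ext A = S" using assms(1) unfolding is_set_def by blast
  have "A \<in> ext U \<or> large U (ext X - ext A)" using uf A assms(2) unfolding cc_ultrafilter_on_def by blast
  then show ?thesis using A unfolding large_def by blast
qed

lemma large_countable_Int:
  assumes w: "omega w" and s: "func s w" "\<And>n. n \<in> ext w \<Longrightarrow> ap s n \<in> ext U"
  shows "large U {x \<in> ext X. \<forall>n\<in>ext w. x \<in> ext (ap s n)}"
proof -
  have s': "app s n = ap s n" if "n \<in> ext w" for n using func_ap[OF s(1) that] by simp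
  have "\<forall>n\<in>ext w. app s n \<in> ext U" using s(2) s' by simp
  then have "large U {x \<in> ext X. \<forall>n\<in>ext w. x \<epsilon> app s n}"
    using uf w s(1) unfolding cc_ultrafilter_on_def by blast
  moreover have "{x \<in> ext X. \<forall>n\<in>ext w. x \<epsilon> app s n} = {x \<in> ext X. \<forall>n\<in>ext w. x \<in> ext (ap s n)}"
  proof -
    have "x \<in> ext (ap s n) \<longleftrightarrow> x \<epsilon> app s n" if "x \<in> ext X" "n \<in> ext w" for x n
      using s'[OF that(2)] ext_iff[OF ext_M[OF that(1)]] by simp
    then show ?thesis by blast
  qed
  ultimately show ?thesis by simp
qed

lemma large_Int: assumes S: "large U S" and T: "large U T" shows "large U (S \<inter> T)"
proof -
  obtain A B where A: "A \<in> ext U" "ext A = S" and B: "B \<in> ext U" "ext B = T"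
    using S T unfolding large_def by blast
  have M: "A \<in> M" "B \<in> M" using A B ext_M by blast+
  obtain w where w: "omega w" using omega_exists by blast
  have "\<exists>s. func s w \<and> (\<forall>n\<in>ext w. if ext n = {} then ap s n = A else ap s n = B)"
  proof (rule function_exists[OF omega_M[OF w]])
    show "definable (\<lambda>s. if ext (s 0) = {} then s 1 = A else s 1 = B)" by (intro definable_intros M)
    show "\<exists>!y. y \<in> M \<and> (if ext n = {} then y = A else y = B)" for n using M by auto
  qed
  then obtain s where s: "func s w" "\<And>n. n \<in> ext w \<Longrightarrow> if ext n = {} then ap s n = A else ap s n = B"
    by blast
  have "large U {x \<in> ext X. \<forall>n\<in>ext w. x \<in> ext (ap s n)}"
  proof (rule large_countable_Int[OF w s(1)])
    show "ap s n \<in> ext U" if "n \<in> ext w" for n using s(2)[OF that] A(1) B(1) by (simp split: if_splits)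
  qed
  moreover have "{x \<in> ext X. \<forall>n\<in>ext w. x \<in> ext (ap s n)} = S \<inter> T"
  proof -
    obtain z where z: "z \<in> ext w" "ext z = {}" using omega_zero[OF w] by blast
    obtain m where m: "m \<in> ext w" "ext m \<noteq> {}" using omega_succ[OF w z(1)] by blast
    have "ap s z = A" "ap s m = B" using s(2)[OF z(1)] s(2)[OF m(1)] z(2) m(2) by simp_all
    moreover have "ap s n = A \<or> ap s n = B" if "n \<in> ext w" for n using s(2)[OF that] by meson
    ultimately have "(\<forall>n\<in>ext w. x \<in> ext (ap s n)) \<longleftrightarrow> x \<in> S \<inter> T" for x
      using A(2) B(2) z(1) m(1) by (metis IntD1 IntD2 IntI)
    then show ?thesis using large_is_set[OF S] by blast
  qed
  ultimately show ?thesis by simp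
qed

lemma is_set_Collect: "definable (\<lambda>s. P (s 0)) \<Longrightarrow> is_set {x \<in> ext X. P x}"
  by (rule is_set_sep[OF X_M])

text \<open>The ultrafilter measures only sets of the model, so \<open>Q\<close> has to cut out such
  a set before upward closure can be applied; its definability ensures this.\<close>

lemma ae_mono:
  assumes "ae P" "definable (\<lambda>s. Q (s 0))" "\<And>x. x \<in> ext X \<Longrightarrow> P x \<Longrightarrow> Q x" shows "ae Q"
  unfolding ae_def
  by (rule large_mono[OF assms(1)[unfolded ae_def]]) (use assms(3) is_set_Collect[OF assms(2)] in auto)

lemma ae_cong: "(\<And>x. x \<in> ext X \<Longrightarrow> P x = Q x) \<Longrightarrow> ae P = ae Q"
  unfolding ae_def by (metis (mono_tags, lifting) Collect_cong)

lemma ae_all: "(\<And>x. x \<in> ext X \<Longrightarrow> P x) \<Longrightarrow> ae P"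
proof -
  assume "\<And>x. x \<in> ext X \<Longrightarrow> P x"
  then have "{x \<in> ext X. P x} = ext X" by blast
  then show ?thesis unfolding ae_def large_def using X_in_U by auto
qed

lemma ae_ex: "ae P \<Longrightarrow> \<exists>x\<in>ext X. P x"
  unfolding ae_def using large_nonempty by blast

lemma ae_conjI: assumes "ae P" "ae Q" shows "ae (\<lambda>x. P x \<and> Q x)"
proof -
  have "{x \<in> ext X. P x} \<inter> {x \<in> ext X. Q x} = {x \<in> ext X. P x \<and> Q x}" by blast
  then show ?thesis using large_Int assms unfolding ae_def by metis
qed

lemma ae_mono2:
  assumes "ae P" "ae P'" "definable (\<lambda>s. Q (s 0))"
    "\<And>x. x \<in> ext X \<Longrightarrow> P x \<Longrightarrow> P' x \<Longrightarrow> Q x" shows "ae Q"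
  by (rule ae_mono[OF ae_conjI[OF assms(1,2)] assms(3)]) (use assms(4) in blast)

lemma ae_conj:
  assumes "definable (\<lambda>s. P (s 0))" "definable (\<lambda>s. Q (s 0))"
  shows "ae (\<lambda>x. P x \<and> Q x) \<longleftrightarrow> ae P \<and> ae Q"
  using ae_conjI ae_mono[OF _ assms(1)] ae_mono[OF _ assms(2)] by blast

lemma ae_not:
  assumes P: "definable (\<lambda>s. P (s 0))" shows "ae (\<lambda>x. \<not> P x) \<longleftrightarrow> \<not> ae P"
proof
  assume "ae (\<lambda>x. \<not> P x)"
  then show "\<not> ae P" using ae_conjI ae_ex by fastforce
next
  assume "\<not> ae P"
  then have "large U (ext X - {x \<in> ext X. P x})"
    using large_or_compl[OF is_set_Collect[OF P]] unfolding ae_def by blast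
  moreover have "ext X - {x \<in> ext X. P x} = {x \<in> ext X. \<not> P x}" by blast
  ultimately show "ae (\<lambda>x. \<not> P x)" unfolding ae_def by simp
qed

lemma def_ae [definable_intros]:
  assumes "definable (\<lambda>s. P (\<lambda>i. s (Suc i)) (s 0))" shows "definable (\<lambda>s. ae (P s))"
proof -
  have P: "definable (\<lambda>s. P (\<lambda>i. s (Suc (Suc i))) (s 0))"
    using definable_rename[OF assms, of "case_nat 0 (\<lambda>i. Suc (Suc i))"] by simp
  have *: "definable (\<lambda>s. \<exists>A\<in>ext U. \<forall>x\<in>M. x \<in> ext A \<longleftrightarrow> x \<in> ext X \<and> P s x)"
    by (intro definable_intros U_M X_M P)
  have "ext A = {x \<in> ext X. P s x} \<longleftrightarrow> (\<forall>x\<in>M. x \<in> ext A \<longleftrightarrow> x \<in> ext X \<and> P s x)" for A s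
    using ext_M by (auto simp: set_eq_iff)
  then show ?thesis
    by (intro definable_cong[OF *]) (simp add: ae_def large_def)
qed

subsection \<open>The ultrapower is well-founded\<close>

definition eqU :: "'v \<Rightarrow> 'v \<Rightarrow> bool" where "eqU f g \<longleftrightarrow> ae (\<lambda>x. ap f x = ap g x)"

definition memU :: "'v \<Rightarrow> 'v \<Rightarrow> bool" where "memU f g \<longleftrightarrow> ae (\<lambda>x. ap f x \<in> ext (ap g x))"

lemma def_eqU [definable_intros]: "definable_fun F \<Longrightarrow> definable_fun G \<Longrightarrow> definable (\<lambda>s. eqU (F s) (G s))"
  by (rule def_inst2[where P = eqU]) (unfold eqU_def, intro definable_intros)

lemma def_memU [definable_intros]: "definable_fun F \<Longrightarrow> definable_fun G \<Longrightarrow> definable (\<lambda>s. memU (F s) (G s))"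
  by (rule def_inst2[where P = memU]) (unfold memU_def, intro definable_intros)

lemma ult_eq_iff: "func f X \<Longrightarrow> func g X \<Longrightarrow> ult_eq U f g \<longleftrightarrow> eqU f g"
  unfolding ult_eq_def eqU_def space_eq ae_def[symmetric] by (rule ae_cong) (simp add: func_ap)

lemma ult_mem_iff: "func f X \<Longrightarrow> func g X \<Longrightarrow> ult_mem U f g \<longleftrightarrow> memU f g"
  unfolding ult_mem_def memU_def space_eq ae_def[symmetric]
  by (rule ae_cong) (simp add: func_ap[symmetric] ext_iff func_M)

lemma eqU_refl: "eqU f f"
  unfolding eqU_def by (rule ae_all) simp

lemma eqU_sym: "eqU f g \<Longrightarrow> eqU g f"
  unfolding eqU_def by (simp add: eq_commute)

lemma eqU_trans: assumes "f \<in> M" "h \<in> M" "eqU f g" "eqU g h" shows "eqU f h"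
  unfolding eqU_def
  by (rule ae_mono2[OF assms(3,4)[unfolded eqU_def]], intro definable_intros assms) simp

lemma memU_cong:
  assumes "f \<in> M" "g \<in> M" "f' \<in> M" "g' \<in> M" "eqU f f'" "eqU g g'" "memU f g" shows "memU f' g'"
  unfolding memU_def
  by (rule ae_mono2[OF assms(5)[unfolded eqU_def] ae_conjI[OF assms(6,7)[unfolded eqU_def memU_def]]],
      intro definable_intros assms) auto

text \<open>Without a minimal element there is, inside the model, a sequence that descends modulo
  \<open>U\<close>. By countable completeness a single point \<open>x\<close> witnesses all of its
  steps at once, and the values at \<open>x\<close> form a set that violates foundation. Minimality
  is claimed for sets of the model only.\<close>

lemma memU_wf:
  assumes B: "B \<in> M" "ext B \<noteq> {}"
  shows "\<exists>f\<in>ext B. \<forall>g\<in>ext B. \<not> memU g f"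
proof (rule ccontr)
  assume "\<not> ?thesis"
  then have no_min: "\<And>f. f \<in> ext B \<Longrightarrow> \<exists>g\<in>ext B. memU g f" by blast
  obtain c where c: "func c B" "\<And>f. f \<in> ext B \<Longrightarrow> ap c f \<in> ext B \<and> memU (ap c f) f"
  proof -
    have "definable (\<lambda>s. s 1 \<in> ext B \<and> memU (s 1) (s 0))" by (intro definable_intros B)
    from choice_function[OF B(1) this] show ?thesis using no_min ext_M that by meson
  qed
  have cM: "c \<in> M" using c(1) func_M by blast
  obtain w where w: "omega w" using omega_exists by blast
  obtain f0 where f0: "f0 \<in> ext B" using B(2) by blast
  obtain e where e: "func e w" "\<And>n. n \<in> ext w \<Longrightarrow> ext n = {} \<Longrightarrow> ap e n = f0"
      "\<And>n m. n \<in> ext w \<Longrightarrow> m \<in> ext w \<Longrightarrow> ext n = insert m (ext m) \<Longrightarrow> ap e n = ap c (ap e m)"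
  proof -
    have "definable_fun (\<lambda>s. ap c (s 0))" by (intro definable_intros cM)
    from omega_recursion[OF w ext_M[OF f0] this] show ?thesis using that by blast
  qed
  have eM: "e \<in> M" using e(1) func_M by blast
  have eB: "ap e n \<in> ext B" if "n \<in> ext w" for n
  proof (rule omega_induct[OF w that])
    show "definable (\<lambda>s. ap e (s 0) \<in> ext B)" by (intro definable_intros eM B)
    show "ap e z \<in> ext B" if "z \<in> ext w" "ext z = {}" for z using e(2)[OF that] f0 by simp
    show "ap e y \<in> ext B" if "x \<in> ext w" "y \<in> ext w" "ext y = insert x (ext x)" "ap e x \<in> ext B" for x y
      using e(3)[OF that(2,1,3)] c(2)[OF that(4)] by simp
  qed
  \<comment> \<open>\<open>ap s n\<close> is the set of points at which the \<open>n\<close>-th step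
    of the sequence really descends.\<close>
  have "\<exists>s. func s w \<and> (\<forall>n\<in>ext w. \<forall>x\<in>M. x \<in> ext (ap s n) \<longleftrightarrow>
      x \<in> ext X \<and> ap (ap c (ap e n)) x \<in> ext (ap (ap e n) x))"
  proof (rule function_exists[OF omega_M[OF w]])
    show "definable (\<lambda>s. \<forall>x\<in>M. x \<in> ext (s 1) \<longleftrightarrow>
        x \<in> ext X \<and> ap (ap c (ap e (s 0))) x \<in> ext (ap (ap e (s 0)) x))"
      by (intro definable_intros X_M cM eM)
    fix n assume "n \<in> ext w"
    then have nM: "n \<in> M" using ext_M by blast
    have S: "is_set {x \<in> ext X. ap (ap c (ap e n)) x \<in> ext (ap (ap e n) x)}"
      by (rule is_set_Collect) (intro definable_intros ap_M cM eM)
    show "\<exists>!y. y \<in> M \<and> (\<forall>x\<in>M. x \<in> ext y \<longleftrightarrow> x \<in> ext X \<and> ap (ap c (ap e n)) x \<in> ext (ap (ap e n) x))"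
    proof (rule ex1I[of _ "mk {x \<in> ext X. ap (ap c (ap e n)) x \<in> ext (ap (ap e n) x)}"])
      show "y = mk {x \<in> ext X. ap (ap c (ap e n)) x \<in> ext (ap (ap e n) x)}"
        if "y \<in> M \<and> (\<forall>x\<in>M. x \<in> ext y \<longleftrightarrow> x \<in> ext X \<and> ap (ap c (ap e n)) x \<in> ext (ap (ap e n) x))" for y
        using that eq_mk_iff[OF S, of y] by simp
    qed (use S in simp)
  qed
  then obtain s where s: "func s w" "\<And>n x. n \<in> ext w \<Longrightarrow> x \<in> M \<Longrightarrow> x \<in> ext (ap s n) \<longleftrightarrow>
      x \<in> ext X \<and> ap (ap c (ap e n)) x \<in> ext (ap (ap e n) x)" by blast
  have sM: "s \<in> M" using s(1) func_M by blast
  have "large U {x \<in> ext X. \<forall>n\<in>ext w. x \<in> ext (ap s n)}"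
  proof (rule large_countable_Int[OF w s(1)])
    fix n assume n: "n \<in> ext w"
    have "ext (ap s n) = {x \<in> ext X. ap (ap c (ap e n)) x \<in> ext (ap (ap e n) x)}"
      using s(2)[OF n] ext_M by blast
    moreover have "memU (ap c (ap e n)) (ap e n)" using c(2)[OF eB[OF n]] by blast
    ultimately have "large U (ext (ap s n))" unfolding memU_def ae_def by simp
    then show "ap s n \<in> ext U" using large_iff[OF is_set_ext] sM by simp
  qed
  then obtain x where x: "x \<in> ext X" "\<And>n. n \<in> ext w \<Longrightarrow> x \<in> ext (ap s n)"
    using large_nonempty by blast
  have xM: "x \<in> M" using x(1) ext_M by blast
  have desc: "ap (ap c (ap e n)) x \<in> ext (ap (ap e n) x)" if "n \<in> ext w" for n
    using s(2)[OF that xM] x(2)[OF that] by blast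
  have S: "is_set ((\<lambda>n. ap (ap e n) x) ` ext w)"
    by (rule is_set_image[OF omega_M[OF w]], intro definable_intros eM xM) (simp add: eM)
  have "(\<lambda>n. ap (ap e n) x) ` ext w \<noteq> {}" using omega_zero[OF w] by blast
  then obtain n where n: "n \<in> ext w" "\<forall>y\<in>ext (ap (ap e n) x). y \<notin> (\<lambda>n. ap (ap e n) x) ` ext w"
    using minimal_element[OF S] by blast
  obtain m where m: "m \<in> ext w" "ext m = insert n (ext n)" using omega_succ[OF w n(1)] by blast
  have "ap (ap e m) x \<in> ext (ap (ap e n) x)" using desc[OF n(1)] e(3)[OF m(1) n(1) m(2)] by simp
  then show False using n(2) m(1) by blast
qed

subsection \<open>The transitive collapse\<close>

text \<open>The approximations of \<open>collapse_approx\<close>, phrased with \<open>ap\<close>,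
  \<open>eqU\<close> and \<open>memU\<close>, to which the definability rules apply.\<close>

definition approx :: "'v \<Rightarrow> 'v \<Rightarrow> bool" where
  "approx D p \<longleftrightarrow> D \<in> M \<and> (\<forall>f\<in>ext D. func f X) \<and> func p D \<and>
     (\<forall>f\<in>ext D. \<forall>g\<in>M. func g X \<longrightarrow> memU g f \<longrightarrow> (\<exists>h\<in>ext D. eqU g h)) \<and>
     (\<forall>f\<in>ext D. ext (ap p f) = {ap p g | g. g \<in> ext D \<and> memU g f})"

lemma approxD:
  assumes "approx D p"
  shows "D \<in> M" "p \<in> M" "func p D" "\<And>f. f \<in> ext D \<Longrightarrow> func f X"
    "\<And>f g. f \<in> ext D \<Longrightarrow> func g X \<Longrightarrow> memU g f \<Longrightarrow> \<exists>h\<in>ext D. eqU g h"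
    "\<And>f. f \<in> ext D \<Longrightarrow> ext (ap p f) = {ap p g | g. g \<in> ext D \<and> memU g f}"
  using assms func_M unfolding approx_def by blast+

lemma approx_iff: "collapse_approx U D p \<longleftrightarrow> approx D p"
proof -
  have 1: "ult_mem U g f = memU g f" "ult_eq U g f = eqU g f" if "func f X" "func g X" for f g
    using ult_mem_iff ult_eq_iff that by blast+
  have 2: "app p f = ap p f" if "func p D" "f \<in> ext D" for f using func_ap[OF that] by simp
  show ?thesis
  proof (cases "D \<in> M \<and> (\<forall>f\<in>ext D. func f X) \<and> func p D")
    case True
    then have D: "D \<in> M" "\<And>f. f \<in> ext D \<Longrightarrow> func f X" "func p D" by blast+
    have a: "(\<forall>f\<in>ext D. \<forall>g\<in>Fn U. ult_mem U g f \<longrightarrow> (\<exists>h\<in>ext D. ult_eq U g h)) \<longleftrightarrow>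
        (\<forall>f\<in>ext D. \<forall>g\<in>M. func g X \<longrightarrow> memU g f \<longrightarrow> (\<exists>h\<in>ext D. eqU g h))"
    proof -
      have "(ult_mem U g f \<longrightarrow> (\<exists>h\<in>ext D. ult_eq U g h)) \<longleftrightarrow> (memU g f \<longrightarrow> (\<exists>h\<in>ext D. eqU g h))"
        if "f \<in> ext D" "func g X" for f g
        using 1 D(2) that by (metis (no_types, lifting))
      then show ?thesis unfolding Ball_def Fn_iff using func_M by (metis (no_types, lifting))
    qed
    have b: "(\<forall>f\<in>ext D. ext (app p f) = {app p g | g. g \<in> ext D \<and> ult_mem U g f}) \<longleftrightarrow>
        (\<forall>f\<in>ext D. ext (ap p f) = {ap p g | g. g \<in> ext D \<and> memU g f})"
    proof (intro ball_cong refl)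
      fix f assume f: "f \<in> ext D"
      have "{app p g | g. g \<in> ext D \<and> ult_mem U g f} = {ap p g | g. g \<in> ext D \<and> memU g f}"
        using 1(1)[OF D(2)[OF f]] D(2) 2[OF D(3)] by (metis (no_types, lifting))
      then show "(ext (app p f) = {app p g | g. g \<in> ext D \<and> ult_mem U g f}) =
          (ext (ap p f) = {ap p g | g. g \<in> ext D \<and> memU g f})"
        using 2[OF D(3) f] by simp
    qed
    show ?thesis unfolding collapse_approx_def approx_def a b using True by (auto simp: Fn_iff)
  next
    case False
    then have "\<not> approx D p" unfolding approx_def by blast
    moreover have "\<not> collapse_approx U D p"
      using False unfolding collapse_approx_def by (auto simp: subset_eq Fn_iff)
    ultimately show ?thesis by blast
  qed
qed

text \<open>This makes the collapse independent of the approximation and of the representative at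
  once. At a \<open>memU\<close>-minimal failure the predecessors are exchanged between
  \<open>D\<close> and \<open>D'\<close>, which contain them only up to \<open>eqU\<close>.\<close>

lemma approx_cong:
  assumes D: "approx D p" and D': "approx D' p'" and f: "f \<in> ext D" "f' \<in> ext D'" "eqU f f'"
  shows "ap p f = ap p' f'"
proof (rule ccontr)
  assume ne: "ap p f \<noteq> ap p' f'"
  note A = approxD[OF D] and A' = approxD[OF D']
  define B where "B = {f \<in> ext D. \<exists>f'\<in>ext D'. eqU f f' \<and> ap p f \<noteq> ap p' f'}"
  have B: "is_set B" unfolding B_def by (rule is_set_sep[OF A(1)]) (intro definable_intros A(2) A'(1,2))
  have "f \<in> B" unfolding B_def using f ne by blast
  then obtain a where a: "a \<in> B" "\<And>b. b \<in> B \<Longrightarrow> \<not> memU b a"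
    using memU_wf[OF mk_M[OF B]] ext_mk[OF B] by auto
  then obtain a' where aD: "a \<in> ext D" and a': "a' \<in> ext D'" "eqU a a'" "ap p a \<noteq> ap p' a'"
    unfolding B_def by blast
  have *: "ap p b = ap p' b'" if "b \<in> ext D" "b' \<in> ext D'" "memU b a" "eqU b b'" for b b'
    using a(2)[of b] that unfolding B_def by blast
  have M: "f \<in> M" if "func f X" for f using that func_M by blast
  have "ap p a = ap p' a'"
  proof (rule extI)
    show "u \<in> ext (ap p a) \<longleftrightarrow> u \<in> ext (ap p' a')" for u
    proof
      assume "u \<in> ext (ap p a)"
      then obtain b where b: "u = ap p b" "b \<in> ext D" "memU b a" using A(6)[OF aD] by blast
      have ba': "memU b a'"
        by (rule memU_cong[OF _ _ _ _ eqU_refl a'(2) b(3)]) (use b(2) aD a'(1) ext_M in blast)+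
      obtain b' where b': "b' \<in> ext D'" "eqU b b'" using A'(5)[OF a'(1) A(4)[OF b(2)] ba'] by blast
      have "memU b' a'"
        by (rule memU_cong[OF _ _ _ _ b'(2) eqU_refl ba']) (use b(2) b'(1) a'(1) ext_M in blast)+
      then show "u \<in> ext (ap p' a')" using A'(6)[OF a'(1)] b' * b by auto
    next
      assume "u \<in> ext (ap p' a')"
      then obtain b' where b': "u = ap p' b'" "b' \<in> ext D'" "memU b' a'" using A'(6)[OF a'(1)] by blast
      have ba: "memU b' a"
        by (rule memU_cong[OF _ _ _ _ eqU_refl eqU_sym[OF a'(2)] b'(3)]) (use b'(2) aD a'(1) ext_M in blast)+
      obtain b where b: "b \<in> ext D" "eqU b' b" using A(5)[OF aD A'(4)[OF b'(2)] ba] by blast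
      have "memU b a"
        by (rule memU_cong[OF _ _ _ _ b(2) eqU_refl ba]) (use b(1) b'(2) aD ext_M in blast)+
      moreover then have "ap p b = u" using *[OF b(1) b'(2) _ eqU_sym[OF b(2)]] b'(1) by simp
      ultimately show "u \<in> ext (ap p a)" using A(6)[OF aD] b(1) by blast
    qed
  qed (use A(2) A'(2) in simp_all)
  then show False using a'(3) by blast
qed

text \<open>Modulo \<open>U\<close>, every predecessor of a function into a transitive
  \<open>T\<close> is again a function into \<open>T\<close>. The functions into \<open>T\<close>
  are therefore closed in the required sense, and they form a set, so the collapse can be defined on
  them by recursion along \<open>memU\<close>.\<close>

lemma approx_functions:
  assumes T: "T \<in> M" "transitive_set T" "ext T \<noteq> {}"
  defines "D \<equiv> mk {f. func f X \<and> (\<forall>x\<in>ext X. ap f x \<in> ext T)}"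
  shows "\<exists>p. approx D p" and "ext D = {f. func f X \<and> (\<forall>x\<in>ext X. ap f x \<in> ext T)}"
proof -
  show extD: "ext D = {f. func f X \<and> (\<forall>x\<in>ext X. ap f x \<in> ext T)}"
    unfolding D_def by (rule ext_mk[OF is_set_functions[OF X_M T(1)]])
  have DM: "D \<in> M" unfolding D_def by (rule mk_M[OF is_set_functions[OF X_M T(1)]])
  define H where "H f p = mk {ap p g | g. g \<in> ext D \<and> memU g f}" for f p
  have S: "is_set {ap p g | g. g \<in> ext D \<and> memU g f}" if M: "f \<in> M" "p \<in> M" for f p
  proof -
    have B: "is_set {g \<in> ext D. memU g f}" by (rule is_set_sep[OF DM]) (intro definable_intros M)
    have "is_set (ap p ` ext (mk {g \<in> ext D. memU g f}))"
      by (rule is_set_image[OF mk_M[OF B]], intro definable_intros M) (simp add: M)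
    moreover have "ap p ` ext (mk {g \<in> ext D. memU g f}) = {ap p g | g. g \<in> ext D \<and> memU g f}"
      unfolding ext_mk[OF B] by blast
    ultimately show ?thesis by simp
  qed
  have "\<exists>p. func p D \<and> (\<forall>f\<in>ext D. ap p f = H f p)"
  proof (rule wf_recursion[OF DM, where R = memU])
    show "definable_fun (\<lambda>s. H (s 0) (s 1))"
    proof (rule definable_funI[where Q = "\<lambda>s v. \<forall>u\<in>M. u \<in> ext v \<longleftrightarrow> (\<exists>g\<in>ext D. memU g (s 0) \<and> u = ap (s 1) g)"])
      fix s :: "nat \<Rightarrow> 'v" and v assume "range s \<subseteq> M"
      then have s: "s 0 \<in> M" "s 1 \<in> M" by blast+
      show "H (s 0) (s 1) \<in> M" unfolding H_def by (rule mk_M[OF S[OF s]])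
      show "(v = H (s 0) (s 1)) = (\<forall>u\<in>M. u \<in> ext v \<longleftrightarrow> (\<exists>g\<in>ext D. memU g (s 0) \<and> u = ap (s 1) g))"
        if "v \<in> M" unfolding H_def eq_mk_iff[OF S[OF s] that] by blast
    qed (intro definable_intros DM)
    show "\<exists>f\<in>ext B. \<forall>g\<in>ext B. \<not> memU g f" if "B \<in> M" "ext B \<noteq> {}" for B by (rule memU_wf[OF that])
    show "H f p = H f q" if "\<And>g. g \<in> ext D \<Longrightarrow> memU g f \<Longrightarrow> ap p g = ap q g" for f p q
    proof -
      have "{ap p g | g. g \<in> ext D \<and> memU g f} = {ap q g | g. g \<in> ext D \<and> memU g f}"
        using that by (metis (no_types, lifting))
      then show ?thesis unfolding H_def by simp
    qed
  qed (intro definable_intros)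
  then obtain p where p: "func p D" "\<And>f. f \<in> ext D \<Longrightarrow> ap p f = H f p" by blast
  obtain t where t: "t \<in> ext T" using T(3) by blast
  have "approx D p"
    unfolding approx_def
  proof (intro conjI ballI impI DM p(1))
    show "func f X" if "f \<in> ext D" for f using that extD by blast
    show "ext (ap p f) = {ap p g | g. g \<in> ext D \<and> memU g f}" if "f \<in> ext D" for f
      unfolding p(2)[OF that] H_def by (rule ext_mk[OF S[OF ext_M[OF that] func_M[OF p(1)]]])
    fix f g assume f: "f \<in> ext D" and g: "func g X" and gf: "memU g f"
    have gM: "g \<in> M" using g func_M by blast
    have tM: "t \<in> M" using t ext_M by blast
    \<comment> \<open>\<open>g\<close> takes values in \<open>T\<close> only almost everywhere.
      Elsewhere it is redirected to an arbitrary element \<open>t\<close> of \<open>T\<close>, which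
      does not change it modulo \<open>U\<close>.\<close>
    have "\<exists>h. func h X \<and> (\<forall>x\<in>ext X. if ap g x \<in> ext T then ap h x = ap g x else ap h x = t)"
    proof (rule function_exists[OF X_M])
      show "definable (\<lambda>s. if ap g (s 0) \<in> ext T then s 1 = ap g (s 0) else s 1 = t)"
        by (intro definable_intros gM tM T(1))
      show "\<exists>!y. y \<in> M \<and> (if ap g x \<in> ext T then y = ap g x else y = t)" for x
        using gM tM by (cases "ap g x \<in> ext T") auto
    qed
    then obtain h where h: "func h X"
      "\<And>x. x \<in> ext X \<Longrightarrow> if ap g x \<in> ext T then ap h x = ap g x else ap h x = t" by blast
    have hM: "h \<in> M" using h(1) func_M by blast
    have "ap h x \<in> ext T" if "x \<in> ext X" for x using h(2)[OF that] t by (simp split: if_splits)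
    then have hD: "h \<in> ext D" using h(1) extD by blast
    have "eqU g h"
      unfolding eqU_def
    proof (rule ae_mono[OF gf[unfolded memU_def]])
      show "definable (\<lambda>s. ap g (s 0) = ap h (s 0))" by (intro definable_intros gM hM)
      fix x assume x: "x \<in> ext X" "ap g x \<in> ext (ap f x)"
      have "ap f x \<in> ext T" using f x(1) extD by blast
      then have "ap g x \<in> ext T" using x(2) transitive_setD[OF T(2)] by blast
      then show "ap g x = ap h x" using h(2)[OF x(1)] by simp
    qed
    then show "\<exists>h\<in>ext D. eqU g h" using hD by blast
  qed
  then show "\<exists>p. approx D p" by blast
qed

lemma approx_exists:
  assumes f: "func f X" and g: "func g X"
  shows "\<exists>D p. approx D p \<and> f \<in> ext D \<and> g \<in> ext D"
proof -
  have M: "f \<in> M" "g \<in> M" using f g func_M by blast+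
  \<comment> \<open>A transitive set that contains a function contains its values, so both
    \<open>f\<close> and \<open>g\<close> are functions into \<open>T\<close>.\<close>
  obtain T where T: "T \<in> M" "transitive_set T" "mk {f, g} \<in> ext T"
    using transitive_closure[OF mk_M[OF is_set_pair[OF M]]] by blast
  have fg: "f \<in> ext T" "g \<in> ext T" using transitive_setD[OF T(2,3)] M by simp_all
  have "ext T \<noteq> {}" using fg by blast
  from approx_functions[OF T(1,2) this] show ?thesis
    using ap_in_transitive[OF T(2) fg(1) f] ap_in_transitive[OF T(2) fg(2) g] f g by blast
qed

definition col :: "'v \<Rightarrow> 'v" where "col f = collapse U f"

lemma col_eq: assumes D: "approx D p" "f \<in> ext D" shows "col f = ap p f"
  unfolding col_def collapse_def approx_iff
proof (rule the_equality)
  show "\<exists>D q. approx D q \<and> f \<in> ext D \<and> ap p f = app q f"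
    using D func_ap[OF approxD(3)[OF D(1)] D(2)] by metis
  fix y assume "\<exists>D q. approx D q \<and> f \<in> ext D \<and> y = app q f"
  then obtain D' q where q: "approx D' q" "f \<in> ext D'" "y = app q f" by blast
  then show "y = ap p f"
    using func_ap[OF approxD(3)[OF q(1)] q(2)] approx_cong[OF q(1) D(1) q(2) D(2) eqU_refl] by simp
qed

lemma col_M [simp]: assumes "func f X" shows "col f \<in> M"
proof -
  obtain D p where D: "approx D p" "f \<in> ext D" using approx_exists[OF assms assms] by blast
  then show ?thesis using col_eq[OF D] approxD(2)[OF D(1)] by simp
qed

lemma col_cong: assumes f: "func f X" and g: "func g X" and fg: "eqU f g" shows "col f = col g"
proof -
  obtain D p where D: "approx D p" "f \<in> ext D" "g \<in> ext D" using approx_exists[OF f g] by blast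
  then show ?thesis using col_eq[OF D(1)] approx_cong[OF D(1) D(1) D(2,3) fg] by simp
qed

lemma ext_col: assumes f: "func f X" shows "ext (col f) = {col g | g. func g X \<and> memU g f}"
proof -
  obtain D p where D: "approx D p" "f \<in> ext D" using approx_exists[OF f f] by blast
  note A = approxD[OF D(1)]
  have 1: "ext (col f) = {ap p g | g. g \<in> ext D \<and> memU g f}" using A(6)[OF D(2)] col_eq[OF D] by simp
  show ?thesis
  proof (intro equalityI subsetI)
    fix u assume "u \<in> ext (col f)"
    then obtain g where g: "g \<in> ext D" "memU g f" "u = ap p g" using 1 by blast
    then have "func g X" "u = col g" using A(4) col_eq[OF D(1)] by simp_all
    then show "u \<in> {col g | g. func g X \<and> memU g f}" using g(2) by blast
  next
    fix u assume "u \<in> {col g | g. func g X \<and> memU g f}"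
    then obtain g where g: "func g X" "memU g f" "u = col g" by blast
    then obtain h where h: "h \<in> ext D" "eqU g h" using A(5)[OF D(2)] by blast
    have "memU h f"
      by (rule memU_cong[OF _ _ _ _ h(2) eqU_refl g(2)]) (use h(1) D(2) g(1) func_M ext_M in blast)+
    moreover have "u = ap p h" using g col_cong[OF g(1) A(4)[OF h(1)] h(2)] col_eq[OF D(1) h(1)] by simp
    ultimately show "u \<in> ext (col f)" using 1 h(1) by blast
  qed
qed

text \<open>If \<open>f\<close> and \<open>g\<close> differ almost everywhere, choice picks at each
  such point an element of exactly one of the two values. The resulting \<open>h\<close> can belong
  neither to both nor to none of \<open>f\<close> and \<open>g\<close> modulo
  \<open>U\<close>.\<close>

lemma eqU_extensional:
  assumes f: "func f X" and g: "func g X"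
    and fg: "\<And>h. func h X \<Longrightarrow> memU h f \<longleftrightarrow> memU h g"
  shows "eqU f g"
proof (rule ccontr)
  assume ne: "\<not> eqU f g"
  have M: "f \<in> M" "g \<in> M" using f g func_M by blast+
  let ?Q = "\<lambda>x z. (z \<in> ext (ap f x)) \<noteq> (z \<in> ext (ap g x))"
  have "definable (\<lambda>s. ?Q (s 0) (s 1))" by (intro definable_intros M)
  from choice_function[OF X_M this] obtain h where h: "func h X"
    "\<And>x. x \<in> ext X \<Longrightarrow> (\<exists>z\<in>M. ?Q x z) \<Longrightarrow> ?Q x (ap h x)" by blast
  have hM: "h \<in> M" using h(1) func_M by blast
  have "ae (\<lambda>x. ap f x \<noteq> ap g x)"
    using ne ae_not[of "\<lambda>x. ap f x = ap g x"] unfolding eqU_def by (simp add: definable_intros M)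
  then have *: "ae (\<lambda>x. ?Q x (ap h x))"
  proof (rule ae_mono)
    show "definable (\<lambda>s. ?Q (s 0) (ap h (s 0)))" by (intro definable_intros M hM)
    fix x assume x: "x \<in> ext X" "ap f x \<noteq> ap g x"
    then have "\<exists>z\<in>M. ?Q x z" using extI[of "ap f x" "ap g x"] M by auto
    then show "?Q x (ap h x)" by (rule h(2)[OF x(1)])
  qed
  have "memU h f \<noteq> memU h g"
  proof
    assume eq: "memU h f = memU h g"
    show False
    proof (cases "memU h f")
      case True
      then have "ae (\<lambda>x. ap h x \<in> ext (ap f x) \<and> ap h x \<in> ext (ap g x))"
        using eq ae_conjI unfolding memU_def by blast
      from ae_ex[OF ae_conjI[OF this *]] show False by blast
    next
      case False
      then have "ae (\<lambda>x. ap h x \<notin> ext (ap f x))" "ae (\<lambda>x. ap h x \<notin> ext (ap g x))"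
        using eq unfolding memU_def by (simp_all add: ae_not definable_intros M hM)
      from ae_ex[OF ae_conjI[OF ae_conjI[OF this] *]] show False by blast
    qed
  qed
  then show False using fg[OF h(1)] by blast
qed

text \<open>Injectivity of a Mostowski collapse. At a \<open>memU\<close>-minimal failure
  \<open>a\<close>, with partner \<open>b\<close>, the predecessors of \<open>a\<close> and
  \<open>b\<close> have the same collapses, hence agree up to \<open>eqU\<close>, and extensionality
  of the ultrapower gives \<open>eqU a b\<close>.\<close>

lemma col_inj: assumes f: "func f X" and g: "func g X" and eq: "col f = col g" shows "eqU f g"
proof (rule ccontr)
  assume ne: "\<not> eqU f g"
  obtain D p where D: "approx D p" "f \<in> ext D" "g \<in> ext D" using approx_exists[OF f g] by blast
  note A = approxD[OF D(1)]
  define B where "B = {f \<in> ext D. \<exists>g\<in>ext D. \<not> eqU f g \<and> ap p f = ap p g}"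
  have B: "is_set B" unfolding B_def by (rule is_set_sep[OF A(1)]) (intro definable_intros A(1,2))
  have "f \<in> B" unfolding B_def using D ne eq col_eq[OF D(1)] by auto
  then obtain a where a: "a \<in> B" "\<And>b. b \<in> B \<Longrightarrow> \<not> memU b a"
    using memU_wf[OF mk_M[OF B]] ext_mk[OF B] by auto
  then obtain b where ab: "a \<in> ext D" "b \<in> ext D" "\<not> eqU a b" "ap p a = ap p b" unfolding B_def by blast
  have M: "a \<in> M" "b \<in> M" using ab ext_M by blast+
  have inj: "eqU c d" if "c \<in> ext D" "d \<in> ext D" "memU c a" "ap p c = ap p d" for c d
    using a(2)[of c] that unfolding B_def by blast
  have "eqU a b"
  proof (rule eqU_extensional[OF A(4)[OF ab(1)] A(4)[OF ab(2)]])
    fix h assume h: "func h X"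
    have hM: "h \<in> M" using h func_M by blast
    show "memU h a \<longleftrightarrow> memU h b"
    proof
      assume ha: "memU h a"
      then obtain c where c: "c \<in> ext D" "eqU h c" using A(5)[OF ab(1) h] by blast
      have cM: "c \<in> M" using c ext_M by blast
      have ca: "memU c a" by (rule memU_cong[OF hM M(1) cM M(1) c(2) eqU_refl ha])
      then have "ap p c \<in> ext (ap p b)" using A(6)[OF ab(1)] ab(4) c(1) by auto
      then obtain d where d: "d \<in> ext D" "memU d b" "ap p c = ap p d" using A(6)[OF ab(2)] by blast
      have dM: "d \<in> M" using d ext_M by blast
      have "eqU d h" using eqU_sym[OF eqU_trans[OF hM dM c(2) inj[OF c(1) d(1) ca d(3)]]] .
      then show "memU h b" by (rule memU_cong[OF dM M(2) hM M(2) _ eqU_refl d(2)])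
    next
      assume hb: "memU h b"
      then obtain c where c: "c \<in> ext D" "eqU h c" using A(5)[OF ab(2) h] by blast
      have cM: "c \<in> M" using c ext_M by blast
      have cb: "memU c b" by (rule memU_cong[OF hM M(2) cM M(2) c(2) eqU_refl hb])
      then have "ap p c \<in> ext (ap p a)" using A(6)[OF ab(2)] ab(4) c(1) by auto
      then obtain d where d: "d \<in> ext D" "memU d a" "ap p c = ap p d" using A(6)[OF ab(1)] by blast
      have dM: "d \<in> M" using d ext_M by blast
      have "eqU d c" by (rule inj[OF d(1) c(1) d(2) d(3)[symmetric]])
      then have "eqU d h" using eqU_trans[OF dM hM _ eqU_sym[OF c(2)]] by blast
      then show "memU h a" by (rule memU_cong[OF dM M(1) hM M(1) _ eqU_refl d(2)])
    qed
  qed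
  then show False using ab(3) by blast
qed

lemma col_eq_iff: "func f X \<Longrightarrow> func g X \<Longrightarrow> col f = col g \<longleftrightarrow> eqU f g"
  using col_inj col_cong by blast

lemma col_mem_iff: assumes f: "func f X" and g: "func g X" shows "col f \<epsilon> col g \<longleftrightarrow> memU f g"
proof -
  have "col f \<epsilon> col g \<longleftrightarrow> col f \<in> ext (col g)" by (simp add: ext_iff f)
  also have "\<dots> \<longleftrightarrow> memU f g"
  proof
    assume "col f \<in> ext (col g)"
    then obtain h where h: "func h X" "memU h g" "col f = col h" using ext_col[OF g] by blast
    have "eqU h f" using col_inj[OF h(1) f] h(3) by simp
    then show "memU f g"
      using memU_cong[OF func_M[OF h(1)] func_M[OF g] func_M[OF f] func_M[OF g] _ eqU_refl h(2)] by blast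
  qed (use ext_col[OF g] f in blast)
  finally show ?thesis .
qed

lemma Ult_eq: "Ult U = col ` {f. func f X}"
  unfolding Ult_def col_def Fn_iff[abs_def, symmetric] by simp

lemma Ult_iff: "u \<in> Ult U \<longleftrightarrow> (\<exists>f. func f X \<and> u = col f)"
  unfolding Ult_eq by blast

lemma Ult_subset: "Ult U \<subseteq> M"
  unfolding Ult_eq by auto

lemma Ult_transitive: "u \<in> Ult U \<Longrightarrow> x \<in> ext u \<Longrightarrow> x \<in> Ult U"
  unfolding Ult_iff using ext_col by blast

lemma ext_Ult: assumes "u \<in> Ult U" shows "mem_structure.ext (Ult U) (\<epsilon>) u = ext u"
  unfolding mem_structure.ext_def using Ult_transitive[OF assms] Ult_subset by (auto simp: ext_def)

subsection \<open>The theorem of Los\<close>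

lemma los_sat:
  assumes "\<And>i. func (fs i) X"
  shows "mem_structure.sat (Ult U) (\<epsilon>) \<phi> (\<lambda>i. col (fs i)) \<longleftrightarrow> ae (\<lambda>x. sat \<phi> (\<lambda>i. ap (fs i) x))"
  using assms
proof (induction \<phi> arbitrary: fs)
  case (FMem i k)
  have "ap (fs i) x \<in> ext (ap (fs k) x) \<longleftrightarrow> ap (fs i) x \<epsilon> ap (fs k) x" for x
    by (rule ext_iff[OF ap_M[OF func_M[OF FMem]]])
  then show ?case using col_mem_iff[OF FMem FMem] by (simp add: mem_structure.sat.simps memU_def)
next
  case (FEq i k)
  show ?case using col_eq_iff[OF FEq FEq] by (simp add: mem_structure.sat.simps eqU_def)
next
  case (FNeg \<phi>)
  have "definable (\<lambda>s. sat \<phi> (\<lambda>i. ap (fs i) (s 0)))"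
    by (rule def_sat) (intro definable_intros func_M[OF FNeg.prems])
  then show ?case using FNeg.IH[OF FNeg.prems] by (simp add: mem_structure.sat.simps ae_not)
next
  case (FConj \<phi> \<psi>)
  have "definable (\<lambda>s. sat \<chi> (\<lambda>i. ap (fs i) (s 0)))" for \<chi>
    by (rule def_sat) (intro definable_intros func_M[OF FConj.prems])
  then show ?case using FConj.IH[OF FConj.prems] by (simp add: mem_structure.sat.simps ae_conj)
next
  case (FEx \<phi>)
  have "(\<lambda>i. ap (case_nat g fs i) x) = case_nat (ap g x) (\<lambda>i. ap (fs i) x)" for g x
    by (rule HOL.ext) (simp split: nat.split)
  moreover have "(\<lambda>i. col (case_nat g fs i)) = case_nat (col g) (\<lambda>i. col (fs i))" for g
    by (rule HOL.ext) (simp split: nat.split)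
  moreover have "func (case_nat g fs i) X" if "func g X" for g i
    using that FEx.prems by (simp split: nat.split)
  ultimately have IH: "mem_structure.sat (Ult U) (\<epsilon>) \<phi> (case_nat (col g) (\<lambda>i. col (fs i))) \<longleftrightarrow>
      ae (\<lambda>x. sat \<phi> (case_nat (ap g x) (\<lambda>i. ap (fs i) x)))" if "func g X" for g
    using FEx.IH[of "case_nat g fs"] that by simp
  have d: "definable (\<lambda>s. sat \<phi> (case_nat (F s) (\<lambda>i. ap (fs i) (G s))))"
    if "definable_fun F" "definable_fun G" for F G
  proof -
    have "definable (\<lambda>s. sat \<phi> (\<lambda>i. case_nat F (\<lambda>i s. ap (fs i) (G s)) i s))"
    proof (rule def_sat)
      show "definable_fun (\<lambda>s. case_nat F (\<lambda>i s. ap (fs i) (G s)) i s)" for i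
        using that(1) defun_ap[OF defun_const[OF func_M[OF FEx.prems]] that(2)] by (cases i) simp_all
    qed
    moreover have "(\<lambda>i. case_nat F (\<lambda>i s. ap (fs i) (G s)) i s) = case_nat (F s) (\<lambda>i. ap (fs i) (G s))" for s
      by (rule HOL.ext) (simp split: nat.split)
    ultimately show ?thesis by simp
  qed
  have "(\<exists>u\<in>Ult U. mem_structure.sat (Ult U) (\<epsilon>) \<phi> (case_nat u (\<lambda>i. col (fs i)))) \<longleftrightarrow>
      (\<exists>g. func g X \<and> ae (\<lambda>x. sat \<phi> (case_nat (ap g x) (\<lambda>i. ap (fs i) x))))"
  proof -
    have *: "(\<exists>u\<in>Ult U. Q u) \<longleftrightarrow> (\<exists>g. func g X \<and> Q (col g))" for Q unfolding Bex_def Ult_iff by blast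
    show ?thesis unfolding * using IH by (simp cong: conj_cong)
  qed
  also have "\<dots> \<longleftrightarrow> ae (\<lambda>x. \<exists>y\<in>M. sat \<phi> (case_nat y (\<lambda>i. ap (fs i) x)))"
  proof
    assume "\<exists>g. func g X \<and> ae (\<lambda>x. sat \<phi> (case_nat (ap g x) (\<lambda>i. ap (fs i) x)))"
    then obtain g where g: "func g X" "ae (\<lambda>x. sat \<phi> (case_nat (ap g x) (\<lambda>i. ap (fs i) x)))" by blast
    from g(2) show "ae (\<lambda>x. \<exists>y\<in>M. sat \<phi> (case_nat y (\<lambda>i. ap (fs i) x)))"
    proof (rule ae_mono)
      show "definable (\<lambda>s. \<exists>y\<in>M. sat \<phi> (case_nat y (\<lambda>i. ap (fs i) (s 0))))" by (intro definable_intros d)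
    qed (use ap_M[OF func_M[OF g(1)]] in blast)
  next
    assume *: "ae (\<lambda>x. \<exists>y\<in>M. sat \<phi> (case_nat y (\<lambda>i. ap (fs i) x)))"
    \<comment> \<open>Here the axiom of choice in \<open>M\<close> enters: the witnesses at almost
      all points are collected into one function \<open>g\<close>.\<close>
    have "definable (\<lambda>s. sat \<phi> (case_nat (s 1) (\<lambda>i. ap (fs i) (s 0))))" by (intro d definable_intros)
    from choice_function[OF X_M this] obtain g where g: "func g X"
      "\<And>x. x \<in> ext X \<Longrightarrow> \<exists>y\<in>M. sat \<phi> (case_nat y (\<lambda>i. ap (fs i) x)) \<Longrightarrow>
        sat \<phi> (case_nat (ap g x) (\<lambda>i. ap (fs i) x))" by blast
    have "ae (\<lambda>x. sat \<phi> (case_nat (ap g x) (\<lambda>i. ap (fs i) x)))"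
      by (rule ae_mono[OF *]) (intro d definable_intros func_M[OF g(1)], rule g(2))
    then show "\<exists>g. func g X \<and> ae (\<lambda>x. sat \<phi> (case_nat (ap g x) (\<lambda>i. ap (fs i) x)))" using g(1) by blast
  qed
  finally show ?case by (simp add: mem_structure.sat.simps)
qed

theorem los:
  assumes P: "udefinable E P" and fs: "\<And>i. func (fs i) X"
  shows "P (Ult U) (\<lambda>i. col (fs i)) \<longleftrightarrow> ae (\<lambda>x. P M (\<lambda>i. ap (fs i) x))"
proof -
  obtain \<phi> where \<phi>: "\<And>M s. range s \<subseteq> M \<Longrightarrow> P M s = mem_structure.sat M E \<phi> s"
    using P unfolding udefinable_def by blast
  have "P M (\<lambda>i. ap (fs i) x) = sat \<phi> (\<lambda>i. ap (fs i) x)" for x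
    by (rule \<phi>) (use func_M[OF fs] in auto)
  moreover have "P (Ult U) (\<lambda>i. col (fs i)) = mem_structure.sat (Ult U) E \<phi> (\<lambda>i. col (fs i))"
    by (rule \<phi>) (use fs Ult_iff in blast)
  ultimately show ?thesis using los_sat[OF fs] by simp
qed

text \<open>Stated for whole assignments in order to cover the schemas, whose instances may have any
  number of parameters.\<close>

lemma los_transfer:
  assumes P: "udefinable E P" and M: "\<And>s. range s \<subseteq> M \<Longrightarrow> P M s" and s: "range s \<subseteq> Ult U"
  shows "P (Ult U) s"
proof -
  have "\<exists>f. func f X \<and> s i = col f" for i using s Ult_iff by blast
  then obtain fs where fs: "\<And>i. func (fs i) X" "\<And>i. s i = col (fs i)" by metis
  have "ae (\<lambda>x. P M (\<lambda>i. ap (fs i) x))"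
    by (rule ae_all, rule M) (use func_M[OF fs(1)] in auto)
  then have "P (Ult U) (\<lambda>i. col (fs i))" using los[OF P fs(1)] by simp
  moreover have "s = (\<lambda>i. col (fs i))" using fs(2) by blast
  ultimately show ?thesis by simp
qed

section \<open>The embedding \<open>j\<close> and the seed\<close>

lemma const_exists: "c \<in> M \<Longrightarrow> \<exists>f. func f X \<and> (\<forall>x\<in>ext X. ap f x = c)"
  by (rule lambda_exists[OF X_M, where F = "\<lambda>_. c"]) (intro definable_intros | simp)+

lemma the_fn_props:
  assumes "\<exists>f. func f X \<and> (\<forall>x\<in>ext X. ap f x = F x)"
  shows "func (the_fn U F) X" "\<And>x. x \<in> ext X \<Longrightarrow> ap (the_fn U F) x = F x"
proof -
  obtain f where f: "func f X" "\<And>x. x \<in> ext X \<Longrightarrow> ap f x = F x" using assms by blast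
  have "the_fn U F = f"
    unfolding the_fn_def space_eq
  proof (rule the_equality)
    show "f \<in> Fn U \<and> (\<forall>x\<in>ext X. app f x = F x)"
      using f func_ap[OF f(1)] by (simp add: Fn_iff)
    fix g assume "g \<in> Fn U \<and> (\<forall>x\<in>ext X. app g x = F x)"
    then have g: "func g X" "\<And>x. x \<in> ext X \<Longrightarrow> app g x = F x" by (simp_all add: Fn_iff)
    show "g = f" by (rule func_eqI[OF g(1) f(1)]) (simp add: func_ap[OF g(1)] g(2) f(2))
  qed
  then show "func (the_fn U F) X" "\<And>x. x \<in> ext X \<Longrightarrow> ap (the_fn U F) x = F x" using f by simp_all
qed

lemma const_fn:
  assumes "c \<in> M"
  shows "func (the_fn U (\<lambda>_. c)) X" "\<And>x. x \<in> ext X \<Longrightarrow> ap (the_fn U (\<lambda>_. c)) x = c"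
  using the_fn_props[OF const_exists[OF assms]] by blast+

lemma id_fn: "func (the_fn U (\<lambda>x. x)) X" "\<And>x. x \<in> ext X \<Longrightarrow> ap (the_fn U (\<lambda>x. x)) x = x"
proof -
  have *: "\<exists>f. func f X \<and> (\<forall>x\<in>ext X. ap f x = x)"
    by (rule lambda_exists[OF X_M, where F = "\<lambda>x. x"]) (auto intro: definable_intros ext_M)
  show "func (the_fn U (\<lambda>x. x)) X" "\<And>x. x \<in> ext X \<Longrightarrow> ap (the_fn U (\<lambda>x. x)) x = x"
    using the_fn_props[OF *] by blast+
qed

lemma j_eq: "j U x = col (the_fn U (\<lambda>_. x))"
  unfolding j_def col_def ..

lemma seed_eq: "seed U = col (the_fn U (\<lambda>x. x))"
  unfolding seed_def col_def ..

lemma j_Ult: "x \<in> M \<Longrightarrow> j U x \<in> Ult U"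
  unfolding Ult_iff j_eq using const_fn(1) by blast

lemma seed_Ult: "seed U \<in> Ult U"
  unfolding Ult_iff seed_eq using id_fn(1) by blast

lemma col_mem_j_iff:
  assumes f: "func f X" and A: "A \<in> M"
  shows "col f \<epsilon> j U A \<longleftrightarrow> ae (\<lambda>x. ap f x \<in> ext A)"
  unfolding j_eq col_mem_iff[OF f const_fn(1)[OF A]] memU_def
  by (rule ae_cong) (simp add: const_fn(2)[OF A])

text \<open>In other words, \<open>U\<close> is the ultrafilter derived from its embedding at the
  seed. Applying a further embedding to both sides, its large sets can be recognised in iterated
  ultrapowers as well.\<close>

lemma seed_mem_j_iff:
  assumes A: "A \<in> M" shows "seed U \<epsilon> j U A \<longleftrightarrow> ae (\<lambda>x. x \<in> ext A)"
  unfolding seed_eq col_mem_j_iff[OF id_fn(1) A] by (rule ae_cong) (simp add: id_fn(2))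

lemma j_mem_iff:
  assumes "x \<in> M" "A \<in> M" shows "j U x \<epsilon> j U A \<longleftrightarrow> x \<in> ext A"
proof -
  have "j U x \<epsilon> j U A \<longleftrightarrow> ae (\<lambda>_. x \<in> ext A)"
    unfolding j_eq[of x] col_mem_j_iff[OF const_fn(1)[OF assms(1)] assms(2)]
    by (rule ae_cong) (simp add: const_fn(2)[OF assms(1)])
  also have "\<dots> \<longleftrightarrow> x \<in> ext A" using ae_all[of "\<lambda>_. x \<in> ext A"] ae_ex[of "\<lambda>_. x \<in> ext A"] by blast
  finally show ?thesis .
qed

section \<open>The ultrapower as a model of ZFC\<close>

lemma transfer1:
  assumes "udefinable E (\<lambda>M s. P M (s 0))" "\<And>a. a \<in> M \<Longrightarrow> P M a" "a \<in> Ult U"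
  shows "P (Ult U) a"
  using los_transfer[OF assms(1), of "\<lambda>_. a"] assms(2,3) by blast

lemma transfer2:
  assumes "udefinable E (\<lambda>M s. P M (s 0) (s 1))" "\<And>a b. a \<in> M \<Longrightarrow> b \<in> M \<Longrightarrow> P M a b"
    "a \<in> Ult U" "b \<in> Ult U"
  shows "P (Ult U) a b"
proof -
  define f where "f i = (if i = 0 then a else b)" for i :: nat
  have "P (Ult U) (f 0) (f 1)"
  proof (rule los_transfer[OF assms(1)])
    show "range f \<subseteq> Ult U" using assms(3,4) unfolding f_def by auto
  qed (use assms(2) in blast)
  then show ?thesis unfolding f_def by simp
qed

text \<open>Each axiom, and each instance of a schema for a fixed \<open>\<phi>\<close>, is written
  with quantifiers over the carrier only and then transferred by Los. The ultrafilters of a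
  comparison live in such ultrapowers, and this result makes the locale \<open>ultrafilter\<close>
  available for them.\<close>

theorem zfc_Ult: "zfc_model (Ult U) (\<epsilon>)"
proof unfold_locales
  let ?N = "Ult U" and ?ext = "mem_structure.ext (Ult U) (\<epsilon>)"
  have extN: "?ext a = {x \<in> ?N. x \<epsilon> a}" for a by (rule mem_structure.ext_def)
  have extM: "ext a = {x \<in> M. x \<epsilon> a}" for a by (rule ext_def)
  {
    fix a b assume ab: "a \<in> ?N" "b \<in> ?N" "?ext a = ?ext b"
    have "(\<forall>x\<in>?N. x \<epsilon> a \<longleftrightarrow> x \<epsilon> b) \<longrightarrow> a = b"
    proof (rule transfer2[where P = "\<lambda>M a b. (\<forall>x\<in>M. x \<epsilon> a \<longleftrightarrow> x \<epsilon> b) \<longrightarrow> a = b", OF _ _ ab(1,2)])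
      show "(\<forall>x\<in>M. x \<epsilon> a \<longleftrightarrow> x \<epsilon> b) \<longrightarrow> a = b" if "a \<in> M" "b \<in> M" for a b
        using extI[OF that] by (simp add: ext_iff)
    qed (intro udefinable_intros)
    then show "a = b" using ab(3) unfolding extN by blast
  next
    fix a assume a: "a \<in> ?N" "?ext a \<noteq> {}"
    have "(\<exists>x\<in>?N. x \<epsilon> a) \<longrightarrow> (\<exists>x\<in>?N. x \<epsilon> a \<and> \<not> (\<exists>y\<in>?N. y \<epsilon> x \<and> y \<epsilon> a))"
    proof (rule transfer1[where P = "\<lambda>M a. (\<exists>x\<in>M. x \<epsilon> a) \<longrightarrow>
        (\<exists>x\<in>M. x \<epsilon> a \<and> \<not> (\<exists>y\<in>M. y \<epsilon> x \<and> y \<epsilon> a))", OF _ _ a(1)])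
      show "(\<exists>x\<in>M. x \<epsilon> a) \<longrightarrow> (\<exists>x\<in>M. x \<epsilon> a \<and> \<not> (\<exists>y\<in>M. y \<epsilon> x \<and> y \<epsilon> a))" if "a \<in> M" for a
        using foundation[OF that] unfolding extM by blast
    qed (intro udefinable_intros)
    then show "\<exists>x\<in>?ext a. ?ext x \<inter> ?ext a = {}"
      using a(2) unfolding extN by blast
  next
    fix a b assume ab: "a \<in> ?N" "b \<in> ?N"
    have "\<exists>c\<in>?N. \<forall>x\<in>?N. x \<epsilon> c \<longleftrightarrow> x = a \<or> x = b"
    proof (rule transfer2[where P = "\<lambda>M a b. \<exists>c\<in>M. \<forall>x\<in>M. x \<epsilon> c \<longleftrightarrow> x = a \<or> x = b", OF _ _ ab])
      fix a b assume "a \<in> M" "b \<in> M"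
      then obtain c where "c \<in> M" "ext c = {a, b}" using pairing by blast
      then show "\<exists>c\<in>M. \<forall>x\<in>M. x \<epsilon> c \<longleftrightarrow> x = a \<or> x = b" using ext_iff by blast
    qed (intro udefinable_intros)
    then obtain c where "c \<in> ?N" "\<forall>x\<in>?N. x \<epsilon> c \<longleftrightarrow> x = a \<or> x = b" by blast
    then show "\<exists>c\<in>?N. ?ext c = {a, b}"
      using ab unfolding extN by (intro bexI[of _ c]) auto
  next
    fix a assume a: "a \<in> ?N"
    have "\<exists>c\<in>?N. \<forall>x\<in>?N. x \<epsilon> c \<longleftrightarrow> (\<exists>y\<in>?N. y \<epsilon> a \<and> x \<epsilon> y)"
    proof (rule transfer1[where P = "\<lambda>M a. \<exists>c\<in>M. \<forall>x\<in>M. x \<epsilon> c \<longleftrightarrow> (\<exists>y\<in>M. y \<epsilon> a \<and> x \<epsilon> y)", OF _ _ a])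
      fix a assume "a \<in> M"
      then obtain c where "c \<in> M" "ext c = (\<Union>x\<in>ext a. ext x)" using union by blast
      then show "\<exists>c\<in>M. \<forall>x\<in>M. x \<epsilon> c \<longleftrightarrow> (\<exists>y\<in>M. y \<epsilon> a \<and> x \<epsilon> y)"
        unfolding extM by (intro bexI[of _ c]) auto
    qed (intro udefinable_intros)
    then obtain c where "c \<in> ?N" "\<forall>x\<in>?N. x \<epsilon> c \<longleftrightarrow> (\<exists>y\<in>?N. y \<epsilon> a \<and> x \<epsilon> y)" by blast
    then show "\<exists>c\<in>?N. ?ext c =
        (\<Union>x\<in>?ext a. ?ext x)"
      unfolding extN by (intro bexI[of _ c]) auto
  next
    fix a assume a: "a \<in> ?N"
    have "\<exists>c\<in>?N. \<forall>x\<in>?N. x \<epsilon> c \<longleftrightarrow> (\<forall>y\<in>?N. y \<epsilon> x \<longrightarrow> y \<epsilon> a)"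
    proof (rule transfer1[where P = "\<lambda>M a. \<exists>c\<in>M. \<forall>x\<in>M. x \<epsilon> c \<longleftrightarrow> (\<forall>y\<in>M. y \<epsilon> x \<longrightarrow> y \<epsilon> a)", OF _ _ a])
      fix a assume "a \<in> M"
      then obtain c where "c \<in> M" "ext c = {x \<in> M. ext x \<subseteq> ext a}" using powerset by blast
      then show "\<exists>c\<in>M. \<forall>x\<in>M. x \<epsilon> c \<longleftrightarrow> (\<forall>y\<in>M. y \<epsilon> x \<longrightarrow> y \<epsilon> a)"
        unfolding extM by (intro bexI[of _ c]) auto
    qed (intro udefinable_intros)
    then obtain c where "c \<in> ?N" "\<forall>x\<in>?N. x \<epsilon> c \<longleftrightarrow> (\<forall>y\<in>?N. y \<epsilon> x \<longrightarrow> y \<epsilon> a)" by blast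
    then show "\<exists>c\<in>?N. ?ext c =
        {x \<in> ?N. ?ext x \<subseteq> ?ext a}"
      unfolding extN by (intro bexI[of _ c]) auto
  next
    let ?P = "\<lambda>M :: 'v set. \<exists>v\<in>M. (\<exists>z\<in>M. z \<epsilon> v \<and> (\<forall>x\<in>M. \<not> x \<epsilon> z)) \<and>
      (\<forall>x\<in>M. x \<epsilon> v \<longrightarrow> (\<exists>y\<in>M. y \<epsilon> v \<and> (\<forall>z\<in>M. z \<epsilon> y \<longleftrightarrow> z = x \<or> z \<epsilon> x)))"
    have "?P ?N"
    \<comment> \<open>Infinity has no parameter; the seed merely provides some element of the
      ultrapower to fill the argument.\<close>
    proof (rule transfer1[where P = "\<lambda>M _. ?P M", OF _ _ seed_Ult])
      obtain v where v: "inductive_set_in v" using infinity by blast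
      then obtain z where z: "z \<in> ext v" "ext z = {}" unfolding inductive_set_in_def by blast
      have vM: "v \<in> M" using v unfolding inductive_set_in_def by blast
      show "?P M"
      proof (rule bexI[OF _ vM], intro conjI ballI impI)
        show "\<exists>z\<in>M. z \<epsilon> v \<and> (\<forall>x\<in>M. \<not> x \<epsilon> z)" using z unfolding extM by blast
        fix x assume x: "x \<in> M" "x \<epsilon> v"
        then obtain y where "y \<in> ext v" "ext y = insert x (ext x)"
          using v ext_iff unfolding inductive_set_in_def by blast
        then show "\<exists>y\<in>M. y \<epsilon> v \<and> (\<forall>z\<in>M. z \<epsilon> y \<longleftrightarrow> z = x \<or> z \<epsilon> x)"
          unfolding extM by (intro bexI[of _ y]) auto
      qed
    qed (intro udefinable_intros)
    then obtain v where v: "v \<in> ?N" "\<exists>z\<in>?N. z \<epsilon> v \<and> (\<forall>x\<in>?N. \<not> x \<epsilon> z)"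
      "\<And>x. x \<in> ?N \<Longrightarrow> x \<epsilon> v \<Longrightarrow> \<exists>y\<in>?N. y \<epsilon> v \<and> (\<forall>z\<in>?N. z \<epsilon> y \<longleftrightarrow> z = x \<or> z \<epsilon> x)" by blast
    have "mem_structure.inductive_set_in ?N (\<epsilon>) v"
      unfolding mem_structure.inductive_set_in_def extN
    proof (intro conjI ballI)
      fix x assume "x \<in> {x \<in> ?N. x \<epsilon> v}"
      then have x: "x \<in> ?N" "x \<epsilon> v" by blast+
      then obtain y where "y \<in> ?N" "y \<epsilon> v" "\<forall>z\<in>?N. z \<epsilon> y \<longleftrightarrow> z = x \<or> z \<epsilon> x" using v(3) by blast
      then show "\<exists>y\<in>{x \<in> ?N. x \<epsilon> v}. {z \<in> ?N. z \<epsilon> y} = insert x {z \<in> ?N. z \<epsilon> x}"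
        using x(1) by (intro bexI[of _ y]) auto
    qed (use v(1,2) in blast)+
    then show "\<exists>v. mem_structure.inductive_set_in ?N (\<epsilon>) v" by blast
  next
    fix a and s :: "nat \<Rightarrow> 'v" and \<phi> assume a: "a \<in> ?N" and s: "range s \<subseteq> ?N"
    \<comment> \<open>Variable 0 holds the set \<open>a\<close>, the variables after it hold the
      parameters of \<open>\<phi>\<close>.\<close>
    let ?P = "\<lambda>M t. \<exists>c\<in>M. \<forall>x\<in>M. x \<epsilon> c \<longleftrightarrow>
      x \<epsilon> t 0 \<and> mem_structure.sat M (\<epsilon>) \<phi> (case_nat x (\<lambda>i. t (Suc i)))"
    have "?P ?N (case_nat a s)"
    proof (rule los_transfer[where P = ?P])
      fix t :: "nat \<Rightarrow> 'v" assume t: "range t \<subseteq> M"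
      then have "t 0 \<in> M" "range (\<lambda>i. t (Suc i)) \<subseteq> M" by blast+
      then obtain c where "c \<in> M" "ext c = {x \<in> ext (t 0). sat \<phi> (case_nat x (\<lambda>i. t (Suc i)))}"
        using separation by blast
      then show "?P M t" unfolding extM by (intro bexI[of _ c]) auto
    qed (use a s in \<open>simp_all add: range_case_nat, intro udefinable_intros\<close>)
    then obtain c where "c \<in> ?N" "\<forall>x\<in>?N. x \<epsilon> c \<longleftrightarrow> x \<epsilon> a \<and> mem_structure.sat ?N (\<epsilon>) \<phi> (case_nat x s)"
      by auto
    then show "\<exists>c\<in>?N. ?ext c =
        {x \<in> ?ext a. mem_structure.sat ?N (\<epsilon>) \<phi> (case_nat x s)}"
      unfolding extN by (intro bexI[of _ c]) auto
  next
    fix a and s :: "nat \<Rightarrow> 'v" and \<phi> assume a: "a \<in> ?N" and s: "range s \<subseteq> ?N"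
      and ex: "\<And>x. x \<in> ?ext a \<Longrightarrow>
        \<exists>!y. y \<in> ?N \<and> mem_structure.sat ?N (\<epsilon>) \<phi> (case_nat x (case_nat y s))"
    let ?S = "\<lambda>M t x y. mem_structure.sat M (\<epsilon>) \<phi> (case_nat x (case_nat y (\<lambda>i. t (Suc i))))"
    let ?P = "\<lambda>M t. (\<forall>x\<in>M. x \<epsilon> t 0 \<longrightarrow> (\<exists>y\<in>M. ?S M t x y \<and> (\<forall>z\<in>M. ?S M t x z \<longrightarrow> z = y))) \<longrightarrow>
      (\<exists>c\<in>M. \<forall>y\<in>M. y \<epsilon> c \<longleftrightarrow> (\<exists>x\<in>M. x \<epsilon> t 0 \<and> ?S M t x y))"
    have "?P ?N (case_nat a s)"
    proof (rule los_transfer[where P = ?P])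
      fix t :: "nat \<Rightarrow> 'v" assume t: "range t \<subseteq> M"
      then have t': "t 0 \<in> M" "range (\<lambda>i. t (Suc i)) \<subseteq> M" by blast+
      show "?P M t"
      proof
        assume *: "\<forall>x\<in>M. x \<epsilon> t 0 \<longrightarrow> (\<exists>y\<in>M. ?S M t x y \<and> (\<forall>z\<in>M. ?S M t x z \<longrightarrow> z = y))"
        have "\<exists>!y. y \<in> M \<and> ?S M t x y" if "x \<in> ext (t 0)" for x
          using * that unfolding extM by blast
        from replacement[OF t' this] obtain c
          where "c \<in> M" "ext c = {y \<in> M. \<exists>x\<in>ext (t 0). ?S M t x y}" by blast
        then show "\<exists>c\<in>M. \<forall>y\<in>M. y \<epsilon> c \<longleftrightarrow> (\<exists>x\<in>M. x \<epsilon> t 0 \<and> ?S M t x y)"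
          unfolding extM by (intro bexI[of _ c]) auto
      qed
    qed (use a s in \<open>simp_all add: range_case_nat, intro udefinable_intros\<close>)
    moreover have "\<forall>x\<in>?N. x \<epsilon> a \<longrightarrow> (\<exists>y\<in>?N. mem_structure.sat ?N (\<epsilon>) \<phi> (case_nat x (case_nat y s)) \<and>
        (\<forall>z\<in>?N. mem_structure.sat ?N (\<epsilon>) \<phi> (case_nat x (case_nat z s)) \<longrightarrow> z = y))"
    proof (intro ballI impI)
      fix x assume "x \<in> ?N" "x \<epsilon> a"
      then have "x \<in> ?ext a" unfolding extN by blast
      from ex[OF this] show "\<exists>y\<in>?N. mem_structure.sat ?N (\<epsilon>) \<phi> (case_nat x (case_nat y s)) \<and>
        (\<forall>z\<in>?N. mem_structure.sat ?N (\<epsilon>) \<phi> (case_nat x (case_nat z s)) \<longrightarrow> z = y)" by blast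
    qed
    ultimately obtain c where "c \<in> ?N"
      "\<forall>y\<in>?N. y \<epsilon> c \<longleftrightarrow> (\<exists>x\<in>?N. x \<epsilon> a \<and> mem_structure.sat ?N (\<epsilon>) \<phi> (case_nat x (case_nat y s)))"
      by auto
    then show "\<exists>c\<in>?N. ?ext c = {y \<in> ?N. \<exists>x\<in>?ext a.
        mem_structure.sat ?N (\<epsilon>) \<phi> (case_nat x (case_nat y s))}"
      unfolding extN by (intro bexI[of _ c]) auto
  next
    fix a assume a: "a \<in> ?N"
      and ne: "\<And>x. x \<in> ?ext a \<Longrightarrow> ?ext x \<noteq> {}"
      and disj: "\<And>x y. x \<in> ?ext a \<Longrightarrow> y \<in> ?ext a \<Longrightarrow> x \<noteq> y \<Longrightarrow>
        ?ext x \<inter> ?ext y = {}"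
    let ?Q = "\<lambda>M a. (\<forall>x\<in>M. x \<epsilon> a \<longrightarrow> (\<exists>y\<in>M. y \<epsilon> x)) \<and>
      (\<forall>x\<in>M. \<forall>y\<in>M. x \<epsilon> a \<and> y \<epsilon> a \<and> \<not> x = y \<longrightarrow> \<not> (\<exists>z\<in>M. z \<epsilon> x \<and> z \<epsilon> y))"
    let ?R = "\<lambda>M a. \<exists>c\<in>M. \<forall>x\<in>M. x \<epsilon> a \<longrightarrow>
      (\<exists>z\<in>M. z \<epsilon> x \<and> z \<epsilon> c \<and> (\<forall>y\<in>M. y \<epsilon> x \<and> y \<epsilon> c \<longrightarrow> y = z))"
    have "?Q ?N a \<longrightarrow> ?R ?N a"
    proof (rule transfer1[where P = "\<lambda>M a. ?Q M a \<longrightarrow> ?R M a", OF _ _ a])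
      show "?Q M a \<longrightarrow> ?R M a" if aM: "a \<in> M" for a
      proof
        assume Q: "?Q M a"
        have 1: "ext x \<noteq> {}" if "x \<in> ext a" for x using conjunct1[OF Q] that unfolding extM by blast
        have 2: "ext x \<inter> ext y = {}" if "x \<in> ext a" "y \<in> ext a" "x \<noteq> y" for x y
          using conjunct2[OF Q] that unfolding extM by blast
        obtain c where c: "c \<in> M" "\<forall>x\<in>ext a. \<exists>!z. z \<in> ext x \<inter> ext c"
          using choice[OF aM 1 2] by blast
        show "?R M a"
        proof (rule bexI[OF _ c(1)], intro ballI impI)
          fix x assume "x \<in> M" "x \<epsilon> a"
          then have "\<exists>!z. z \<in> ext x \<inter> ext c" using c(2) ext_iff by blast
          then show "\<exists>z\<in>M. z \<epsilon> x \<and> z \<epsilon> c \<and> (\<forall>y\<in>M. y \<epsilon> x \<and> y \<epsilon> c \<longrightarrow> y = z)"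
            unfolding extM by blast
        qed
      qed
    qed (intro udefinable_intros)
    moreover have "?Q ?N a"
    proof (intro conjI ballI impI)
      show "\<exists>y\<in>?N. y \<epsilon> x" if "x \<in> ?N" "x \<epsilon> a" for x using ne[of x] that unfolding extN by blast
      show "\<not> (\<exists>z\<in>?N. z \<epsilon> x \<and> z \<epsilon> y)" if "x \<in> ?N" "y \<in> ?N" "x \<epsilon> a \<and> y \<epsilon> a \<and> \<not> x = y" for x y
        using disj[of x y] that unfolding extN by blast
    qed
    ultimately obtain c where c: "c \<in> ?N" "\<And>x. x \<in> ?N \<Longrightarrow> x \<epsilon> a \<Longrightarrow>
      \<exists>z\<in>?N. z \<epsilon> x \<and> z \<epsilon> c \<and> (\<forall>y\<in>?N. y \<epsilon> x \<and> y \<epsilon> c \<longrightarrow> y = z)" by blast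
    show "\<exists>c\<in>?N. \<forall>x\<in>?ext a.
        \<exists>!z. z \<in> ?ext x \<inter> ?ext c"
    proof (intro bexI[of _ c] ballI c(1))
      fix x assume "x \<in> ?ext a"
      then have "x \<in> ?N" "x \<epsilon> a" unfolding extN by blast+
      from c(2)[OF this] obtain z where z: "z \<in> ?N" "z \<epsilon> x" "z \<epsilon> c"
        "\<forall>y\<in>?N. y \<epsilon> x \<and> y \<epsilon> c \<longrightarrow> y = z" by (elim bexE conjE)
      show "\<exists>!z. z \<in> ?ext x \<inter> ?ext c"
      proof (rule ex1I[of _ z])
        show "z \<in> ?ext x \<inter> ?ext c"
          using z(1-3) unfolding extN by simp
        show "y = z" if "y \<in> ?ext x \<inter> ?ext c" for y
        proof -
          have "y \<in> ?N" "y \<epsilon> x \<and> y \<epsilon> c" using that unfolding extN by simp_all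
          then show ?thesis using z(4) by simp
        qed
      qed
    qed
  }
qed

end

context zfc_model
begin

subsection \<open>Ordinals and the order on finite sets of ordinals\<close>

lemma def_finset_less [definable_intros]:
  "definable_fun F \<Longrightarrow> definable_fun G \<Longrightarrow> definable (\<lambda>s. finset_less (F s) (G s))"
  by (rule def_inst2[where P = finset_less]) (unfold finset_less_iff, intro definable_intros)

lemma def_ordinal [definable_intros]: "definable_fun F \<Longrightarrow> definable (\<lambda>s. ordinal (F s))"
  by (rule def_inst1[where P = ordinal]) (unfold ordinal_def, intro definable_intros)

lemma ordinal_M: "ordinal a \<Longrightarrow> a \<in> M"
  unfolding ordinal_def by blast

lemma ordinal_trans: "ordinal a \<Longrightarrow> x \<in> ext a \<Longrightarrow> y \<in> ext x \<Longrightarrow> y \<in> ext a"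
  unfolding ordinal_def using transitive_setD by blast

lemma ordinal_mem: assumes a: "ordinal a" and x: "x \<in> ext a" shows "ordinal x"
  unfolding ordinal_def
proof (intro conjI ballI)
  show "transitive_set x" using a x unfolding ordinal_def by blast
  show "transitive_set y" if "y \<in> ext x" for y
    using ordinal_trans[OF a x that] a unfolding ordinal_def by blast
qed (rule ext_M[OF x])

text \<open>Nested membership induction. If \<open>a\<close> and \<open>b\<close> were incomparable,
  every element of \<open>a\<close> would still be comparable with \<open>b\<close> and, by
  transitivity, could only lie in \<open>b\<close>; likewise for the elements of \<open>b\<close>,
  and extensionality gives \<open>a = b\<close>.\<close>

lemma ordinal_linear:
  assumes a: "ordinal a" and b: "ordinal b" shows "a = b \<or> a \<in> ext b \<or> b \<in> ext a"
proof -
  let ?L = "\<lambda>a b. ordinal b \<longrightarrow> a = b \<or> a \<in> ext b \<or> b \<in> ext a"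
  have "ordinal a \<longrightarrow> (\<forall>b\<in>M. ?L a b)"
  proof (rule mem_induct[of "\<lambda>a. ordinal a \<longrightarrow> (\<forall>b\<in>M. ?L a b)", OF _ ordinal_M[OF a]])
    show "definable (\<lambda>s. ordinal (s 0) \<longrightarrow> (\<forall>b\<in>M. ?L (s 0) b))" by (intro definable_intros)
    fix a assume aM: "a \<in> M" and IH: "\<And>x. x \<in> ext a \<Longrightarrow> ordinal x \<longrightarrow> (\<forall>b\<in>M. ?L x b)"
    show "ordinal a \<longrightarrow> (\<forall>b\<in>M. ?L a b)"
    proof (intro impI ballI)
      fix b assume a: "ordinal a" and bM: "b \<in> M" and b: "ordinal b"
      have "?L a b"
      proof (rule mem_induct[of "\<lambda>b. ?L a b", OF _ bM])
        show "definable (\<lambda>s. ?L a (s 0))" by (intro definable_intros aM)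
        fix b assume bM: "b \<in> M" and IH': "\<And>y. y \<in> ext b \<Longrightarrow> ?L a y"
        show "?L a b"
        proof (intro impI, rule ccontr)
          assume b: "ordinal b" and *: "\<not> (a = b \<or> a \<in> ext b \<or> b \<in> ext a)"
          have "x \<in> ext b" if x: "x \<in> ext a" for x
          proof -
            have "x = b \<or> x \<in> ext b \<or> b \<in> ext x" using IH[OF x] ordinal_mem[OF a x] bM b by blast
            then show ?thesis using * x ordinal_trans[OF a x] by blast
          qed
          moreover have "y \<in> ext a" if y: "y \<in> ext b" for y
          proof -
            have "a = y \<or> a \<in> ext y \<or> y \<in> ext a" using IH'[OF y] ordinal_mem[OF b y] by blast
            then show ?thesis using * y ordinal_trans[OF b y] by blast
          qed
          ultimately have "a = b" using extI[OF aM bM] by blast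
          then show False using * by blast
        qed
      qed
      then show "a = b \<or> a \<in> ext b \<or> b \<in> ext a" using b by blast
    qed
  qed
  then show ?thesis using a b ordinal_M by blast
qed

text \<open>Finiteness is only used in the form that all nonempty subsets have a largest element.\<close>

definition finset :: "'v \<Rightarrow> bool" where
  "finset a \<longleftrightarrow> (\<forall>x\<in>ext a. ordinal x) \<and>
     (\<forall>c\<in>M. ext c \<subseteq> ext a \<longrightarrow> ext c \<noteq> {} \<longrightarrow> (\<exists>m\<in>ext c. \<forall>y\<in>ext c. y = m \<or> y \<in> ext m))"

lemma def_finset [definable_intros]: "definable_fun F \<Longrightarrow> definable (\<lambda>s. finset (F s))"
  by (rule def_inst1[where P = finset]) (unfold finset_def, intro definable_intros)

lemma finset_subset: "finset a \<Longrightarrow> ext b \<subseteq> ext a \<Longrightarrow> finset b"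
  unfolding finset_def by blast

text \<open>Induction on \<open>n\<close> inside the model, removing the last value of
  \<open>b\<close> from \<open>c\<close>. The set \<open>c\<close> is only required to be covered by
  values of \<open>b\<close>, a condition that survives the removal.\<close>

lemma image_of_natural_max:
  assumes w: "omega w" and n: "n \<in> ext w" and b: "b \<in> M" and c: "c \<in> M"
    "\<forall>x\<in>ext c. ordinal x" "\<forall>x\<in>ext c. \<exists>i\<in>ext n. ap b i = x" "ext c \<noteq> {}"
  shows "\<exists>m\<in>ext c. \<forall>y\<in>ext c. y = m \<or> y \<in> ext m"
proof -
  let ?max = "\<lambda>c. \<exists>m\<in>ext c. \<forall>y\<in>ext c. y = m \<or> y \<in> ext m"
  let ?Q = "\<lambda>n. \<forall>c\<in>M. (\<forall>x\<in>ext c. ordinal x) \<longrightarrow> (\<forall>x\<in>ext c. \<exists>i\<in>ext n. ap b i = x) \<longrightarrow>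
    \<not> ext c = {} \<longrightarrow> ?max c"
  have "?Q n"
  proof (rule omega_induct[OF w n])
    show "definable (\<lambda>s. ?Q (s 0))" by (intro definable_intros b)
    show "?Q z" if "ext z = {}" for z using that by blast
    fix x y assume y: "ext y = insert x (ext x)" and IH: "?Q x"
    show "?Q y"
    proof (intro ballI impI)
      fix c assume c: "c \<in> M" "\<forall>z\<in>ext c. ordinal z" "\<forall>z\<in>ext c. \<exists>i\<in>ext y. ap b i = z" "\<not> ext c = {}"
      have bM: "ap b x \<in> M" using b by simp
      have S: "is_set {z \<in> ext c. \<not> z = ap b x}" by (rule is_set_sep[OF c(1)]) (intro definable_intros bM)
      define d where "d = mk {z \<in> ext c. \<not> z = ap b x}"
      have d: "d \<in> M" "ext d = {z \<in> ext c. \<not> z = ap b x}" unfolding d_def using S by simp_all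
      show "?max c"
      proof (cases "ext d = {}")
        case True
        then have "ext c = {ap b x}" using d(2) c(4) by blast
        then show ?thesis by blast
      next
        case False
        have "\<exists>i\<in>ext x. ap b i = z" if z: "z \<in> ext d" for z
        proof -
          have "z \<in> ext c" "z \<noteq> ap b x" using z d(2) by simp_all
          then obtain i where i: "i \<in> ext y" "ap b i = z" using c(3) by blast
          then have "i \<noteq> x" using \<open>z \<noteq> ap b x\<close> by metis
          then show ?thesis using i y by auto
        qed
        then have "\<forall>z\<in>ext d. \<exists>i\<in>ext x. ap b i = z" by blast
        then have "?max d" using IH d c(2) False by blast
        then obtain m where m: "m \<in> ext d" "\<And>z. z \<in> ext d \<Longrightarrow> z = m \<or> z \<in> ext m" by blast
        have mc: "m \<in> ext c" using m(1) d(2) by blast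
        show ?thesis
        proof (cases "ap b x \<in> ext c \<and> m \<in> ext (ap b x)")
          case True
          then have o: "ordinal (ap b x)" using c(2) by blast
          have "z = ap b x \<or> z \<in> ext (ap b x)" if "z \<in> ext c" for z
          proof (cases "z = ap b x")
            case False
            then have "z = m \<or> z \<in> ext m" using m(2) d(2) that by blast
            then show ?thesis using True ordinal_trans[OF o] by blast
          qed simp
          then show ?thesis using True by blast
        next
          case F: False
          have "z = m \<or> z \<in> ext m" if z: "z \<in> ext c" for z
          proof (cases "z = ap b x")
            case True
            then have "m \<notin> ext z" using F z by blast
            then show ?thesis using ordinal_linear[of z m] c(2) z mc by blast
          next
            case False
            then show ?thesis using m(2) d(2) z by blast
          qed
          then show ?thesis using mc by blast
        qed
      qed
    qed
  qed
  then show ?thesis using c by blast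
qed

lemma finset_subsets_of_size:
  assumes w: "omega w" and n: "n \<in> ext w" and \<kappa>: "ordinal \<kappa>" and a: "a \<in> subsets_of_size \<kappa> n"
  shows "finset a"
proof -
  obtain b where b: "func b n" "bij_betw (app b) (ext n) (ext a)" and sub: "ext a \<subseteq> ext \<kappa>"
    using a unfolding subsets_of_size_def by blast
  have surj: "\<exists>i\<in>ext n. ap b i = x" if "x \<in> ext a" for x
  proof -
    have "x \<in> app b ` ext n" using that bij_betw_imp_surj_on[OF b(2)] by simp
    then obtain i where "x = app b i" "i \<in> ext n" by (rule imageE)
    then show ?thesis using func_ap[OF b(1)] by (intro bexI[of _ i]) simp_all
  qed
  have o: "ordinal x" if "x \<in> ext a" for x using that sub ordinal_mem[OF \<kappa>] by blast
  show ?thesis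
    unfolding finset_def
  proof (intro conjI ballI impI o)
    fix c assume c: "c \<in> M" "ext c \<subseteq> ext a" "ext c \<noteq> {}"
    show "\<exists>m\<in>ext c. \<forall>y\<in>ext c. y = m \<or> y \<in> ext m"
      by (rule image_of_natural_max[OF w n func_M[OF b(1)] c(1) _ _ c(3)]) (use c(2) o surj in blast)+
  qed
qed

lemma finset_lessE:
  assumes "finset_less a b"
  obtains x where "x \<in> ext b" "x \<notin> ext a"
    "\<And>y. y \<in> ext a \<Longrightarrow> y \<notin> ext b \<Longrightarrow> y = x \<or> y \<in> ext x"
    "\<And>y. y \<in> ext b \<Longrightarrow> y \<notin> ext a \<Longrightarrow> y = x \<or> y \<in> ext x"
proof -
  obtain x where x: "x \<in> ext b - ext a"
    "\<forall>y\<in>(ext a - ext b) \<union> (ext b - ext a). y = x \<or> y \<epsilon> x" using assms unfolding finset_less_def by blast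
  have "y = x \<or> y \<in> ext x" if "y \<in> (ext a - ext b) \<union> (ext b - ext a)" for y
  proof -
    have "y \<in> M" using that ext_M by blast
    then show ?thesis using x(2) that ext_iff by blast
  qed
  then show ?thesis using that x(1) by blast
qed

lemma finset_lessI:
  assumes "x \<in> ext b" "x \<notin> ext a"
    "\<And>y. y \<in> ext a \<Longrightarrow> y \<notin> ext b \<Longrightarrow> y = x \<or> y \<in> ext x"
    "\<And>y. y \<in> ext b \<Longrightarrow> y \<notin> ext a \<Longrightarrow> y = x \<or> y \<in> ext x"
  shows "finset_less a b"
proof -
  have "y = x \<or> y \<epsilon> x" if "y \<in> (ext a - ext b) \<union> (ext b - ext a)" for y
  proof -
    have "y \<in> M" "y = x \<or> y \<in> ext x" using that ext_M assms(3,4) by blast+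
    then show ?thesis using ext_iff by blast
  qed
  then show ?thesis unfolding finset_less_def using assms(1,2) by blast
qed

text \<open>Let \<open>x\<close> decide between \<open>a\<close> and \<open>b\<close>, and
  \<open>y\<close> between \<open>b\<close> and \<open>c\<close>. Above the larger of the two all
  three sets agree, so it decides between \<open>a\<close> and \<open>c\<close>.\<close>

lemma finset_less_trans:
  assumes fin: "finset a" "finset b" "finset c" and ab: "finset_less a b" and bc: "finset_less b c"
  shows "finset_less a c"
proof -
  obtain x where x: "x \<in> ext b" "x \<notin> ext a"
    "\<And>z. z \<in> ext a \<Longrightarrow> z \<notin> ext b \<Longrightarrow> z = x \<or> z \<in> ext x"
    "\<And>z. z \<in> ext b \<Longrightarrow> z \<notin> ext a \<Longrightarrow> z = x \<or> z \<in> ext x" using finset_lessE[OF ab] by blast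
  obtain y where y: "y \<in> ext c" "y \<notin> ext b"
    "\<And>z. z \<in> ext b \<Longrightarrow> z \<notin> ext c \<Longrightarrow> z = y \<or> z \<in> ext y"
    "\<And>z. z \<in> ext c \<Longrightarrow> z \<notin> ext b \<Longrightarrow> z = y \<or> z \<in> ext y" using finset_lessE[OF bc] by blast
  have o: "ordinal x" "ordinal y" using fin(2,3) x(1) y(1) unfolding finset_def by blast+
  have "x \<noteq> y" using x(1) y(2) by blast
  then consider "x \<in> ext y" | "y \<in> ext x" using ordinal_linear[OF o] by blast
  then show ?thesis
  proof cases
    case 1
    have *: "z = x \<or> z \<in> ext x \<Longrightarrow> z \<in> ext y" for z using 1 ordinal_trans[OF o(2) 1] by blast
    have ya: "y \<notin> ext a"
    proof
      assume "y \<in> ext a"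
      then have "y \<in> ext y" using * x(3) y(2) by blast
      then show False using mem_irrefl by blast
    qed
    show ?thesis
    proof (rule finset_lessI[OF y(1) ya])
      show "z = y \<or> z \<in> ext y" if "z \<in> ext a" "z \<notin> ext c" for z
        using that x(3) y(3) * by blast
      show "z = y \<or> z \<in> ext y" if "z \<in> ext c" "z \<notin> ext a" for z
        using that x(4) y(4) * by blast
    qed
  next
    case 2
    have *: "z = y \<or> z \<in> ext y \<Longrightarrow> z \<in> ext x" for z using 2 ordinal_trans[OF o(1) 2] by blast
    have xc: "x \<in> ext c"
    proof (rule ccontr)
      assume "x \<notin> ext c"
      then have "x \<in> ext x" using * y(3) x(1) by blast
      then show False using mem_irrefl by blast
    qed
    show ?thesis
    proof (rule finset_lessI[OF xc x(2)])
      show "z = x \<or> z \<in> ext x" if "z \<in> ext a" "z \<notin> ext c" for z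
        using that x(3) y(3) * by blast
      show "z = x \<or> z \<in> ext x" if "z \<in> ext c" "z \<notin> ext a" for z
        using that x(4) y(4) * by blast
    qed
  qed
qed

text \<open>Induction on the bound \<open>\<delta>\<close>: a minimal element is found among the sets whose maximum \<open>\<mu>\<close> is least,
  by removing \<open>\<mu>\<close> from them.\<close>

lemma finset_less_wf:
  assumes \<delta>: "ordinal \<delta>" and B: "B \<in> M" "ext B \<noteq> {}" "\<And>a. a \<in> ext B \<Longrightarrow> finset a \<and> ext a \<subseteq> ext \<delta>"
  shows "\<exists>a\<in>ext B. \<forall>c\<in>ext B. \<not> finset_less c a"
proof -
  let ?Q = "\<lambda>\<delta>. ordinal \<delta> \<longrightarrow> (\<forall>B\<in>M. \<not> ext B = {} \<longrightarrow> (\<forall>a\<in>ext B. finset a \<and> ext a \<subseteq> ext \<delta>) \<longrightarrow>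
    (\<exists>a\<in>ext B. \<forall>c\<in>ext B. \<not> finset_less c a))"
  have "?Q \<delta>"
  proof (rule mem_induct[of ?Q, OF _ ordinal_M[OF \<delta>]])
    show "definable (\<lambda>s. ?Q (s 0))" by (intro definable_intros)
    fix \<delta> assume \<delta>M: "\<delta> \<in> M" and IH: "\<And>\<gamma>. \<gamma> \<in> ext \<delta> \<Longrightarrow> ?Q \<gamma>"
    show "?Q \<delta>"
    proof (intro impI ballI)
      fix B assume \<delta>: "ordinal \<delta>" and BM: "B \<in> M" and ne: "\<not> ext B = {}"
        and B: "\<forall>a\<in>ext B. finset a \<and> ext a \<subseteq> ext \<delta>"
      show "\<exists>a\<in>ext B. \<forall>c\<in>ext B. \<not> finset_less c a"
      proof (cases "\<exists>a\<in>ext B. ext a = {}")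
        case True
        then obtain a where "a \<in> ext B" "ext a = {}" by blast
        then show ?thesis unfolding finset_less_def by blast
      next
        case nonempty: False
        define mx where "mx a m \<longleftrightarrow> m \<in> ext a \<and> (\<forall>y\<in>ext a. y = m \<or> y \<in> ext m)" for a m
        have def_mx: "definable (\<lambda>s. mx (F s) (G s))" if "definable_fun F" "definable_fun G" for F G
          by (rule def_inst2[OF _ that]) (unfold mx_def, intro definable_intros)
        have mx_ex: "\<exists>m. mx a m" if a: "a \<in> ext B" for a
        proof -
          have "ext a \<noteq> {}" "a \<in> M" using nonempty a ext_M by blast+
          then show ?thesis using B a unfolding finset_def mx_def by blast
        qed
        define S where "S = {m \<in> ext \<delta>. \<exists>a\<in>ext B. mx a m}"
        have S: "is_set S" unfolding S_def by (rule is_set_sep[OF \<delta>M]) (intro definable_intros def_mx BM)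
        have "S \<noteq> {}"
        proof -
          obtain a where a: "a \<in> ext B" using ne by blast
          obtain m where m: "mx a m" using mx_ex[OF a] by blast
          have "m \<in> ext \<delta>" using m B a unfolding mx_def by blast
          then show ?thesis unfolding S_def using a m by blast
        qed
        then obtain \<mu> where \<mu>: "\<mu> \<in> S" "\<And>y. y \<in> ext \<mu> \<Longrightarrow> y \<notin> S" using minimal_element[OF S] by blast
        have \<mu>\<delta>: "\<mu> \<in> ext \<delta>" using \<mu>(1) unfolding S_def by blast
        have \<mu>M: "\<mu> \<in> M" and \<mu>o: "ordinal \<mu>" using \<mu>\<delta> ext_M ordinal_mem[OF \<delta>] by blast+
        \<comment> \<open>\<open>r a d\<close> says that \<open>d\<close> arises from
          \<open>a\<close> by deleting its maximum \<open>\<mu>\<close>. What remains is bounded by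
          \<open>\<mu> \<in> \<delta>\<close>, so the induction hypothesis applies to the sets
          \<open>d\<close>.\<close>
        define r where "r a d \<longleftrightarrow> mx a \<mu> \<and> (\<forall>y\<in>M. y \<in> ext d \<longleftrightarrow> y \<in> ext a \<and> \<not> y = \<mu>)" for a d
        have def_r: "definable (\<lambda>s. r (F s) (G s))" if "definable_fun F" "definable_fun G" for F G
          by (rule def_inst2[OF _ that]) (unfold r_def, intro definable_intros def_mx \<mu>M)
        have ext_r: "ext d = ext a - {\<mu>}" if "r a d" for a d
          using that ext_M unfolding r_def by blast
        have P: "is_set {x \<in> M. ext x \<subseteq> ext \<delta>}" by (rule is_set_pow[OF \<delta>M])
        define B' where "B' = {d \<in> ext (mk {x \<in> M. ext x \<subseteq> ext \<delta>}). \<exists>a\<in>ext B. r a d}"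
        have B': "is_set B'" unfolding B'_def by (rule is_set_sep[OF mk_M[OF P]]) (intro definable_intros def_r BM)
        have in_B': "\<exists>d\<in>B'. ext d = ext a - {\<mu>}" if a: "a \<in> ext B" "mx a \<mu>" for a
        proof -
          have D: "is_set {y \<in> ext a. \<not> y = \<mu>}" by (rule is_set_sep[OF ext_M[OF a(1)]]) (intro definable_intros \<mu>M)
          have e: "ext (mk {y \<in> ext a. \<not> y = \<mu>}) = ext a - {\<mu>}" unfolding ext_mk[OF D] by blast
          have "r a (mk {y \<in> ext a. \<not> y = \<mu>})" unfolding r_def e using a(2) by simp
          moreover have "mk {y \<in> ext a. \<not> y = \<mu>} \<in> ext (mk {x \<in> M. ext x \<subseteq> ext \<delta>})"
            unfolding ext_mk[OF P] mem_Collect_eq e using mk_M[OF D] B a(1) by blast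
          ultimately show ?thesis unfolding B'_def using a(1) e by blast
        qed
        have "\<exists>d\<in>ext (mk B'). \<forall>c\<in>ext (mk B'). \<not> finset_less c d"
        proof -
          have "?Q \<mu>" using IH[OF \<mu>\<delta>] .
          moreover have "\<not> ext (mk B') = {}"
            unfolding ext_mk[OF B'] using in_B' \<mu>(1) unfolding S_def by blast
          moreover have "\<forall>d\<in>ext (mk B'). finset d \<and> ext d \<subseteq> ext \<mu>"
            unfolding ext_mk[OF B']
          proof
            fix d assume "d \<in> B'"
            then obtain a where a: "a \<in> ext B" "r a d" unfolding B'_def by blast
            have "ext d \<subseteq> ext \<mu>" using a(2) ext_r[OF a(2)] unfolding r_def mx_def by blast
            moreover have "finset d" using finset_subset[of a d] ext_r[OF a(2)] B a(1) by blast
            ultimately show "finset d \<and> ext d \<subseteq> ext \<mu>" by blast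
          qed
          ultimately show ?thesis using \<mu>o mk_M[OF B'] by blast
        qed
        then obtain d where d: "d \<in> B'" "\<And>c. c \<in> B' \<Longrightarrow> \<not> finset_less c d" unfolding ext_mk[OF B'] by blast
        obtain a where a: "a \<in> ext B" "r a d" using d(1) unfolding B'_def by blast
        have mxa: "mx a \<mu>" using a(2) unfolding r_def by blast
        have "\<not> finset_less c a" if c: "c \<in> ext B" for c
        proof
          assume "finset_less c a"
          then obtain x where x: "x \<in> ext a" "x \<notin> ext c"
            "\<And>y. y \<in> ext c \<Longrightarrow> y \<notin> ext a \<Longrightarrow> y = x \<or> y \<in> ext x"
            "\<And>y. y \<in> ext a \<Longrightarrow> y \<notin> ext c \<Longrightarrow> y = x \<or> y \<in> ext x" using finset_lessE by blast
          obtain m where m: "mx c m" using mx_ex[OF c] by blast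
          have mS: "m \<in> S" unfolding S_def using c m B unfolding mx_def by blast
          have "ordinal m" using mS ordinal_mem[OF \<delta>] unfolding S_def by blast
          then have "m = \<mu> \<or> \<mu> \<in> ext m" using \<mu>(2) mS ordinal_linear[OF \<mu>o] by blast
          \<comment> \<open>A maximum \<open>m\<close> of \<open>c\<close> above
            \<open>\<mu>\<close> would lie outside \<open>a\<close>. The element \<open>x\<close> of
            \<open>a\<close> that places \<open>c\<close> below \<open>a\<close> would then have to
            be at least \<open>m\<close>, although it is at most \<open>\<mu>\<close>.\<close>
          moreover have False if mm: "\<mu> \<in> ext m"
          proof -
            have "m \<notin> ext a"
            proof
              assume "m \<in> ext a"
              then have "m = \<mu> \<or> m \<in> ext \<mu>" using mxa unfolding mx_def by blast
              then show False using mm mem_irrefl mem_asym by blast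
            qed
            then have "m = x \<or> m \<in> ext x" using x(3) m unfolding mx_def by blast
            moreover have "x = \<mu> \<or> x \<in> ext \<mu>" using mxa x(1) unfolding mx_def by blast
            ultimately have "m = \<mu> \<or> m \<in> ext \<mu>" using ordinal_trans[OF \<mu>o] by blast
            then show False using mm mem_irrefl mem_asym by blast
          qed
          ultimately have "m = \<mu>" by blast
          then have mxc: "mx c \<mu>" using m by simp
          obtain e where e: "e \<in> B'" "ext e = ext c - {\<mu>}" using in_B'[OF c mxc] by blast
          have x\<mu>: "x \<noteq> \<mu>" using x(2) mxc unfolding mx_def by blast
          \<comment> \<open>Deleting the common maximum \<open>\<mu>\<close> from \<open>c\<close>
            and \<open>a\<close> does not affect their symmetric difference, so \<open>e\<close>
            contradicts the minimality of \<open>d\<close>.\<close>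
          have "finset_less e d"
          proof (rule finset_lessI)
            show "x \<in> ext d" using x(1) x\<mu> ext_r[OF a(2)] by blast
            show "x \<notin> ext e" using x(2) e(2) by blast
            show "y = x \<or> y \<in> ext x" if "y \<in> ext e" "y \<notin> ext d" for y
              using that x(3) e(2) ext_r[OF a(2)] by blast
            show "y = x \<or> y \<in> ext x" if "y \<in> ext d" "y \<notin> ext e" for y
              using that x(4) e(2) ext_r[OF a(2)] by blast
          qed
          then show False using d(2)[OF e(1)] by blast
        qed
        then show ?thesis using a(1) by blast
      qed
    qed
  qed
  then show ?thesis using \<delta> B by blast
qed

text \<open>Well-founded recursion for characteristic functions. It is phrased with a set
  \<open>S\<close> so that \<open>\<Gamma>\<close> may be an arbitrary condition on
  \<open>S\<close>, as long as only the part of \<open>S\<close> below \<open>x\<close>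
  matters.\<close>

lemma subset_recursion:
  assumes X: "X \<in> M" and R: "definable (\<lambda>s. R (s 0) (s 1))"
    and wf: "\<And>B. B \<in> M \<Longrightarrow> ext B \<subseteq> ext X \<Longrightarrow> ext B \<noteq> {} \<Longrightarrow> \<exists>x\<in>ext B. \<forall>y\<in>ext B. \<not> R y x"
    and \<Gamma>: "definable (\<lambda>s. \<Gamma> (s 0) (s 1))"
    and local: "\<And>x A B. x \<in> ext X \<Longrightarrow> A \<in> M \<Longrightarrow> B \<in> M \<Longrightarrow> ext A \<subseteq> ext X \<Longrightarrow> ext B \<subseteq> ext X \<Longrightarrow>
      (\<And>y. y \<in> ext X \<Longrightarrow> R y x \<Longrightarrow> y \<in> ext A \<longleftrightarrow> y \<in> ext B) \<Longrightarrow> \<Gamma> x A = \<Gamma> x B"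
  shows "\<exists>S\<in>M. ext S \<subseteq> ext X \<and> (\<forall>x\<in>ext X. x \<in> ext S \<longleftrightarrow> \<Gamma> x S)"
proof -
  have \<Gamma>': "definable (\<lambda>s. \<Gamma> (F s) (G s))" if "definable_fun F" "definable_fun G" for F G
    by (rule def_inst2[OF \<Gamma> that])
  \<comment> \<open>\<open>t\<close> and \<open>X\<close> serve as the values true and false; they
    are distinct because no set is an element of itself.\<close>
  define t where "t = mk {X}"
  have t: "t \<in> M" "t \<noteq> X"
  proof -
    have "ext t = {X}" "t \<in> M" unfolding t_def using X by simp_all
    then show "t \<in> M" "t \<noteq> X" using mem_irrefl[of X] by auto
  qed
  define S where "S p = mk {y \<in> ext X. ap p y = t}" for p
  have S: "is_set {y \<in> ext X. ap p y = t}" if "p \<in> M" for p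
    by (rule is_set_sep[OF X]) (intro definable_intros that t(1))
  have SM: "S p \<in> M" "ext (S p) = {y \<in> ext X. ap p y = t}" if "p \<in> M" for p
    unfolding S_def using S[OF that] by simp_all
  define H where "H x p = (if \<Gamma> x (S p) then t else X)" for x p
  have "\<exists>p. func p X \<and> (\<forall>x\<in>ext X. ap p x = H x p)"
  proof (rule wf_recursion[OF X R wf])
    show "definable_fun (\<lambda>s. H (s 0) (s 1))"
    proof (rule definable_funI[where Q = "\<lambda>s v. \<exists>A\<in>M. (\<forall>y\<in>M. y \<in> ext A \<longleftrightarrow> y \<in> ext X \<and> ap (s 1) y = t) \<and>
          (if \<Gamma> (s 0) A then v = t else v = X)"])
      fix s :: "nat \<Rightarrow> 'v" and v assume "range s \<subseteq> M"
      then have s: "s 1 \<in> M" by blast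
      show "H (s 0) (s 1) \<in> M" unfolding H_def using t(1) X by simp
      have "A = S (s 1) \<longleftrightarrow> (\<forall>y\<in>M. y \<in> ext A \<longleftrightarrow> y \<in> ext X \<and> ap (s 1) y = t)" if "A \<in> M" for A
        unfolding S_def eq_mk_iff[OF S[OF s] that] by blast
      then have "(\<exists>A\<in>M. (\<forall>y\<in>M. y \<in> ext A \<longleftrightarrow> y \<in> ext X \<and> ap (s 1) y = t) \<and>
          (if \<Gamma> (s 0) A then v = t else v = X)) \<longleftrightarrow>
          (\<exists>A\<in>M. A = S (s 1) \<and> (if \<Gamma> (s 0) A then v = t else v = X))"
        by (intro bex_cong refl) simp
      also have "\<dots> \<longleftrightarrow> v = H (s 0) (s 1)" unfolding H_def using SM(1)[OF s] by auto
      finally show "(v = H (s 0) (s 1)) = (\<exists>A\<in>M. (\<forall>y\<in>M. y \<in> ext A \<longleftrightarrow> y \<in> ext X \<and> ap (s 1) y = t) \<and>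
          (if \<Gamma> (s 0) A then v = t else v = X))" by simp
    qed (intro definable_intros \<Gamma>' X t(1))
    show "H x p = H x q" if "x \<in> ext X" "p \<in> M" "q \<in> M"
      "\<And>y. y \<in> ext X \<Longrightarrow> R y x \<Longrightarrow> ap p y = ap q y" for x p q
    proof -
      have "\<Gamma> x (S p) = \<Gamma> x (S q)"
        by (rule local[OF that(1) SM(1)[OF that(2)] SM(1)[OF that(3)]])
           (use that SM(2) in auto)
      then show ?thesis unfolding H_def by simp
    qed
  qed
  then obtain p where p: "func p X" "\<And>x. x \<in> ext X \<Longrightarrow> ap p x = H x p" by blast
  have pM: "p \<in> M" using p(1) func_M by blast
  have "x \<in> ext (S p) \<longleftrightarrow> \<Gamma> x (S p)" if "x \<in> ext X" for x
    using p(2)[OF that] that t(2) SM(2)[OF pM] unfolding H_def by simp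
  then show ?thesis using SM[OF pM] by (intro bexI[of _ "S p"]) auto
qed

subsection \<open>The seed order\<close>

text \<open>A single set \<open>x\<close> of both sizes links the two classes: bijections are
  composed through \<open>x\<close>, without any arithmetic of the natural numbers of the model.
  This serves to show that two uniform ultrafilters with the same large sets have the same
  underlying set.\<close>

lemma subsets_of_size_subset:
  assumes "x \<in> subsets_of_size \<kappa> n" "x \<in> subsets_of_size \<kappa> m" and nM: "n \<in> M" and mM: "m \<in> M"
  shows "subsets_of_size \<kappa> n \<subseteq> subsets_of_size \<kappa> m"
proof
  fix a assume a: "a \<in> subsets_of_size \<kappa> n"
  obtain b where b: "func b n" "bij_betw (app b) (ext n) (ext a)" "a \<in> M" "ext a \<subseteq> ext \<kappa>"
    using a unfolding subsets_of_size_def by blast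
  obtain c where c: "func c n" "bij_betw (app c) (ext n) (ext x)"
    using assms(1) unfolding subsets_of_size_def by blast
  obtain d where d: "func d m" "bij_betw (app d) (ext m) (ext x)"
    using assms(2) unfolding subsets_of_size_def by blast
  have M: "b \<in> M" "c \<in> M" "d \<in> M" using b c d func_M by blast+
  let ?k = "inv_into (ext n) (app c)"
  have k: "bij_betw ?k (ext x) (ext n)" by (rule bij_betw_inv_into[OF c(2)])
  have dx: "app d i \<in> ext x" if "i \<in> ext m" for i using bij_betwE[OF d(2)] that by blast
  \<comment> \<open>\<open>e\<close> applies \<open>d\<close>, then the inverse of \<open>c\<close>,
    then \<open>b\<close>. It has to be a function of the model, so the inverse is described by a
    bounded quantifier instead of \<open>inv_into\<close>.\<close>
  have "\<exists>e. func e m \<and> (\<forall>i\<in>ext m. \<exists>k\<in>ext n. ap c k = ap d i \<and> ap e i = ap b k)"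
  proof (rule function_exists[OF mM])
    show "definable (\<lambda>s. \<exists>k\<in>ext n. ap c k = ap d (s 0) \<and> s 1 = ap b k)"
      by (intro definable_intros M nM)
    fix i assume i: "i \<in> ext m"
    have di: "ap d i = app d i" using func_ap[OF d(1) i] .
    have kn: "?k (app d i) \<in> ext n" using bij_betwE[OF k] dx[OF i] by blast
    have ck: "ap c (?k (app d i)) = ap d i"
      unfolding func_ap[OF c(1) kn] di by (rule bij_betw_inv_into_right[OF c(2) dx[OF i]])
    have un: "k = ?k (app d i)" if "k \<in> ext n" "ap c k = ap d i" for k
    proof -
      have "app c k = app d i" using that func_ap[OF c(1)] di by simp
      then show ?thesis using bij_betw_inv_into_left[OF c(2) that(1)] by simp
    qed
    show "\<exists>!y. y \<in> M \<and> (\<exists>k\<in>ext n. ap c k = ap d i \<and> y = ap b k)"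
    proof (rule ex1I[of _ "ap b (?k (app d i))"])
      show "ap b (?k (app d i)) \<in> M \<and> (\<exists>k\<in>ext n. ap c k = ap d i \<and> ap b (?k (app d i)) = ap b k)"
        using M(1) kn ck by (intro conjI bexI[of _ "?k (app d i)"]) simp_all
      fix y assume "y \<in> M \<and> (\<exists>k\<in>ext n. ap c k = ap d i \<and> y = ap b k)"
      then obtain k where "k \<in> ext n" "ap c k = ap d i" "y = ap b k" by blast
      then show "y = ap b (?k (app d i))" using un[of k] by simp
    qed
  qed
  then obtain e where e: "func e m" "\<And>i. i \<in> ext m \<Longrightarrow> \<exists>k\<in>ext n. ap c k = ap d i \<and> ap e i = ap b k"
    by blast
  have "app e i = (app b \<circ> ?k \<circ> app d) i" if i: "i \<in> ext m" for i
  proof -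
    obtain k where k: "k \<in> ext n" "ap c k = ap d i" "ap e i = ap b k" using e(2)[OF i] by blast
    then have "app c k = app d i" using func_ap[OF c(1)] func_ap[OF d(1) i] by simp
    then have "?k (app d i) = k" using bij_betw_inv_into_left[OF c(2) k(1)] by simp
    then show ?thesis using k(3) func_ap[OF e(1) i] func_ap[OF b(1) k(1)] by simp
  qed
  then have "bij_betw (app e) (ext m) (ext a) = bij_betw (app b \<circ> ?k \<circ> app d) (ext m) (ext a)"
    by (rule bij_betw_cong)
  then have "bij_betw (app e) (ext m) (ext a)"
    using bij_betw_trans[OF d(2) bij_betw_trans[OF k b(2)]] by (simp add: comp_assoc)
  then show "a \<in> subsets_of_size \<kappa> m" unfolding subsets_of_size_def using b(3,4) e(1) by blast
qed

section \<open>Comparisons of two ultrafilters\<close>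

abbreviation seed_image :: "'v \<Rightarrow> 'v \<Rightarrow> 'v" where
  "seed_image U W \<equiv> mem_structure.j (Ult U) (\<epsilon>) W (seed U)"

lemma ultrafilterI: "cc_ultrafilter_on X U \<Longrightarrow> ultrafilter M (\<epsilon>) X U"
  by (simp add: ultrafilter_def ultrafilter_axioms_def zfc_model_axioms)

text \<open>Evaluating a comparison: membership of \<open>A\<close> in \<open>U\<^sub>0\<close> is read off the image of the seed of \<open>U\<^sub>0\<close> in the
  common iterated ultrapower, where it can be computed on the side of \<open>U\<^sub>1\<close>.\<close>

lemma comparison_seed:
  assumes U0: "cc_ultrafilter_on X0 U0" and U1: "cc_ultrafilter_on X1 U1"
    and cmp: "comparison U0 U1 W0 W1" and A: "A \<in> M"
  shows "ultrafilter.ae M (\<epsilon>) X0 U0 (\<lambda>x. x \<in> ext A) \<longleftrightarrow>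
    seed_image U0 W0 \<epsilon> mem_structure.j (Ult U1) (\<epsilon>) W1 (j U1 A)"
proof -
  interpret A0: ultrafilter M E X0 U0 by (rule ultrafilterI[OF U0])
  interpret N0: zfc_model "Ult U0" E by (rule A0.zfc_Ult)
  obtain Y0 where "N0.cc_ultrafilter_on Y0 W0"
    using cmp unfolding comparison_def N0.cc_ultrafilter_def by blast
  then interpret B0: ultrafilter "Ult U0" E Y0 W0 by (rule N0.ultrafilterI)
  have "A0.ae (\<lambda>x. x \<in> ext A) \<longleftrightarrow> seed U0 \<epsilon> j U0 A" by (rule A0.seed_mem_j_iff[OF A, symmetric])
  also have "\<dots> \<longleftrightarrow> seed U0 \<in> N0.ext (j U0 A)" by (rule N0.ext_iff[OF A0.seed_Ult, symmetric])
  also have "\<dots> \<longleftrightarrow> N0.j W0 (seed U0) \<epsilon> N0.j W0 (j U0 A)"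
    by (rule B0.j_mem_iff[OF A0.seed_Ult A0.j_Ult[OF A], symmetric])
  also have "N0.j W0 (j U0 A) = mem_structure.j (Ult U1) (\<epsilon>) W1 (j U1 A)"
    using cmp A unfolding comparison_def by blast
  finally show ?thesis .
qed

lemma comparison_sym: "comparison U0 U1 W0 W1 \<Longrightarrow> comparison U1 U0 W1 W0"
  unfolding comparison_def by metis

text \<open>Both ultrafilters are then derived from the same embedding at the same point of the
  common iterated ultrapower.\<close>

lemma comparison_seed_eq:
  assumes U0: "cc_ultrafilter_on X0 U0" and U1: "cc_ultrafilter_on X1 U1"
    and cmp: "comparison U0 U1 W0 W1" and A: "A \<in> M"
    and eq: "seed_image U0 W0 = seed_image U1 W1"
  shows "ultrafilter.ae M (\<epsilon>) X0 U0 (\<lambda>x. x \<in> ext A) \<longleftrightarrow> ultrafilter.ae M (\<epsilon>) X1 U1 (\<lambda>x. x \<in> ext A)"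
proof -
  have "mem_structure.j (Ult U0) (\<epsilon>) W0 (j U0 A) = mem_structure.j (Ult U1) (\<epsilon>) W1 (j U1 A)"
    using cmp A unfolding comparison_def by blast
  then show ?thesis
    using comparison_seed[OF U0 U1 cmp A] comparison_seed[OF U1 U0 comparison_sym[OF cmp] A] eq by simp
qed

text \<open>In other words, \<open>U\<^sub>0\<close> lies below \<open>U\<^sub>1\<close> in the Ketonen order. The families \<open>{A. \<Theta> a A}\<close> come from representing \<open>W\<^sub>1\<close>, and a function representing the image of the
  seed of \<open>U\<^sub>0\<close>, modulo \<open>U\<^sub>1\<close>.\<close>

lemma comparison_seed_less:
  assumes U0: "cc_ultrafilter_on X0 U0" and U1: "cc_ultrafilter_on X1 U1"
    and cmp: "comparison U0 U1 W0 W1"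
    and less: "finset_less (seed_image U0 W0) (seed_image U1 W1)"
  obtains \<Theta> where "definable (\<lambda>s. \<Theta> (s 0) (s 1))"
    "\<And>A. A \<in> M \<Longrightarrow> ultrafilter.ae M (\<epsilon>) X0 U0 (\<lambda>x. x \<in> ext A) \<longleftrightarrow> ultrafilter.ae M (\<epsilon>) X1 U1 (\<lambda>a. \<Theta> a A)"
    "\<And>a A B. (\<And>z. finset_less z a \<Longrightarrow> z \<in> ext A \<longleftrightarrow> z \<in> ext B) \<Longrightarrow> \<Theta> a A = \<Theta> a B"
proof -
  interpret A0: ultrafilter M E X0 U0 by (rule ultrafilterI[OF U0])
  interpret A1: ultrafilter M E X1 U1 by (rule ultrafilterI[OF U1])
  interpret N0: zfc_model "Ult U0" E by (rule A0.zfc_Ult)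
  interpret N1: zfc_model "Ult U1" E by (rule A1.zfc_Ult)
  obtain Y0 where "N0.cc_ultrafilter_on Y0 W0"
    using cmp unfolding comparison_def N0.cc_ultrafilter_def by blast
  then interpret B0: ultrafilter "Ult U0" E Y0 W0 by (rule N0.ultrafilterI)
  obtain Y1 where "N1.cc_ultrafilter_on Y1 W1"
    using cmp unfolding comparison_def N1.cc_ultrafilter_def by blast
  then interpret B1: ultrafilter "Ult U1" E Y1 W1 by (rule N1.ultrafilterI)
  \<comment> \<open>The common iterated ultrapower is also the ultrapower of \<open>Ult U1\<close>
    by \<open>W1\<close>, so the image of the seed of \<open>U0\<close> is represented there by a
    function \<open>f\<close> that belongs to \<open>Ult U1\<close>.\<close>
  have "N0.j W0 (seed U0) \<in> N1.Ult W1"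
    using B0.j_Ult[OF A0.seed_Ult] cmp unfolding comparison_def by simp
  then obtain f where f: "N1.func f Y1" "N0.j W0 (seed U0) = B1.col f" unfolding B1.Ult_iff by blast
  have fN: "f \<in> Ult U1" using f(1) N1.func_M by blast

  let ?c = "N1.the_fn W1 (\<lambda>_. seed U1)"
  note c = B1.const_fn[OF A1.seed_Ult]
  \<comment> \<open>The iterated ultrapower is transitive in \<open>Ult U1\<close>, and
    \<open>Ult U1\<close> in \<open>M\<close>; hence for its elements the order on finite sets means
    the same in all three.\<close>
  have ext_N: "mem_structure.ext (N1.Ult W1) (\<epsilon>) u = ext u" if "u \<in> N1.Ult W1" for u
    using B1.ext_Ult[OF that] A1.ext_Ult[of u] B1.Ult_subset that by auto
  have "finset_less (B1.col f) (B1.col ?c)" using less f(2) B1.j_eq[of "seed U1"] by simp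
  then have "mem_structure.finset_less (N1.Ult W1) (\<epsilon>) (B1.col f) (B1.col ?c)"
    unfolding mem_structure.finset_less_def using f(1) c(1) ext_N B1.Ult_iff by metis
  then have f_less: "B1.ae (\<lambda>y. N1.finset_less (N1.ap f y) (seed U1))"
  proof -
    assume *: "mem_structure.finset_less (N1.Ult W1) (\<epsilon>) (B1.col f) (B1.col ?c)"
    define fs where "fs i = (if i = 0 then f else ?c)" for i :: nat
    have fs: "N1.func (fs i) Y1" for i unfolding fs_def using f(1) c(1) by simp
    have "mem_structure.finset_less (N1.Ult W1) E (B1.col (fs 0)) (B1.col (fs 1))"
      unfolding fs_def using * by simp
    then have "B1.ae (\<lambda>y. N1.finset_less (N1.ap (fs 0) y) (N1.ap (fs 1) y))"
      using B1.los[where P = "\<lambda>M s. mem_structure.finset_less M E (s 0) (s 1)" and fs = fs,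
          OF udef_finset_less fs]
      by simp
    moreover have "N1.ap (fs 1) y = seed U1" if "y \<in> N1.ext Y1" for y
      unfolding fs_def using c(2)[OF that] by simp
    ultimately show ?thesis
      using B1.ae_cong[of "\<lambda>y. N1.finset_less (N1.ap (fs 0) y) (N1.ap (fs 1) y)"
          "\<lambda>y. N1.finset_less (N1.ap f y) (seed U1)"] unfolding fs_def by simp
  qed

  \<comment> \<open>Variables 0 to 3 stand for \<open>W1\<close>, \<open>f\<close>, the image of
    \<open>A\<close> and the seed of \<open>U1\<close>. The formula says that on some set in
    \<open>W1\<close> the values of \<open>f\<close> lie in that image and below the seed. The bound
    is built in so that the condition pulled back to \<open>M\<close> sees only the part of
    \<open>A\<close> below \<open>a\<close>.\<close>
  let ?P = "\<lambda>M (s :: nat \<Rightarrow> 'v). \<exists>B\<in>M. B \<epsilon> s 0 \<and> (\<forall>y\<in>M. y \<epsilon> B \<longrightarrow> (\<exists>z\<in>M. z \<epsilon> s 2 \<and>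
    mem_structure.finset_less M E z (s 3) \<and> (\<exists>p\<in>M. p \<epsilon> s 1 \<and> mem_structure.opair M E p y z)))"
  have udef_P: "udefinable E ?P" by (intro udefinable_intros)

  have P_iff: "A0.ae (\<lambda>x. x \<in> ext A) \<longleftrightarrow>
      ?P (Ult U1) (\<lambda>i :: nat. if i = 0 then W1 else if i = 1 then f else if i = 2 then j U1 A else seed U1)"
    if A: "A \<in> M" for A
  proof -
    let ?A = "j U1 A"
    let ?R = "\<exists>B\<in>Ult U1. B \<epsilon> W1 \<and> (\<forall>y\<in>Ult U1. y \<epsilon> B \<longrightarrow> (\<exists>z\<in>Ult U1. z \<epsilon> j U1 A \<and>
        N1.finset_less z (seed U1) \<and> (\<exists>p\<in>Ult U1. p \<epsilon> f \<and> N1.opair p y z)))"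
    have AN: "?A \<in> Ult U1" by (rule A1.j_Ult[OF A])
    have "A0.ae (\<lambda>x. x \<in> ext A) \<longleftrightarrow> B1.col f \<epsilon> N1.j W1 ?A"
      using comparison_seed[OF U0 U1 cmp A] f(2) by simp
    also have "\<dots> \<longleftrightarrow> B1.ae (\<lambda>y. N1.ap f y \<in> N1.ext ?A)" by (rule B1.col_mem_j_iff[OF f(1) AN])
    also have "\<dots> \<longleftrightarrow> ?R"
    proof
      \<comment> \<open>The strict inequality of the images of the seeds, in the form
        \<open>f_less\<close>, allows the bound to be added.\<close>
      assume "B1.ae (\<lambda>y. N1.ap f y \<in> N1.ext ?A)"
      then have "B1.ae (\<lambda>y. N1.ap f y \<in> N1.ext ?A \<and> N1.finset_less (N1.ap f y) (seed U1))"
        by (rule B1.ae_conjI[OF _ f_less])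
      then have "N1.large W1 {y \<in> N1.ext Y1. N1.ap f y \<in> N1.ext ?A \<and> N1.finset_less (N1.ap f y) (seed U1)}"
        unfolding B1.ae_def .
      then obtain B where B: "B \<in> N1.ext W1"
        "N1.ext B = {y \<in> N1.ext Y1. N1.ap f y \<in> N1.ext ?A \<and> N1.finset_less (N1.ap f y) (seed U1)}"
        unfolding N1.large_def by blast
      have BN: "B \<in> Ult U1" "B \<epsilon> W1" using B(1) N1.ext_M N1.ext_iff by blast+
      have "\<exists>z\<in>Ult U1. z \<epsilon> ?A \<and> N1.finset_less z (seed U1) \<and> (\<exists>p\<in>Ult U1. p \<epsilon> f \<and> N1.opair p y z)"
        if y: "y \<in> Ult U1" "y \<epsilon> B" for y
      proof -
        have "y \<in> N1.ext B" using y N1.ext_iff by blast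
        then have yB: "y \<in> N1.ext Y1" "N1.ap f y \<in> N1.ext ?A" "N1.finset_less (N1.ap f y) (seed U1)"
          unfolding B(2) by blast+
        have fyN: "N1.ap f y \<in> Ult U1" using N1.ap_M[OF fN] .
        obtain p where p: "p \<in> N1.ext f" "N1.opair p y (N1.ap f y)"
          using N1.func_pair_iff[OF f(1) yB(1) fyN] by blast
        have "p \<in> Ult U1" "p \<epsilon> f" using p(1) N1.ext_M N1.ext_iff by blast+
        moreover have "N1.ap f y \<epsilon> ?A" using yB(2) N1.ext_iff[OF fyN] by blast
        ultimately show ?thesis using p(2) yB(3) fyN by blast
      qed
      then show ?R using BN by blast
    next
      assume ?R
      then obtain B where B: "B \<in> Ult U1" "B \<epsilon> W1" "\<And>y. y \<in> Ult U1 \<Longrightarrow> y \<epsilon> B \<Longrightarrow>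
        \<exists>z\<in>Ult U1. z \<epsilon> ?A \<and> N1.finset_less z (seed U1) \<and> (\<exists>p\<in>Ult U1. p \<epsilon> f \<and> N1.opair p y z)" by blast
      have BW: "B \<in> N1.ext W1" using B(1,2) N1.ext_iff by blast
      have "N1.large W1 (N1.ext B)" unfolding N1.large_def using BW by blast
      then show "B1.ae (\<lambda>y. N1.ap f y \<in> N1.ext ?A)"
        unfolding B1.ae_def
      proof (rule B1.large_mono)
        show "N1.ext B \<subseteq> {y \<in> N1.ext Y1. N1.ap f y \<in> N1.ext ?A}"
        proof
          fix y assume y: "y \<in> N1.ext B"
          then have yY: "y \<in> N1.ext Y1" using B1.U_subset[OF BW] by blast
          have "y \<in> Ult U1" "y \<epsilon> B" using y N1.ext_M N1.ext_iff by blast+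
          from B(3)[OF this] obtain z p where zp: "z \<in> Ult U1" "z \<epsilon> ?A" "p \<in> Ult U1" "p \<epsilon> f" "N1.opair p y z"
            by blast
          have "p \<in> N1.ext f" "z \<in> N1.ext ?A" using zp N1.ext_iff by blast+
          then have "z = N1.ap f y" using N1.func_pair_iff[OF f(1) yY zp(1)] zp(5) by blast
          then show "y \<in> {y \<in> N1.ext Y1. N1.ap f y \<in> N1.ext ?A}" using yY \<open>z \<in> N1.ext ?A\<close> by blast
        qed
        show "N1.is_set {y \<in> N1.ext Y1. N1.ap f y \<in> N1.ext ?A}"
          by (rule B1.is_set_Collect) (intro N1.definable_intros fN AN)
      qed blast
    qed
    finally show ?thesis by simp
  qed

  have W1N: "W1 \<in> Ult U1" by (rule B1.U_M)
  obtain w where w: "func w X1" "W1 = A1.col w" using W1N unfolding A1.Ult_iff by blast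
  obtain g where g: "func g X1" "f = A1.col g" using fN unfolding A1.Ult_iff by blast
  have M: "w \<in> M" "g \<in> M" using w(1) g(1) func_M by blast+
  \<comment> \<open>The same formula read at a point \<open>a\<close>: by Los, \<open>W1\<close>
    turns into \<open>ap w a\<close>, \<open>f\<close> into \<open>ap g a\<close>, the image of
    \<open>A\<close> into \<open>A\<close> itself, and the seed into \<open>a\<close>.\<close>
  define \<Theta> where "\<Theta> a A \<longleftrightarrow> (\<exists>B\<in>M. B \<epsilon> ap w a \<and> (\<forall>y\<in>M. y \<epsilon> B \<longrightarrow> (\<exists>z\<in>M. z \<epsilon> A \<and>
    finset_less z a \<and> (\<exists>p\<in>M. p \<epsilon> ap g a \<and> opair p y z))))" for a A
  show thesis
  proof (rule that)
    show "definable (\<lambda>s. \<Theta> (s 0) (s 1))" unfolding \<Theta>_def by (intro definable_intros M)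
    show "\<Theta> a A = \<Theta> a B" if "\<And>z. finset_less z a \<Longrightarrow> z \<in> ext A \<longleftrightarrow> z \<in> ext B" for a A B
    proof -
      have "(z \<epsilon> A \<and> finset_less z a \<and> Q) \<longleftrightarrow> (z \<epsilon> B \<and> finset_less z a \<and> Q)" if "z \<in> M" for z Q
        using \<open>\<And>z. finset_less z a \<Longrightarrow> z \<in> ext A \<longleftrightarrow> z \<in> ext B\<close>[of z] ext_iff[OF that] by blast
      then show ?thesis unfolding \<Theta>_def by (simp cong: bex_cong)
    qed
    fix A assume A: "A \<in> M"
    define fs where "fs i = (if i = 0 then w else if i = 1 then g else if i = 2 then the_fn U1 (\<lambda>_. A)
      else the_fn U1 (\<lambda>x. x))" for i :: nat
    have fs: "func (fs i) X1" for i
      unfolding fs_def using w(1) g(1) A1.const_fn(1)[OF A] A1.id_fn(1) by simp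
    have "A1.col (fs 0) = W1" "A1.col (fs 1) = f" "A1.col (fs 2) = j U1 A" "A1.col (fs 3) = seed U1"
      by (simp_all add: fs_def w(2) g(2) A1.j_eq A1.seed_eq)
    then have "A0.ae (\<lambda>x. x \<in> ext A) \<longleftrightarrow> ?P (Ult U1) (\<lambda>i. A1.col (fs i))" using P_iff[OF A] by simp
    also have "\<dots> \<longleftrightarrow> A1.ae (\<lambda>x. ?P M (\<lambda>i. ap (fs i) x))" by (rule A1.los[OF udef_P fs])
    also have "\<dots> \<longleftrightarrow> A1.ae (\<lambda>a. \<Theta> a A)"
    proof (rule A1.ae_cong)
      fix x assume x: "x \<in> ext X1"
      have "ap (fs 0) x = ap w x" "ap (fs 1) x = ap g x" "ap (fs 2) x = A" "ap (fs 3) x = x"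
        unfolding fs_def using A1.const_fn(2)[OF A x] A1.id_fn(2)[OF x] by simp_all
      then show "?P M (\<lambda>i. ap (fs i) x) = \<Theta> x A" unfolding \<Theta>_def by simp
    qed
    finally show "A0.ae (\<lambda>x. x \<in> ext A) \<longleftrightarrow> A1.ae (\<lambda>a. \<Theta> a A)" .
  qed
qed

text \<open>Two strict comparisons in opposite directions are refuted by diagonalisation: recursion along the well-founded
  order of finite sets of ordinals gives a set \<open>S\<^sub>0\<close> which lies in \<open>U\<^sub>0\<close> iff it does not.\<close>

lemma seed_less_asym:
  assumes U0: "cc_ultrafilter_on X0 U0" and U1: "cc_ultrafilter_on X1 U1"
    and \<kappa>: "ordinal \<kappa>" and X0: "\<And>a. a \<in> ext X0 \<Longrightarrow> finset a \<and> ext a \<subseteq> ext \<kappa>"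
    and X1: "\<And>a. a \<in> ext X1 \<Longrightarrow> finset a"
    and cmp: "comparison U0 U1 W0 W1" "comparison U1 U0 V1 V0"
    and less: "finset_less (seed_image U0 W0) (seed_image U1 W1)"
      "finset_less (seed_image U1 V1) (seed_image U0 V0)"
  shows False
proof -
  interpret A0: ultrafilter M E X0 U0 by (rule ultrafilterI[OF U0])
  interpret A1: ultrafilter M E X1 U1 by (rule ultrafilterI[OF U1])
  obtain \<Theta>1 where \<Theta>1: "definable (\<lambda>s. \<Theta>1 (s 0) (s 1))"
    "\<And>A. A \<in> M \<Longrightarrow> A0.ae (\<lambda>x. x \<in> ext A) \<longleftrightarrow> A1.ae (\<lambda>a. \<Theta>1 a A)"
    "\<And>a A B. (\<And>z. finset_less z a \<Longrightarrow> z \<in> ext A \<longleftrightarrow> z \<in> ext B) \<Longrightarrow> \<Theta>1 a A = \<Theta>1 a B"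
    using comparison_seed_less[OF U0 U1 cmp(1) less(1)] by blast
  obtain \<Theta>0 where \<Theta>0: "definable (\<lambda>s. \<Theta>0 (s 0) (s 1))"
    "\<And>A. A \<in> M \<Longrightarrow> A1.ae (\<lambda>x. x \<in> ext A) \<longleftrightarrow> A0.ae (\<lambda>a. \<Theta>0 a A)"
    "\<And>a A B. (\<And>z. finset_less z a \<Longrightarrow> z \<in> ext A \<longleftrightarrow> z \<in> ext B) \<Longrightarrow> \<Theta>0 a A = \<Theta>0 a B"
    using comparison_seed_less[OF U1 U0 cmp(2) less(2)] by blast
  have d1: "definable (\<lambda>s. \<Theta>1 (F s) (G s))" if "definable_fun F" "definable_fun G" for F G
    by (rule def_inst2[OF \<Theta>1(1) that])
  have d0: "definable (\<lambda>s. \<Theta>0 (F s) (G s))" if "definable_fun F" "definable_fun G" for F G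
    by (rule def_inst2[OF \<Theta>0(1) that])
  \<comment> \<open>\<open>C S\<close> is the set \<open>S\<^sub>1\<close> that belongs to
    \<open>S\<close> in the role of \<open>S\<^sub>0\<close>. As it is definable from
    \<open>S\<close>, the double recursion reduces to a recursion for \<open>S\<close>
    alone.\<close>
  define C where "C A = mk {a \<in> ext X1. \<not> \<Theta>1 a A}" for A
  have isC: "is_set {a \<in> ext X1. \<not> \<Theta>1 a A}" if "A \<in> M" for A
    by (rule A1.is_set_Collect) (intro definable_intros d1 that)
  have C: "C A \<in> M" "ext (C A) = {a \<in> ext X1. \<not> \<Theta>1 a A}" if "A \<in> M" for A
    unfolding C_def using isC[OF that] by simp_all
  have "\<exists>S\<in>M. ext S \<subseteq> ext X0 \<and> (\<forall>x\<in>ext X0. x \<in> ext S \<longleftrightarrow> \<Theta>0 x (C S))"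
  proof (rule subset_recursion[OF A0.X_M, where R = finset_less])
    show "definable (\<lambda>s. finset_less (s 0) (s 1))" by (intro definable_intros)
    show "\<exists>x\<in>ext B. \<forall>y\<in>ext B. \<not> finset_less y x" if "B \<in> M" "ext B \<subseteq> ext X0" "ext B \<noteq> {}" for B
      by (rule finset_less_wf[OF \<kappa> that(1,3)]) (use X0 that(2) in blast)
    have "definable (\<lambda>s. \<exists>B\<in>M. (\<forall>a\<in>M. a \<in> ext B \<longleftrightarrow> a \<in> ext X1 \<and> \<not> \<Theta>1 a (s 1)) \<and> \<Theta>0 (s 0) B)"
      by (intro definable_intros d1 d0 A1.X_M)
    then show "definable (\<lambda>s. \<Theta>0 (s 0) (C (s 1)))"
    proof (rule definable_cong)
      fix s :: "nat \<Rightarrow> 'v" assume "range s \<subseteq> M"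
      then have s: "s 1 \<in> M" by blast
      have "(\<forall>a\<in>M. a \<in> ext B \<longleftrightarrow> a \<in> ext X1 \<and> \<not> \<Theta>1 a (s 1)) \<longleftrightarrow> B = C (s 1)" if "B \<in> M" for B
        unfolding C_def eq_mk_iff[OF isC[OF s] that] by blast
      then have "(\<exists>B\<in>M. (\<forall>a\<in>M. a \<in> ext B \<longleftrightarrow> a \<in> ext X1 \<and> \<not> \<Theta>1 a (s 1)) \<and> \<Theta>0 (s 0) B) \<longleftrightarrow>
          (\<exists>B\<in>M. B = C (s 1) \<and> \<Theta>0 (s 0) B)"
        by (intro bex_cong refl) simp
      then show "\<Theta>0 (s 0) (C (s 1)) = (\<exists>B\<in>M. (\<forall>a\<in>M. a \<in> ext B \<longleftrightarrow> a \<in> ext X1 \<and> \<not> \<Theta>1 a (s 1)) \<and> \<Theta>0 (s 0) B)"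
        using C(1)[OF s] by simp
    qed
    fix x A B assume x: "x \<in> ext X0" and AB: "A \<in> M" "B \<in> M" "ext A \<subseteq> ext X0" "ext B \<subseteq> ext X0"
      and eq: "\<And>y. y \<in> ext X0 \<Longrightarrow> finset_less y x \<Longrightarrow> y \<in> ext A \<longleftrightarrow> y \<in> ext B"
    \<comment> \<open>The condition at \<open>x\<close> looks at \<open>C A\<close> below
      \<open>x\<close>, and membership of \<open>z\<close> in \<open>C A\<close> looks at
      \<open>A\<close> below \<open>z\<close>; by transitivity of the order only \<open>A\<close>
      below \<open>x\<close> is involved.\<close>
    show "\<Theta>0 x (C A) = \<Theta>0 x (C B)"
    proof (rule \<Theta>0(3))
      fix z assume z: "finset_less z x"
      have "\<Theta>1 z A = \<Theta>1 z B" if zX: "z \<in> ext X1"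
      proof (rule \<Theta>1(3))
        fix y assume y: "finset_less y z"
        have "finset_less y x" if "y \<in> ext X0"
          by (rule finset_less_trans[OF _ _ _ y z]) (use that zX x X0 X1 in blast)+
        then show "y \<in> ext A \<longleftrightarrow> y \<in> ext B" using eq AB(3,4) by blast
      qed
      then show "z \<in> ext (C A) \<longleftrightarrow> z \<in> ext (C B)" unfolding C(2)[OF AB(1)] C(2)[OF AB(2)] by blast
    qed
  qed
  then obtain S where S: "S \<in> M" "\<And>x. x \<in> ext X0 \<Longrightarrow> x \<in> ext S \<longleftrightarrow> \<Theta>0 x (C S)" by blast
  have "A0.ae (\<lambda>x. x \<in> ext S) \<longleftrightarrow> A1.ae (\<lambda>a. \<Theta>1 a S)" by (rule \<Theta>1(2)[OF S(1)])
  also have "\<dots> \<longleftrightarrow> \<not> A1.ae (\<lambda>a. \<not> \<Theta>1 a S)"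
  proof -
    have "definable (\<lambda>s. \<Theta>1 (s 0) S)" by (intro d1 definable_intros S(1))
    from A1.ae_not[OF this] show ?thesis by blast
  qed
  also have "A1.ae (\<lambda>a. \<not> \<Theta>1 a S) \<longleftrightarrow> A1.ae (\<lambda>a. a \<in> ext (C S))"
    by (rule A1.ae_cong) (simp add: C(2)[OF S(1)])
  also have "\<dots> \<longleftrightarrow> A0.ae (\<lambda>x. \<Theta>0 x (C S))" by (rule \<Theta>0(2)[OF C(1)[OF S(1)]])
  also have "\<dots> \<longleftrightarrow> A0.ae (\<lambda>x. x \<in> ext S)" by (rule A0.ae_cong) (simp add: S(2))
  finally show False by blast
qed

section \<open>Uniform ultrafilters are determined by their large sets\<close>

lemma uniform_le:
  assumes U0: "cc_ultrafilter_on X0 U0" and U1: "cc_ultrafilter_on X1 U1"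
    and X0: "ext X0 = subsets_of_size \<kappa>0 n0" and X1: "ext X1 = subsets_of_size \<kappa>1 n1"
    and \<kappa>1: "ordinal \<kappa>1" and min: "\<And>\<alpha>. \<alpha> \<in> ext \<kappa>1 \<Longrightarrow> \<not> large U1 (subsets_of_size \<alpha> n1)"
    and ae: "ultrafilter.ae M (\<epsilon>) X1 U1 (\<lambda>x. x \<in> ext X0)"
  shows "\<kappa>0 \<notin> ext \<kappa>1"
proof
  assume k: "\<kappa>0 \<in> ext \<kappa>1"
  interpret A1: ultrafilter M E X1 U1 by (rule ultrafilterI[OF U1])
  have sub: "ext \<kappa>0 \<subseteq> ext \<kappa>1" using ordinal_trans[OF \<kappa>1 k] by blast
  \<comment> \<open>Elements common to \<open>X0\<close> and \<open>X1\<close> are subsets of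
    \<open>\<kappa>0\<close> of size \<open>n1\<close>, so \<open>U1\<close> would concentrate on a
    class that the minimality of \<open>\<kappa>1\<close> excludes.\<close>
  have eq: "{x \<in> ext X1. ext x \<subseteq> ext \<kappa>0} = subsets_of_size \<kappa>0 n1"
    unfolding X1 subsets_of_size_def using sub by blast
  have "A1.ae (\<lambda>x. ext x \<subseteq> ext \<kappa>0)"
  proof (rule A1.ae_mono[OF ae])
    show "definable (\<lambda>s. ext (s 0) \<subseteq> ext \<kappa>0)" by (intro definable_intros ext_M[OF k])
  qed (simp add: X0 subsets_of_size_def)
  then have "large U1 (subsets_of_size \<kappa>0 n1)" unfolding A1.ae_def eq .
  then show False using min[OF k] by blast
qed

text \<open>Agreement is assumed for all sets \<open>A\<close> of the model, not just for subsets of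
  a common space. Applied to the spaces themselves it shows that each ultrafilter concentrates on
  the space of the other; minimality then gives the same \<open>\<kappa>\<close>, and a common
  element gives the same space.\<close>

lemma uniform_eqI:
  assumes "uniform_ultrafilter U0" "uniform_ultrafilter U1"
    and eq: "\<And>X0 X1 A. cc_ultrafilter_on X0 U0 \<Longrightarrow> cc_ultrafilter_on X1 U1 \<Longrightarrow> A \<in> M \<Longrightarrow>
      ultrafilter.ae M (\<epsilon>) X0 U0 (\<lambda>x. x \<in> ext A) \<longleftrightarrow> ultrafilter.ae M (\<epsilon>) X1 U1 (\<lambda>x. x \<in> ext A)"
  shows "U0 = U1"
proof -
  obtain \<kappa>0 n0 w0 X0 where 0: "ordinal \<kappa>0" "omega w0" "n0 \<in> ext w0" "ext X0 = subsets_of_size \<kappa>0 n0"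
    "cc_ultrafilter_on X0 U0" "\<And>\<alpha>. \<alpha> \<in> ext \<kappa>0 \<Longrightarrow> \<not> large U0 (subsets_of_size \<alpha> n0)"
    using assms(1) unfolding uniform_ultrafilter_def by blast
  obtain \<kappa>1 n1 w1 X1 where 1: "ordinal \<kappa>1" "omega w1" "n1 \<in> ext w1" "ext X1 = subsets_of_size \<kappa>1 n1"
    "cc_ultrafilter_on X1 U1" "\<And>\<alpha>. \<alpha> \<in> ext \<kappa>1 \<Longrightarrow> \<not> large U1 (subsets_of_size \<alpha> n1)"
    using assms(2) unfolding uniform_ultrafilter_def by blast
  interpret A0: ultrafilter M E X0 U0 by (rule ultrafilterI[OF 0(5)])
  interpret A1: ultrafilter M E X1 U1 by (rule ultrafilterI[OF 1(5)])
  note eq = eq[OF 0(5) 1(5)]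
  have ae0: "A0.ae (\<lambda>x. x \<in> ext X1)" using eq[OF A1.X_M] A1.ae_all[of "\<lambda>x. x \<in> ext X1"] by blast
  have ae1: "A1.ae (\<lambda>x. x \<in> ext X0)" using eq[OF A0.X_M] A0.ae_all[of "\<lambda>x. x \<in> ext X0"] by blast
  have \<kappa>: "\<kappa>0 = \<kappa>1"
    using ordinal_linear[OF 0(1) 1(1)] uniform_le[OF 0(5) 1(5) 0(4) 1(4) 1(1,6) ae1]
      uniform_le[OF 1(5) 0(5) 1(4) 0(4) 0(1,6) ae0] by blast
  obtain x where x: "x \<in> ext X0" "x \<in> ext X1" using A0.ae_ex[OF ae0] by blast
  have "ext X0 = ext X1"
    unfolding 0(4) 1(4) \<kappa>
    using subsets_of_size_subset[of x \<kappa>1 n0 n1] subsets_of_size_subset[of x \<kappa>1 n1 n0] x 0(4) 1(4) \<kappa>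
      ext_M[OF 0(3)] ext_M[OF 1(3)] by blast
  then have X: "X0 = X1" by (rule extensionality[OF A0.X_M A1.X_M])
  show "U0 = U1"
  proof (rule extI[OF A0.U_M A1.U_M])
    fix A assume A: "A \<in> M"
    have 2: "A \<in> ext U0 \<longleftrightarrow> A0.ae (\<lambda>x. x \<in> ext A)" "A \<in> ext U1 \<longleftrightarrow> A1.ae (\<lambda>x. x \<in> ext A)"
      if sub: "ext A \<subseteq> ext X0"
    proof -
      have "{x \<in> ext X0. x \<in> ext A} = ext A" "{x \<in> ext X1. x \<in> ext A} = ext A" using sub X by blast+
      then show "A \<in> ext U0 \<longleftrightarrow> A0.ae (\<lambda>x. x \<in> ext A)" "A \<in> ext U1 \<longleftrightarrow> A1.ae (\<lambda>x. x \<in> ext A)"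
        unfolding A0.ae_def A1.ae_def using A0.large_iff[OF is_set_ext[OF A]] A1.large_iff[OF is_set_ext[OF A]] A
        by simp_all
    qed
    show "A \<in> ext U0 \<longleftrightarrow> A \<in> ext U1"
    proof (cases "ext A \<subseteq> ext X0")
      case True
      then show ?thesis using 2 eq[OF A] by blast
    next
      case False
      then show ?thesis using A0.U_subset A1.U_subset X by blast
    qed
  qed
qed

lemma uniform_space:
  assumes "uniform_ultrafilter U"
  obtains X \<kappa> where "cc_ultrafilter_on X U" "ordinal \<kappa>" "\<forall>a\<in>ext X. finset a \<and> ext a \<subseteq> ext \<kappa>"
proof -
  obtain \<kappa> n w X where *: "ordinal \<kappa>" "omega w" "n \<in> ext w" "ext X = subsets_of_size \<kappa> n"
    "cc_ultrafilter_on X U"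
    using assms unfolding uniform_ultrafilter_def by blast
  have "finset a \<and> ext a \<subseteq> ext \<kappa>" if "a \<in> ext X" for a
  proof -
    have a: "a \<in> subsets_of_size \<kappa> n" using that *(4) by simp
    then show ?thesis using finset_subsets_of_size[OF *(2,3,1) a] unfolding subsets_of_size_def by blast
  qed
  then show thesis using that *(1,5) by blast
qed

lemma seed_le_antisym:
  assumes U0: "uniform_ultrafilter U0" and U1: "uniform_ultrafilter U1"
    and le: "seed_le U0 U1" and ge: "seed_le U1 U0"
  shows "U0 = U1"
proof -
  obtain W0 W1 where W: "comparison U0 U1 W0 W1"
    "finset_le (seed_image U0 W0) (seed_image U1 W1)"
    using le unfolding seed_le_def by blast
  obtain V1 V0 where V: "comparison U1 U0 V1 V0"
    "finset_le (seed_image U1 V1) (seed_image U0 V0)"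
    using ge unfolding seed_le_def by blast
  obtain X0 \<kappa>0 where X0: "cc_ultrafilter_on X0 U0" "ordinal \<kappa>0"
    "\<forall>a\<in>ext X0. finset a \<and> ext a \<subseteq> ext \<kappa>0" by (rule uniform_space[OF U0])
  obtain X1 \<kappa>1 where X1: "cc_ultrafilter_on X1 U1" "ordinal \<kappa>1"
    "\<forall>a\<in>ext X1. finset a \<and> ext a \<subseteq> ext \<kappa>1" by (rule uniform_space[OF U1])
  consider
    "seed_image U0 W0 = seed_image U1 W1"
    | "seed_image U1 V1 = seed_image U0 V0"
    | "finset_less (seed_image U0 W0) (seed_image U1 W1)"
      "finset_less (seed_image U1 V1) (seed_image U0 V0)"
    using W(2) V(2) unfolding finset_le_def by blast
  then show ?thesis
  proof cases
    case 1
    show ?thesis by (rule uniform_eqI[OF U0 U1]) (rule comparison_seed_eq[OF _ _ W(1) _ 1])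
  next
    case 2
    have "U1 = U0" by (rule uniform_eqI[OF U1 U0]) (rule comparison_seed_eq[OF _ _ V(1) _ 2])
    then show ?thesis by simp
  next
    case 3
    have "finset a" if "a \<in> ext X1" for a using X1(3) that by blast
    from seed_less_asym[OF X0(1) X1(1) X0(2) bspec[OF X0(3)] this W(1) V(1) 3] show ?thesis ..
  qed
qed

end

theorem theorem3p9:
  fixes V :: "'v set" and E :: "'v \<Rightarrow> 'v \<Rightarrow> bool" and U\<^sub>0 U\<^sub>1 :: 'v
  assumes "zfc_model V E"
    and "mem_structure.ultrapower_axiom V E"
    and "mem_structure.uniform_ultrafilter V E U\<^sub>0"
    and "mem_structure.uniform_ultrafilter V E U\<^sub>1"
    and "mem_structure.seed_le V E U\<^sub>0 U\<^sub>1"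
    and "mem_structure.seed_le V E U\<^sub>1 U\<^sub>0"
  shows "U\<^sub>0 = U\<^sub>1"
  by (rule zfc_model.seed_le_antisym[OF assms(1,3-6)])

end
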